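(* Let $\Sigma$ be a closed surface. For any Riemannian metric $g_0\in\mathcal{R}(\Sigma)$ and any point $p\in\Sigma$ there exists a sequence $(g_n)_{n\ge 1}\subset\mathcal{R}(\Sigma)$ of metrics, each isometric to $g_0$ (so that the $g_n$ are pairwise isometric), which concentrates to $p$. In particular the metrics $g_n$ are isospectral, i.e. the Laplace operators $\Delta_{g_n}$ all have the same spectrum (with multiplicities).
   Context: A closed surface is a compact connected smooth surface without boundary. $\mathcal{R}(\Sigma)$ denotes the space of smooth Riemannian metrics on $\Sigma$ of total area one, and $dg$ denotes the Riemannian area measure of $g$. A sequence $(g_n)\subset\mathcal{R}(\Sigma)$ concentrates to the point $p\in\Sigma$ if for each neighborhood $\mathcal{O}$ of $p$, $\lim_{n\to\infty}\int_{\mathcal{O}}dg_n=1$. Two metrics $g,g'$ on $\Sigma$ are isometric if $g'=\varphi^*g$ for some diffeomorphism $\varphi:\Sigma\to\Sigma$. *)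

theory Defs
  imports "HOL-Analysis.Analysis" "HOL-Library.Function_Algebras" "HOL-Library.Extended_Nat"
begin

section \<open>Smooth functions between normed spaces\<close>

(* Meant for open S. A map is C^(n+1) on S iff it is differentiable on S and all its
   directional derivatives are C^n on S. *)
primrec Ck_on :: "nat \<Rightarrow> ('v::real_normed_vector \<Rightarrow> 'w::real_normed_vector) \<Rightarrow> 'v set \<Rightarrow> bool" where
  "Ck_on 0 f S \<longleftrightarrow> continuous_on S f"
| "Ck_on (Suc n) f S \<longleftrightarrow>
     (\<forall>x\<in>S. f differentiable (at x)) \<and> (\<forall>v. Ck_on n (\<lambda>x. frechet_derivative f (at x) v) S)"

definition smooth_on :: "('v::real_normed_vector \<Rightarrow> 'w::real_normed_vector) \<Rightarrow> 'v set \<Rightarrow> bool" where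
  "smooth_on f S \<longleftrightarrow> (\<forall>n. Ck_on n f S)"

section \<open>Closed surfaces\<close>

(* A chart (U, c) consists of its domain and its coordinate map; c is irrelevant off U. *)
type_synonym 'a chart = "'a set \<times> ('a \<Rightarrow> real^2)"

abbreviation chart_dom :: "'a chart \<Rightarrow> 'a set" where
  "chart_dom \<equiv> fst"

abbreviation coord :: "'a chart \<Rightarrow> 'a \<Rightarrow> real^2" where
  "coord \<equiv> snd"

abbreviation chart_img :: "'a chart \<Rightarrow> (real^2) set" where
  "chart_img c \<equiv> coord c ` chart_dom c"

definition chart_inv :: "'a chart \<Rightarrow> real^2 \<Rightarrow> 'a" where
  "chart_inv c = inv_into (chart_dom c) (coord c)"

definition is_chart :: "'a topology \<Rightarrow> 'a chart \<Rightarrow> bool" where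
  "is_chart X c \<longleftrightarrow> openin X (chart_dom c) \<and> open (chart_img c) \<and>
     homeomorphic_map (subtopology X (chart_dom c)) (top_of_set (chart_img c)) (coord c)"

definition smooth_atlas :: "'a topology \<Rightarrow> 'a chart set \<Rightarrow> bool" where
  "smooth_atlas X A \<longleftrightarrow>
     (\<forall>c\<in>A. is_chart X c) \<and> (\<Union>c\<in>A. chart_dom c) = topspace X \<and>
     (\<forall>c\<in>A. \<forall>d\<in>A. smooth_on (coord d \<circ> chart_inv c) (coord c ` (chart_dom c \<inter> chart_dom d)))"

(* Second countability is automatic: X is compact and covered by chart domains.
   The atlas A need not be maximal; it determines the smooth structure. *)
definition closed_surface :: "'a topology \<Rightarrow> 'a chart set \<Rightarrow> bool" where
  "closed_surface X A \<longleftrightarrow>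
     Hausdorff_space X \<and> compact_space X \<and> connected_space X \<and> smooth_atlas X A"

definition chart_at :: "'a chart set \<Rightarrow> 'a \<Rightarrow> 'a chart" where
  "chart_at A x = (SOME c. c \<in> A \<and> x \<in> chart_dom c)"

definition smooth_self_map :: "'a topology \<Rightarrow> 'a chart set \<Rightarrow> ('a \<Rightarrow> 'a) \<Rightarrow> bool" where
  "smooth_self_map X A \<phi> \<longleftrightarrow> continuous_map X X \<phi> \<and>
     (\<forall>c\<in>A. \<forall>d\<in>A. smooth_on (coord d \<circ> \<phi> \<circ> chart_inv c)
        (coord c ` {x \<in> chart_dom c. \<phi> x \<in> chart_dom d}))"

definition diffeomorphism :: "'a topology \<Rightarrow> 'a chart set \<Rightarrow> ('a \<Rightarrow> 'a) \<Rightarrow> bool" where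
  "diffeomorphism X A \<phi> \<longleftrightarrow> bij_betw \<phi> (topspace X) (topspace X) \<and>
     smooth_self_map X A \<phi> \<and> smooth_self_map X A (inv_into (topspace X) \<phi>)"

definition smooth_function :: "'a chart set \<Rightarrow> ('a \<Rightarrow> real) \<Rightarrow> bool" where
  "smooth_function A f \<longleftrightarrow> (\<forall>c\<in>A. smooth_on (f \<circ> chart_inv c) (chart_img c))"

section \<open>Riemannian metrics\<close>

(* A covariant 2-tensor field g is given by its components: g c x is the matrix, at the
   point x of chart_dom c, of the bilinear form with respect to the coordinate frame of c.
   Only the values for c in the atlas and x in chart_dom c matter. *)
type_synonym 'a tensor2 = "'a chart \<Rightarrow> 'a \<Rightarrow> real^2^2"

definition riemannian_metric :: "'a chart set \<Rightarrow> 'a tensor2 \<Rightarrow> bool" where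
  "riemannian_metric A g \<longleftrightarrow>
     (\<forall>c\<in>A. smooth_on (g c \<circ> chart_inv c) (chart_img c)) \<and>
     (\<forall>c\<in>A. \<forall>x\<in>chart_dom c.
        transpose (g c x) = g c x \<and> (\<forall>v. v \<noteq> 0 \<longrightarrow> v \<bullet> (g c x *v v) > 0)) \<and>
     (\<forall>c\<in>A. \<forall>d\<in>A. \<forall>x\<in>chart_dom c \<inter> chart_dom d.
        let J = jacobian (coord d \<circ> chart_inv c) (at (coord c x))
        in g c x = transpose J ** g d x ** J)"

definition borel_sets :: "'a topology \<Rightarrow> 'a set set" where
  "borel_sets X = sigma_sets (topspace X) {U. openin X U}"

(* The unique Borel measure that equals sqrt (det g) dy in every chart. *)
definition area_measure :: "'a topology \<Rightarrow> 'a chart set \<Rightarrow> 'a tensor2 \<Rightarrow> 'a measure" where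
  "area_measure X A g = (THE \<mu>. space \<mu> = topspace X \<and> sets \<mu> = borel_sets X \<and>
     (\<forall>c\<in>A. \<forall>B\<in>borel_sets X. B \<subseteq> chart_dom c \<longrightarrow>
        emeasure \<mu> B = (\<integral>\<^sup>+y\<in>coord c ` B. ennreal (sqrt (det (g c (chart_inv c y)))) \<partial>lborel)))"

definition unit_area_metrics :: "'a topology \<Rightarrow> 'a chart set \<Rightarrow> 'a tensor2 set" where
  "unit_area_metrics X A =
     {g. riemannian_metric A g \<and> emeasure (area_measure X A g) (topspace X) = 1}"

definition pullback :: "'a chart set \<Rightarrow> ('a \<Rightarrow> 'a) \<Rightarrow> 'a tensor2 \<Rightarrow> 'a tensor2" where
  "pullback A \<phi> g = (\<lambda>c x.
     let d = chart_at A (\<phi> x); J = jacobian (coord d \<circ> \<phi> \<circ> chart_inv c) (at (coord c x))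
     in transpose J ** g d (\<phi> x) ** J)"

definition isometric :: "'a topology \<Rightarrow> 'a chart set \<Rightarrow> 'a tensor2 \<Rightarrow> 'a tensor2 \<Rightarrow> bool" where
  "isometric X A g g' \<longleftrightarrow>
     (\<exists>\<phi>. diffeomorphism X A \<phi> \<and> (\<forall>c\<in>A. \<forall>x\<in>chart_dom c. g' c x = pullback A \<phi> g c x))"

(* Neighbourhoods need not be open, but must be Borel for their area to be meaningful. *)
definition concentrates_to ::
    "'a topology \<Rightarrow> 'a chart set \<Rightarrow> (nat \<Rightarrow> 'a tensor2) \<Rightarrow> 'a \<Rightarrow> bool" where
  "concentrates_to X A gs p \<longleftrightarrow>
     (\<forall>N\<in>borel_sets X. (\<exists>U. openin X U \<and> p \<in> U \<and> U \<subseteq> N) \<longrightarrow>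
        (\<lambda>n. emeasure (area_measure X A (gs n)) N) \<longlonglongrightarrow> 1)"

section \<open>The Laplace operator and its spectrum\<close>

definition partial_deriv :: "2 \<Rightarrow> (real^2 \<Rightarrow> real) \<Rightarrow> real^2 \<Rightarrow> real" where
  "partial_deriv i u y = frechet_derivative u (at y) (axis i 1)"

(* - div grad u for the metric G on an open subset of the plane *)
definition coord_laplacian :: "(real^2 \<Rightarrow> real^2^2) \<Rightarrow> (real^2 \<Rightarrow> real) \<Rightarrow> real^2 \<Rightarrow> real" where
  "coord_laplacian G u y = - (1 / sqrt (det (G y))) *
     (\<Sum>i\<in>UNIV. partial_deriv i
        (\<lambda>z. sqrt (det (G z)) * (\<Sum>j\<in>UNIV. matrix_inv (G z) $ i $ j * partial_deriv j u z)) y)"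

definition laplacian :: "'a chart set \<Rightarrow> 'a tensor2 \<Rightarrow> ('a \<Rightarrow> real) \<Rightarrow> 'a \<Rightarrow> real" where
  "laplacian A g f x =
     (let c = chart_at A x in coord_laplacian (g c \<circ> chart_inv c) (f \<circ> chart_inv c) (coord c x))"

(* Functions on the surface are represented by their extension by 0, so that distinct
   elements are distinct functions on the surface. *)
definition eigenspace ::
    "'a topology \<Rightarrow> 'a chart set \<Rightarrow> 'a tensor2 \<Rightarrow> real \<Rightarrow> ('a \<Rightarrow> real) set" where
  "eigenspace X A g l = {f. smooth_function A f \<and> (\<forall>x. x \<notin> topspace X \<longrightarrow> f x = 0) \<and>
     (\<forall>x\<in>topspace X. laplacian A g f x = l * f x)}"

definition spectrum :: "'a topology \<Rightarrow> 'a chart set \<Rightarrow> 'a tensor2 \<Rightarrow> real set" where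
  "spectrum X A g = {l. \<exists>f\<in>eigenspace X A g l. f \<noteq> (\<lambda>x. 0)}"

(* The dimension of the eigenspace, as a supremum in enat so that a finite value
   never stands for an infinite-dimensional space. *)
definition multiplicity :: "'a topology \<Rightarrow> 'a chart set \<Rightarrow> 'a tensor2 \<Rightarrow> real \<Rightarrow> enat" where
  "multiplicity X A g l = (SUP B \<in> {B. finite B \<and> B \<subseteq> eigenspace X A g l \<and>
     \<not> module.dependent (\<lambda>(a::real) f x. a * f x) B}. enat (card B))"

definition isospectral :: "'a topology \<Rightarrow> 'a chart set \<Rightarrow> 'a tensor2 \<Rightarrow> 'a tensor2 \<Rightarrow> bool" where
  "isospectral X A g g' \<longleftrightarrow> spectrum X A g = spectrum X A g' \<and>
     (\<forall>l\<in>spectrum X A g. multiplicity X A g l = multiplicity X A g' l)"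

end

theory Submission
  imports Defs
begin

text \<open>If \<open>g\<^sub>n = \<phi>\<^sub>n\<^sup>* g\<^sub>0\<close> for a diffeomorphism \<open>\<phi>\<^sub>n\<close>, then the \<open>g\<^sub>n\<close>-area of a set \<open>N\<close> is the
  \<open>g\<^sub>0\<close>-area of \<open>\<phi>\<^sub>n(N)\<close> (\<open>area_measure_pulls_back\<close>), and passing from \<open>g\<^sub>0\<close> to \<open>g\<^sub>n\<close> changes neither
  the total area nor the spectrum (\<open>isometric_imp_isospectral\<close>). So concentration at \<open>p\<close> is a question
  about diffeomorphisms: a prescribed neighbourhood of \<open>p\<close>, however small, has to be spread over
  the whole surface up to a set of small area (\<open>fillable_topspace\<close>).

  This is done by moves inside chart discs. In a ball of the plane there is a diffeomorphism that
  is the identity outside the ball, fixes the centre \<open>q\<close> and moves all other points of the ball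
  outwards; its iterates expand any neighbourhood of \<open>q\<close> until only a set of small area is left
  over near the boundary of the ball (\<open>expanding_diffeomorphism_ball\<close>, \<open>expand_in_chart_disc\<close>).
  Outside the ball nothing moves, hence no area that was covered before is lost there. Starting at \<open>p\<close>, one
  therefore fills one disc of a finite cover after the other. The next disc can always be
  chosen to meet the part that is already filled, because the surface is connected; and if
  the part missing so far has less area than the intersection, then the spread-out
  neighbourhood does reach into the next disc, and can be expanded from a point in there
  (\<open>fillable_Un_disc\<close>).

  Area and Laplacian are given by coordinate formulas, and both must be seen to be compatible
  with pullbacks. For the area this is the change of variables formula; with the identity as the
  diffeomorphism it also shows that the formulas in different charts fit together, so that the area
  measure exists. For the Laplacian, the vector field whose divergence it takes is
  transformed, up to a sign, by the transposed cofactor matrix of the Jacobian, and the rows of the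
  cofactor matrix are divergence free since second derivatives commute (\<open>coord_laplacian_pullback\<close>).\<close>

section \<open>Finitely often differentiable functions\<close>

lemma Ck_on_continuous_on: "Ck_on n f S \<Longrightarrow> continuous_on S f"
  by (cases n)
    (auto intro!: continuous_at_imp_continuous_on differentiable_imp_continuous_within)

lemma Ck_on_subset: "Ck_on n f S \<Longrightarrow> T \<subseteq> S \<Longrightarrow> Ck_on n f T"
  by (induction n arbitrary: f) (auto intro: continuous_on_subset)

lemma Ck_on_SucD: "Ck_on (Suc n) f S \<Longrightarrow> Ck_on n f S"
proof (induction n arbitrary: f)
  case 0
  then show ?case using Ck_on_continuous_on[of "Suc 0"] by (simp only: Ck_on.simps(1))
qed auto

lemma frechet_derivative_eqI: "(f has_derivative f') (at x) \<Longrightarrow> frechet_derivative f (at x) = f'"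
  using frechet_derivative_at by metis

lemma frechet_derivative_local:
  assumes "open S" "x \<in> S" "\<And>y. y \<in> S \<Longrightarrow> f y = g y"
  shows "frechet_derivative f (at x) = frechet_derivative g (at x)"
proof -
  have "(f has_derivative f') (at x) \<longleftrightarrow> (g has_derivative f') (at x)" for f'
    using assms has_derivative_transform_within_open[of f f' x UNIV S g]
      has_derivative_transform_within_open[of g f' x UNIV S f] by auto
  then show ?thesis unfolding frechet_derivative_def by simp
qed

lemma differentiable_local:
  assumes "open S" "x \<in> S" "\<And>y. y \<in> S \<Longrightarrow> f y = g y" "f differentiable (at x)"
  shows "g differentiable (at x)"
  using assms has_derivative_transform_within_open[of f _ x UNIV S g]
  unfolding differentiable_def by blast

lemma Ck_on_cong:
  assumes "open S" "\<And>x. x \<in> S \<Longrightarrow> f x = g x" "Ck_on n f S"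
  shows "Ck_on n g S"
  using assms(2,3)
proof (induction n arbitrary: f g)
  case 0
  then show ?case using continuous_on_cong[of S S f g] by auto
next
  case (Suc n)
  have "Ck_on n (\<lambda>x. frechet_derivative g (at x) v) S" for v
  proof (rule Suc.IH)
    show "frechet_derivative f (at x) v = frechet_derivative g (at x) v" if "x \<in> S" for x
      using frechet_derivative_local[OF assms(1) that Suc.prems(1)] by simp
    show "Ck_on n (\<lambda>x. frechet_derivative f (at x) v) S" using Suc.prems(2) by simp
  qed
  moreover have "g differentiable (at x)" if "x \<in> S" for x
    by (rule differentiable_local[OF assms(1) that Suc.prems(1)]) (use Suc.prems(2) that in auto)
  ultimately show ?case by auto
qed

text \<open>Differentiability of any order is a local property, although the definition of
  \<^const>\<open>Ck_on\<close> refers to the whole set; this is what makes it possible to check the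
  smoothness of a map between surfaces chart by chart.\<close>

lemma Ck_on_local:
  assumes "\<And>x. x \<in> S \<Longrightarrow> \<exists>T. open T \<and> x \<in> T \<and> Ck_on n f T"
  shows "Ck_on n f S"
  using assms
proof (induction n arbitrary: f)
  case 0
  have "isCont f x" if "x \<in> S" for x
    using 0[OF that] by (auto simp: continuous_on_eq_continuous_at)
  then show ?case by (simp add: continuous_at_imp_continuous_on)
next
  case (Suc n)
  have "Ck_on n (\<lambda>x. frechet_derivative f (at x) v) S" for v
    using Suc.prems by (intro Suc.IH) fastforce
  moreover have "f differentiable (at x)" if "x \<in> S" for x
    using Suc.prems[OF that] by auto
  ultimately show ?case by auto
qed

lemma Ck_on_SucI:
  assumes "open S" "\<And>x. x \<in> S \<Longrightarrow> (f has_derivative f' x) (at x)"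
    and "\<And>v. Ck_on n (\<lambda>x. f' x v) S"
  shows "Ck_on (Suc n) f S"
proof -
  have "Ck_on n (\<lambda>x. frechet_derivative f (at x) v) S" for v
    by (rule Ck_on_cong[OF assms(1) _ assms(3)[of v]])
      (simp add: frechet_derivative_eqI[OF assms(2)])
  then show ?thesis using assms(2) by (auto simp: differentiable_def)
qed

lemma Ck_on_Suc_has_derivative:
  "Ck_on (Suc n) f S \<Longrightarrow> x \<in> S \<Longrightarrow> (f has_derivative frechet_derivative f (at x)) (at x)"
  using frechet_derivative_works by auto

lemma Ck_on_const: "Ck_on n (\<lambda>x. c) S"
  by (induction n arbitrary: c) auto

lemma Ck_on_linear:
  assumes "open S" "bounded_linear L" "Ck_on n f S"
  shows "Ck_on n (\<lambda>x. L (f x)) S"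
  using assms(3)
proof (induction n arbitrary: f)
  case 0
  then show ?case using bounded_linear.continuous_on[OF assms(2)] by auto
next
  case (Suc n)
  show ?case
    by (rule Ck_on_SucI[OF assms(1) bounded_linear.has_derivative[OF assms(2)
          Ck_on_Suc_has_derivative[OF Suc.prems]] Suc.IH])
      (use Suc.prems in auto)
qed

lemma Ck_on_ident: "open S \<Longrightarrow> Ck_on n (\<lambda>x. x) S"
proof (cases n)
  case (Suc m)
  assume "open S"
  show ?thesis unfolding Suc
    by (rule Ck_on_SucI[OF \<open>open S\<close>, where f' = "\<lambda>x v. v"]) (auto intro: Ck_on_const)
qed auto

lemma Ck_on_add:
  assumes "open S" "Ck_on n f S" "Ck_on n g S"
  shows "Ck_on n (\<lambda>x. f x + g x) S"
  using assms(2,3)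
proof (induction n arbitrary: f g)
  case 0
  then show ?case by (auto intro: continuous_on_add)
next
  case (Suc n)
  show ?case
    by (rule Ck_on_SucI[OF assms(1) has_derivative_add[OF
          Ck_on_Suc_has_derivative[OF Suc.prems(1)] Ck_on_Suc_has_derivative[OF Suc.prems(2)]] Suc.IH])
      (use Suc.prems in auto)
qed

lemma Ck_on_sum:
  assumes "open S" "\<And>i. i \<in> I \<Longrightarrow> Ck_on n (f i) S"
  shows "Ck_on n (\<lambda>x. \<Sum>i\<in>I. f i x) S"
  using assms(2)
  by (induction I rule: infinite_finite_induct) (auto intro: Ck_on_const Ck_on_add[OF assms(1)])

lemma Ck_on_bilinear:
  assumes "open S" "bounded_bilinear B" "Ck_on n f S" "Ck_on n g S"
  shows "Ck_on n (\<lambda>x. B (f x) (g x)) S"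
  using assms(3,4)
proof (induction n arbitrary: f g)
  case 0
  then show ?case using bounded_bilinear.continuous_on[OF assms(2)] by auto
next
  case (Suc n)
  show ?case
    by (rule Ck_on_SucI[OF assms(1) bounded_bilinear.FDERIV[OF assms(2)
          Ck_on_Suc_has_derivative[OF Suc.prems(1)] Ck_on_Suc_has_derivative[OF Suc.prems(2)]]])
      (use Suc.prems Suc.prems[THEN Ck_on_SucD] in \<open>auto intro!: Ck_on_add[OF assms(1)] Suc.IH\<close>)
qed

text \<open>In the chain rule the outer function is differentiated in a direction that itself varies with
  the point. Expanding this direction in a basis leaves derivatives in fixed directions, to which the
  induction hypothesis applies; for this the space in the middle has to be Euclidean.\<close>

lemma Ck_on_compose:
  fixes f :: "'a::real_normed_vector \<Rightarrow> 'b::euclidean_space" and g :: "'b \<Rightarrow> 'c::real_normed_vector"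
  assumes "open S" "open T" "f ` S \<subseteq> T" "Ck_on n f S" "Ck_on n g T"
  shows "Ck_on n (\<lambda>x. g (f x)) S"
  using assms(4,5)
proof (induction n arbitrary: g)
  case 0
  then show ?case using continuous_on_compose2[OF _ _ assms(3)] by auto
next
  case (Suc n)
  let ?D = "\<lambda>x v. \<Sum>b\<in>Basis. (frechet_derivative f (at x) v \<bullet> b) *\<^sub>R frechet_derivative g (at (f x)) b"
  have "((\<lambda>x. g (f x)) has_derivative ?D x) (at x)" if "x \<in> S" for x
  proof -
    have f: "(f has_derivative frechet_derivative f (at x)) (at x)"
      using Ck_on_Suc_has_derivative[OF Suc.prems(1) that] .
    have g: "(g has_derivative frechet_derivative g (at (f x))) (at (f x))"
      using Ck_on_Suc_has_derivative[OF Suc.prems(2)] that assms(3) by auto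
    have lin: "linear (frechet_derivative g (at (f x)))"
      using g has_derivative_linear by blast
    have "frechet_derivative g (at (f x)) u = (\<Sum>b\<in>Basis. (u \<bullet> b) *\<^sub>R frechet_derivative g (at (f x)) b)" for u
      by (subst (1) euclidean_representation[symmetric, of u])
        (simp only: linear_sum[OF lin] linear_cmul[OF lin])
    then show ?thesis
      by (intro has_derivative_eq_rhs[OF has_derivative_compose[OF f g]] ext)
  qed
  moreover have "Ck_on n (\<lambda>x. ?D x v) S" for v
  proof (intro Ck_on_sum[OF assms(1)] Ck_on_bilinear[OF assms(1) bounded_bilinear_scaleR])
    show "Ck_on n (\<lambda>x. frechet_derivative f (at x) v \<bullet> b) S" for b
      by (rule Ck_on_linear[OF assms(1) bounded_linear_inner_left]) (use Suc.prems in auto)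
    show "Ck_on n (\<lambda>x. frechet_derivative g (at (f x)) b) S" for b
      by (rule Suc.IH) (use Suc.prems Suc.prems[THEN Ck_on_SucD] in auto)
  qed
  ultimately show ?case by (rule Ck_on_SucI[OF assms(1)])
qed

lemma Ck_on_componentwise:
  fixes f :: "'a::real_normed_vector \<Rightarrow> 'b::euclidean_space"
  assumes "open S" "\<And>b. b \<in> Basis \<Longrightarrow> Ck_on n (\<lambda>x. f x \<bullet> b) S"
  shows "Ck_on n f S"
proof -
  have "Ck_on n (\<lambda>x. \<Sum>b\<in>Basis. (f x \<bullet> b) *\<^sub>R b) S"
    by (intro Ck_on_sum[OF assms(1)] Ck_on_linear[OF assms(1) bounded_linear_scaleR_left] assms(2))
  then show ?thesis by (simp add: euclidean_representation)
qed

section \<open>Smooth maps\<close>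

lemma smooth_on_subset: "smooth_on f S \<Longrightarrow> T \<subseteq> S \<Longrightarrow> smooth_on f T"
  unfolding smooth_on_def using Ck_on_subset by blast

lemma smooth_on_cong:
  "open S \<Longrightarrow> (\<And>x. x \<in> S \<Longrightarrow> f x = g x) \<Longrightarrow> smooth_on f S \<Longrightarrow> smooth_on g S"
  unfolding smooth_on_def using Ck_on_cong by blast

lemma smooth_on_local:
  assumes "\<And>x. x \<in> S \<Longrightarrow> \<exists>T. open T \<and> x \<in> T \<and> smooth_on f T"
  shows "smooth_on f S"
  unfolding smooth_on_def using Ck_on_local assms unfolding smooth_on_def by metis

lemma smooth_on_continuous_on: "smooth_on f S \<Longrightarrow> continuous_on S f"
  unfolding smooth_on_def using Ck_on_continuous_on by blast

lemma smooth_on_differentiable: "smooth_on f S \<Longrightarrow> x \<in> S \<Longrightarrow> f differentiable (at x)"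
  unfolding smooth_on_def using Ck_on.simps(2)[of 0 f S] by blast

lemma smooth_on_frechet_derivative:
  "smooth_on f S \<Longrightarrow> smooth_on (\<lambda>x. frechet_derivative f (at x) v) S"
  unfolding smooth_on_def using Ck_on.simps(2) by blast

lemma smooth_on_const: "smooth_on (\<lambda>x. c) S"
  unfolding smooth_on_def by (simp add: Ck_on_const)

lemma smooth_on_ident: "open S \<Longrightarrow> smooth_on (\<lambda>x. x) S"
  unfolding smooth_on_def by (simp add: Ck_on_ident)

lemma smooth_on_linear:
  "open S \<Longrightarrow> bounded_linear L \<Longrightarrow> smooth_on f S \<Longrightarrow> smooth_on (\<lambda>x. L (f x)) S"
  unfolding smooth_on_def by (simp add: Ck_on_linear)

lemma smooth_on_add:
  "open S \<Longrightarrow> smooth_on f S \<Longrightarrow> smooth_on g S \<Longrightarrow> smooth_on (\<lambda>x. f x + g x) S"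
  unfolding smooth_on_def by (simp add: Ck_on_add)

lemma smooth_on_bilinear:
  "open S \<Longrightarrow> bounded_bilinear B \<Longrightarrow> smooth_on f S \<Longrightarrow> smooth_on g S \<Longrightarrow>
    smooth_on (\<lambda>x. B (f x) (g x)) S"
  unfolding smooth_on_def by (simp add: Ck_on_bilinear)

lemmas smooth_on_mult = smooth_on_bilinear[OF _ bounded_bilinear_mult]
  and smooth_on_scaleR = smooth_on_bilinear[OF _ bounded_bilinear_scaleR]
  and smooth_on_inner = smooth_on_bilinear[OF _ bounded_bilinear_inner]

lemma smooth_on_compose:
  fixes f :: "'a::real_normed_vector \<Rightarrow> 'b::euclidean_space"
  assumes "open S" "open T" "f ` S \<subseteq> T" "smooth_on f S" "smooth_on g T"
  shows "smooth_on (\<lambda>x. g (f x)) S"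
  using assms unfolding smooth_on_def by (simp add: Ck_on_compose[OF assms(1-3)])

lemma smooth_on_componentwise:
  fixes f :: "'a::real_normed_vector \<Rightarrow> 'b::euclidean_space"
  assumes "open S" "\<And>b. b \<in> Basis \<Longrightarrow> smooth_on (\<lambda>x. f x \<bullet> b) S"
  shows "smooth_on f S"
  using assms unfolding smooth_on_def by (simp add: Ck_on_componentwise)

text \<open>A function on the line is smooth as soon as it belongs to a family whose members are
  differentiable with derivatives that are, up to smooth operations, again in the family. For the
  reciprocal the family has one member, since its derivative is \<open>- (1/x) * (1/x)\<close>.\<close>

lemma Ck_on_SucI_real:
  fixes f :: "real \<Rightarrow> 'a::real_normed_vector"
  assumes "open S" "\<And>x. x \<in> S \<Longrightarrow> (f has_vector_derivative f' x) (at x)" "Ck_on n f' S"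
  shows "Ck_on (Suc n) f S"
  by (rule Ck_on_SucI[OF assms(1) assms(2)[unfolded has_vector_derivative_def]])
    (auto intro: Ck_on_linear[OF assms(1) bounded_linear_scaleR_right assms(3)])

lemma open_nonzero_reals: "open {x::real. x \<noteq> 0}"
proof -
  have eq: "{x::real. x \<noteq> 0} = - {0}" by auto
  show ?thesis unfolding eq by (intro open_Compl closed_singleton)
qed

lemma smooth_on_inverse: "smooth_on (inverse :: real \<Rightarrow> real) {x. x \<noteq> 0}"
  unfolding smooth_on_def
proof
  note op = open_nonzero_reals
  fix n show "Ck_on n (inverse :: real \<Rightarrow> real) {x. x \<noteq> 0}"
  proof (induction n)
    case 0
    then show ?case by (auto intro: continuous_intros)
  next
    case (Suc n)
    show ?case
    proof (rule Ck_on_SucI_real[OF op])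
      show "(inverse has_vector_derivative - (inverse x * inverse x)) (at x)"
        if "x \<in> {x. x \<noteq> 0}" for x :: real
        using that DERIV_inverse[of x UNIV]
        by (simp add: has_real_derivative_iff_has_vector_derivative numeral_2_eq_2)
      show "Ck_on n (\<lambda>x::real. - (inverse x * inverse x)) {x. x \<noteq> 0}"
        using Suc by (intro Ck_on_linear[OF op bounded_linear_minus[OF bounded_linear_ident]]
            Ck_on_bilinear[OF op bounded_bilinear_mult])
    qed
  qed
qed

lemma smooth_on_inverse_compose:
  fixes f :: "'a::real_normed_vector \<Rightarrow> real"
  assumes "open S" "smooth_on f S" "\<And>x. x \<in> S \<Longrightarrow> f x \<noteq> 0"
  shows "smooth_on (\<lambda>x. inverse (f x)) S"
  by (rule smooth_on_compose[OF assms(1) open_nonzero_reals _ assms(2) smooth_on_inverse])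
    (use assms(3) in auto)

text \<open>The derivative of the inverse function \<open>k\<close> is \<open>1 / h'\<close> composed with \<open>k\<close> itself. So if \<open>k\<close> is of
  some class, then its derivative is of the same class, and \<open>k\<close> is one class better.\<close>

lemma smooth_on_inv_real:
  fixes h :: "real \<Rightarrow> real"
  assumes "smooth_on h UNIV" "\<And>s. (h has_real_derivative h' s) (at s)" "\<And>s. h' s > 0"
    and "\<And>s. h (k s) = s" "\<And>s. k (h s) = s"
  shows "smooth_on k UNIV"
proof -
  have h': "smooth_on h' UNIV"
  proof -
    have "frechet_derivative h (at s) 1 = h' s" for s
      by (subst frechet_derivative_eqI[OF assms(2)[unfolded has_field_derivative_def]]) simp
    then show ?thesis using smooth_on_frechet_derivative[OF assms(1), of 1] by simp
  qed
  have cont: "isCont k s" for s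
  proof -
    have "isCont k (h (k s))"
      by (rule isCont_inverse_function[where d=1 and f=h])
        (use assms(5) assms(2)[THEN DERIV_isCont] in auto)
    then show ?thesis by (simp add: assms)
  qed
  have der: "(k has_real_derivative inverse (h' (k s))) (at s)" for s
    by (rule DERIV_inverse_function[where f=h and a="s-1" and b="s+1"])
      (use assms(2,4) assms(3)[of "k s"] cont in auto)
  have "Ck_on n k UNIV" for n
  proof (induction n)
    case 0
    then show ?case using cont by (simp add: continuous_at_imp_continuous_on)
  next
    case (Suc n)
    have "smooth_on (\<lambda>s. inverse (h' s)) UNIV"
      by (rule smooth_on_inverse_compose[OF open_UNIV h']) (metis assms(3) less_irrefl)
    then have "Ck_on n (\<lambda>s. inverse (h' (k s))) UNIV"
      using Ck_on_compose[OF open_UNIV open_UNIV _ Suc, of "\<lambda>s. inverse (h' s)"]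
      by (simp add: smooth_on_def)
    then show ?case
      using der by (intro Ck_on_SucI_real) (auto simp: has_real_derivative_iff_has_vector_derivative)
  qed
  then show ?thesis by (simp add: smooth_on_def)
qed

section \<open>Symmetry of second derivatives\<close>

text \<open>The mean value theorem, applied first along \<open>v\<close> to a difference along \<open>w\<close>, and then along \<open>w\<close>.\<close>

lemma second_difference_mean_value:
  fixes f :: "'a::real_normed_vector \<Rightarrow> real"
  assumes "Ck_on (Suc (Suc 0)) f S" "t > 0"
    and inS: "\<And>a b. 0 \<le> a \<Longrightarrow> a \<le> t \<Longrightarrow> 0 \<le> b \<Longrightarrow> b \<le> t \<Longrightarrow> x + a *\<^sub>R v + b *\<^sub>R w \<in> S"
  shows "\<exists>a b. 0 < a \<and> a < t \<and> 0 < b \<and> b < t \<and>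
    f (x + t *\<^sub>R v + t *\<^sub>R w) - f (x + t *\<^sub>R w) - (f (x + t *\<^sub>R v) - f x) =
    t * (t * frechet_derivative (\<lambda>y. frechet_derivative f (at y) v) (at (x + a *\<^sub>R v + b *\<^sub>R w)) w)"
proof -
  let ?D = "\<lambda>y. frechet_derivative f (at y) v"
  have f: "(f has_derivative frechet_derivative f (at y)) (at y)" if "y \<in> S" for y
    using Ck_on_Suc_has_derivative[OF assms(1) that] .
  have D: "(?D has_derivative frechet_derivative ?D (at y)) (at y)" if "y \<in> S" for y
    by (rule Ck_on_Suc_has_derivative[of 0, OF _ that]) (use assms(1) in auto)
  have der: "((\<lambda>s. g (z + s *\<^sub>R u)) has_real_derivative g' u) (at s)"
    if "(g has_derivative g') (at (z + s *\<^sub>R u))" for g :: "'a \<Rightarrow> real" and g' z u s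
  proof -
    have "((\<lambda>s. g (z + s *\<^sub>R u)) has_derivative (\<lambda>h. g' (h *\<^sub>R u))) (at s)"
      by (rule has_derivative_compose[of "\<lambda>s. z + s *\<^sub>R u" "\<lambda>h. h *\<^sub>R u", OF _ that])
        (auto intro!: derivative_eq_intros)
    moreover have "g' (h *\<^sub>R u) = g' u * h" for h
      using linear_cmul[OF has_derivative_linear[OF that]] by simp
    ultimately show ?thesis by (simp add: has_field_derivative_def)
  qed
  have "\<exists>a. 0 < a \<and> a < t \<and>
      (f (x + t *\<^sub>R w + t *\<^sub>R v) - f (x + t *\<^sub>R v)) - (f (x + t *\<^sub>R w + 0 *\<^sub>R v) - f (x + 0 *\<^sub>R v)) =
      (t - 0) * (?D (x + t *\<^sub>R w + a *\<^sub>R v) - ?D (x + a *\<^sub>R v))"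
  proof (rule MVT2[OF assms(2)])
    fix s :: real assume "0 \<le> s" "s \<le> t"
    then have "x + t *\<^sub>R w + s *\<^sub>R v \<in> S" "x + s *\<^sub>R v \<in> S"
      using inS[of s t] inS[of s 0] assms(2) by (auto simp: algebra_simps)
    then show "((\<lambda>s. f (x + t *\<^sub>R w + s *\<^sub>R v) - f (x + s *\<^sub>R v)) has_real_derivative
        ?D (x + t *\<^sub>R w + s *\<^sub>R v) - ?D (x + s *\<^sub>R v)) (at s)"
      by (intro DERIV_diff der f)
  qed
  then obtain a where a: "0 < a" "a < t"
    and eq1: "f (x + t *\<^sub>R v + t *\<^sub>R w) - f (x + t *\<^sub>R w) - (f (x + t *\<^sub>R v) - f x) =
      t * (?D (x + a *\<^sub>R v + t *\<^sub>R w) - ?D (x + a *\<^sub>R v))"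
    by (auto simp: algebra_simps)
  have "\<exists>b. 0 < b \<and> b < t \<and> ?D (x + a *\<^sub>R v + t *\<^sub>R w) - ?D (x + a *\<^sub>R v + 0 *\<^sub>R w) =
      (t - 0) * frechet_derivative ?D (at (x + a *\<^sub>R v + b *\<^sub>R w)) w"
    by (rule MVT2[OF assms(2)]) (use a in \<open>intro der D inS, auto\<close>)
  then show ?thesis using a eq1 by auto
qed

text \<open>Both mixed second derivatives are limits of the same second difference quotient.\<close>

lemma frechet_derivative_commute:
  fixes f :: "'a::real_normed_vector \<Rightarrow> real"
  assumes f: "Ck_on (Suc (Suc 0)) f S" and S: "open S" "x \<in> S"
  shows "frechet_derivative (\<lambda>y. frechet_derivative f (at y) v) (at x) w =
    frechet_derivative (\<lambda>y. frechet_derivative f (at y) w) (at x) v"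
proof (rule ccontr)
  define D where "D v w y = frechet_derivative (\<lambda>y. frechet_derivative f (at y) v) (at y) w" for v w y
  assume "\<not> ?thesis"
  then have ne: "D v w x \<noteq> D w v x" by (simp add: D_def)
  define e where "e = \<bar>D v w x - D w v x\<bar> / 2"
  have e: "e > 0" using ne by (simp add: e_def)
  have "isCont (D v w) x" for v w
    using f S by (auto simp: D_def[abs_def] continuous_on_eq_continuous_at)
  then have "\<exists>d>0. \<forall>y. dist y x < d \<longrightarrow> dist (D v w y) (D v w x) < e" for v w
    using e unfolding continuous_at_eps_delta by blast
  then obtain d1 d2 where d12: "d1 > 0" "d2 > 0"
      "\<And>y. dist y x < d1 \<Longrightarrow> dist (D v w y) (D v w x) < e"
      "\<And>y. dist y x < d2 \<Longrightarrow> dist (D w v y) (D w v x) < e"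
    by metis
  obtain d3 where d3: "d3 > 0" "ball x d3 \<subseteq> S" using S openE by blast
  define d where "d = min d1 (min d2 d3)"
  define t where "t = d / (norm v + norm w + 1)"
  have d: "d > 0" using d12 d3 by (simp add: d_def)
  have pos: "norm v + norm w + 1 > 0" by (simp add: add_nonneg_pos)
  have t: "t > 0" using d pos by (simp add: t_def)
  have close: "dist (x + a *\<^sub>R v + b *\<^sub>R w) x < d" if "0 \<le> a" "a \<le> t" "0 \<le> b" "b \<le> t" for a b
  proof -
    have "dist (x + a *\<^sub>R v + b *\<^sub>R w) x \<le> a * norm v + b * norm w"
      using norm_triangle_ineq[of "a *\<^sub>R v" "b *\<^sub>R w"] that by (simp add: dist_norm)
    also have "\<dots> \<le> t * (norm v + norm w)"
      using that mult_right_mono[of a t "norm v"] mult_right_mono[of b t "norm w"]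
      by (simp add: algebra_simps)
    also have "\<dots> < t * (norm v + norm w + 1)" using t by simp
    also have "\<dots> = d" using pos by (simp add: t_def)
    finally show ?thesis .
  qed
  have inS: "x + a *\<^sub>R v + b *\<^sub>R w \<in> S" if "0 \<le> a" "a \<le> t" "0 \<le> b" "b \<le> t" for a b
    using close[OF that] d3(2) by (auto simp: d_def dist_commute)
  have inS': "x + a *\<^sub>R w + b *\<^sub>R v \<in> S" if "0 \<le> a" "a \<le> t" "0 \<le> b" "b \<le> t" for a b
    using inS[of b a] that by (simp add: algebra_simps)
  from second_difference_mean_value[OF f t inS] obtain a b where
    ab: "0 < a" "a < t" "0 < b" "b < t" and eq1:
    "f (x + t *\<^sub>R v + t *\<^sub>R w) - f (x + t *\<^sub>R w) - (f (x + t *\<^sub>R v) - f x) =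
     t * (t * D v w (x + a *\<^sub>R v + b *\<^sub>R w))" unfolding D_def by blast
  from second_difference_mean_value[OF f t inS'] obtain a' b' where
    ab': "0 < a'" "a' < t" "0 < b'" "b' < t" and eq2:
    "f (x + t *\<^sub>R w + t *\<^sub>R v) - f (x + t *\<^sub>R v) - (f (x + t *\<^sub>R w) - f x) =
     t * (t * D w v (x + a' *\<^sub>R w + b' *\<^sub>R v))" unfolding D_def by blast
  have swap: "x + t *\<^sub>R w + t *\<^sub>R v = x + t *\<^sub>R v + t *\<^sub>R w" by simp
  have "t * (t * D v w (x + a *\<^sub>R v + b *\<^sub>R w)) = t * (t * D w v (x + a' *\<^sub>R w + b' *\<^sub>R v))"
    using eq1 eq2 unfolding swap by linarith
  then have "D v w (x + a *\<^sub>R v + b *\<^sub>R w) = D w v (x + b' *\<^sub>R v + a' *\<^sub>R w)"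
    using t by (simp add: algebra_simps)
  moreover have "dist (D v w (x + a *\<^sub>R v + b *\<^sub>R w)) (D v w x) < e"
    using close[of a b] ab by (intro d12) (auto simp: d_def)
  moreover have "dist (D w v (x + b' *\<^sub>R v + a' *\<^sub>R w)) (D w v x) < e"
    using close[of b' a'] ab' by (intro d12) (auto simp: d_def)
  ultimately show False by (simp add: e_def dist_real_def abs_if split: if_splits)
qed

section \<open>A flat function\<close>

text \<open>The factor \<open>1 / t ^ k\<close> makes the family closed under differentiation, up to linear
  combinations; the case \<open>k = 0\<close> is the classical flat function.\<close>

definition flat :: "nat \<Rightarrow> real \<Rightarrow> real" where
  "flat k t = (if t > 0 then exp (- (1 / t)) / t ^ k else 0)"

lemma flat_nonneg: "0 \<le> flat k t"
  by (simp add: flat_def)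

lemma flat_nonpos: "t \<le> 0 \<Longrightarrow> flat k t = 0"
  by (simp add: flat_def)

lemma flat_tendsto_0: "(flat k \<longlongrightarrow> 0) (at 0)"
proof -
  have "((\<lambda>u::real. u ^ k / exp u) \<longlongrightarrow> 0) at_top"
    by (rule tendsto_power_div_exp_0)
  then have "((\<lambda>t::real. inverse t ^ k / exp (inverse t)) \<longlongrightarrow> 0) (at_right 0)"
    by (rule filterlim_compose[OF _ filterlim_inverse_at_top_right])
  moreover have "\<forall>\<^sub>F t in at_right 0. inverse t ^ k / exp (inverse t) = flat k t"
    by (auto simp: eventually_at_right_less flat_def exp_minus divide_simps
        intro!: eventually_mono[OF eventually_at_right_less])
  ultimately have "(flat k \<longlongrightarrow> 0) (at_right 0)" using tendsto_cong by fast
  moreover have "(flat k \<longlongrightarrow> 0) (at_left 0)"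
    by (rule tendsto_eventually) (auto simp: eventually_at_filter flat_def)
  ultimately show ?thesis by (simp add: filterlim_split_at)
qed

lemma flat_has_derivative:
  "(flat k has_real_derivative flat (k + 2) t - real k * flat (k + 1) t) (at t)"
proof (cases t "0::real" rule: linorder_cases)
  case less
  show ?thesis
    by (rule has_field_derivative_transform_within_open[where f = "\<lambda>_. 0" and S = "{..<0}"])
      (use less in \<open>auto simp: flat_def intro!: derivative_eq_intros\<close>)
next
  case equal
  have "(\<lambda>h. (flat k (0 + h) - flat k 0) / h) \<midarrow>0\<rightarrow> 0"
  proof (rule Lim_transform_eventually[OF flat_tendsto_0[of "Suc k"]])
    show "\<forall>\<^sub>F h in at 0. flat (Suc k) h = (flat k (0 + h) - flat k 0) / h"
      by (auto simp: eventually_at_filter flat_def)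
  qed
  then show ?thesis using equal by (simp add: DERIV_def flat_def)
next
  case greater
  have "((\<lambda>t. t ^ k) has_real_derivative real k * t ^ k / t) (at t)"
    using DERIV_pow[of k t UNIV] greater by (cases k) auto
  moreover have "((\<lambda>t. exp (- (1 / t))) has_real_derivative exp (- (1 / t)) / t\<^sup>2) (at t)"
    using greater by (auto intro!: derivative_eq_intros simp: power2_eq_square)
  ultimately have "((\<lambda>t. exp (- (1 / t)) / t ^ k) has_real_derivative
      (exp (- (1 / t)) / t\<^sup>2 * t ^ k - exp (- (1 / t)) * (real k * t ^ k / t)) / (t ^ k * t ^ k)) (at t)"
    using greater by (intro DERIV_divide) auto
  also have "(exp (- (1 / t)) / t\<^sup>2 * t ^ k - exp (- (1 / t)) * (real k * t ^ k / t)) / (t ^ k * t ^ k) =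
      exp (- (1 / t)) / t ^ (k + 2) - real k * (exp (- (1 / t)) / t ^ (k + 1))"
    using greater by (simp add: field_simps power2_eq_square)
  finally have "(flat k has_real_derivative
      exp (- (1 / t)) / t ^ (k + 2) - real k * (exp (- (1 / t)) / t ^ (k + 1))) (at t)"
    by (rule has_field_derivative_transform_within_open[where S = "{0<..}"])
      (use greater in \<open>auto simp: flat_def\<close>)
  then show ?thesis using greater by (simp add: flat_def)
qed

lemma smooth_on_flat: "smooth_on (flat k) UNIV"
proof -
  have "Ck_on n (flat k) UNIV" for n
  proof (induction n arbitrary: k)
    case 0
    then show ?case
      using DERIV_isCont[OF flat_has_derivative] by (simp add: continuous_at_imp_continuous_on)
  next
    case (Suc n)
    have "Ck_on n (\<lambda>t. flat (k + 2) t + - (real k * flat (k + 1) t)) UNIV"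
      by (intro Ck_on_add Ck_on_linear[OF open_UNIV bounded_linear_minus[OF bounded_linear_ident]]
          Ck_on_linear[OF open_UNIV bounded_linear_mult_right] Suc open_UNIV)
    then show ?case
      using flat_has_derivative[of k]
      by (intro Ck_on_SucI_real) (auto simp: has_real_derivative_iff_has_vector_derivative)
  qed
  then show ?thesis by (simp add: smooth_on_def)
qed

text \<open>This bound on the derivative of \<open>flat 0\<close> is what makes the radial map below monotone.\<close>

lemma flat_2_le: "flat 2 t \<le> 2"
proof (cases "t > 0")
  case True
  have "1 + 1 / t + (1 / t)\<^sup>2 / 2 \<le> exp (1 / t)"
    using True by (intro exp_lower_Taylor_quadratic) simp
  then have "(1 / t)\<^sup>2 / 2 \<le> exp (1 / t)" 
    using True by (smt (verit) divide_nonneg_nonneg)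
  then show ?thesis using True
    by (simp add: flat_def exp_minus field_simps power2_eq_square)
qed (simp add: flat_def)

section \<open>A diffeomorphism that expands a ball within itself\<close>

text \<open>The radial map \<open>x \<mapsto> stretch (|x|\<^sup>2) x\<close> is the identity outside the unit ball, and inside
  it moves every point other than the centre outwards. On the squared radius it acts as \<open>radial\<close>,
  so that everything about it, the smoothness of its inverse included, is a question about
  one real variable. The factor 1/4 is small enough to keep \<open>radial\<close> increasing.\<close>

definition stretch :: "real \<Rightarrow> real" where
  "stretch s = 1 + flat 0 (1 - s) / 4"

definition radial :: "real \<Rightarrow> real" where
  "radial s = s * (stretch s)\<^sup>2"

definition radial_inv :: "real \<Rightarrow> real" where
  "radial_inv = inv radial"

lemma stretch_ge_1: "1 \<le> stretch s"
  by (simp add: stretch_def flat_nonneg)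

lemma stretch_pos: "0 < stretch s"
  using stretch_ge_1[of s] by simp

lemma stretch_eq_1: "1 \<le> s \<Longrightarrow> stretch s = 1"
  by (simp add: stretch_def flat_nonpos)

lemma stretch_gt_1: "s < 1 \<Longrightarrow> 1 < stretch s"
  by (simp add: stretch_def flat_def)

lemma smooth_on_stretch: "smooth_on stretch UNIV"
proof -
  have "smooth_on (\<lambda>s. 1 + - s) (UNIV :: real set)"
    by (intro smooth_on_add smooth_on_const open_UNIV
        smooth_on_linear[OF open_UNIV bounded_linear_minus[OF bounded_linear_ident]] smooth_on_ident)
  then have "smooth_on (\<lambda>s. flat 0 (1 + - s)) UNIV"
    using smooth_on_compose[OF open_UNIV open_UNIV _ _ smooth_on_flat, of "\<lambda>s. 1 + - s"] by simp
  then have "smooth_on (\<lambda>s. 1 + flat 0 (1 + - s) / 4) UNIV"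
    by (intro smooth_on_add smooth_on_const open_UNIV
        smooth_on_linear[OF open_UNIV bounded_linear_divide])
  then show ?thesis by (simp add: stretch_def[abs_def])
qed

lemma smooth_on_radial: "smooth_on radial UNIV"
  unfolding radial_def[abs_def] power2_eq_square
  by (intro smooth_on_mult smooth_on_ident smooth_on_stretch open_UNIV)

lemma radial_has_derivative:
  "(radial has_real_derivative stretch s * (stretch s - s * flat 2 (1 - s) / 2)) (at s)"
proof -
  have "((\<lambda>s. flat 0 (1 - s)) has_real_derivative flat 2 (1 - s) * - 1) (at s)"
    by (rule DERIV_chain2) (use flat_has_derivative[of 0 "1 - s"] in
        \<open>auto intro!: derivative_eq_intros simp: numeral_2_eq_2\<close>)
  then show ?thesis
    unfolding radial_def[abs_def] stretch_def
    by (auto intro!: derivative_eq_intros simp: field_simps power2_eq_square)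
qed

text \<open>The factor \<open>stretch s\<close> is at least 1. The term that is subtracted from it is at most \<open>s\<close> for
  \<open>0 < s < 1\<close>, it has the good sign for \<open>s \<le> 0\<close>, and it
  vanishes for \<open>s \<ge> 1\<close>.\<close>

lemma radial_deriv_pos: "0 < stretch s * (stretch s - s * flat 2 (1 - s) / 2)"
proof -
  have "s * flat 2 (1 - s) / 2 < stretch s"
  proof (cases "s \<le> 0")
    case True
    then have "s * flat 2 (1 - s) \<le> 0" by (simp add: mult_nonpos_nonneg flat_nonneg)
    then show ?thesis using stretch_pos[of s] by simp
  next
    case False
    show ?thesis
    proof (cases "s < 1")
      case True
      have "s * flat 2 (1 - s) \<le> s * 2" using False flat_2_le by (intro mult_left_mono) auto
      then show ?thesis using True stretch_ge_1[of s] by simp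
    next
      case False
      then show ?thesis by (simp add: flat_nonpos stretch_pos)
    qed
  qed
  then show ?thesis by (simp add: stretch_pos)
qed

lemma radial_strict_mono: "s < t \<Longrightarrow> radial s < radial t"
  using DERIV_pos_imp_increasing[of s t radial] radial_has_derivative radial_deriv_pos by blast

lemma radial_less_iff: "radial s < radial t \<longleftrightarrow> s < t"
  using radial_strict_mono by (metis less_asym linorder_neqE_linordered_idom)

lemma radial_le_iff: "radial s \<le> radial t \<longleftrightarrow> s \<le> t"
  using radial_less_iff by (meson not_le)

lemma radial_eq: "1 \<le> s \<Longrightarrow> radial s = s"
  by (simp add: radial_def stretch_eq_1)

lemma radial_0: "radial 0 = 0"
  by (simp add: radial_def)

lemma radial_greater: "0 < s \<Longrightarrow> s < 1 \<Longrightarrow> s < radial s"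
  using stretch_gt_1[of s] by (simp add: radial_def one_less_power)

lemma surj_radial: "surj radial"
proof (rule surjI)
  show "radial (SOME x. radial x = y) = y" for y
  proof (rule someI_ex)
    show "\<exists>x. radial x = y"
    proof (cases "1 \<le> y")
      case True
      then show ?thesis using radial_eq by blast
    next
      case False
      have "radial (min 0 y) \<le> min 0 y"
        using one_le_power[OF stretch_ge_1, of "min 0 y" 2]
          mult_left_mono_neg[of 1 "(stretch (min 0 y))\<^sup>2" "min 0 y"]
        by (simp add: radial_def)
      then have "\<exists>x. min 0 y \<le> x \<and> x \<le> 1 \<and> radial x = y"
        using False radial_eq[of 1]
        by (intro IVT) (auto simp: DERIV_isCont[OF radial_has_derivative])
      then show ?thesis by blast
    qed
  qed
qed

lemma radial_radial_inv: "radial (radial_inv s) = s"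
  unfolding radial_inv_def by (rule surj_f_inv_f[OF surj_radial])

lemma radial_inv_radial: "radial_inv (radial s) = s"
  using radial_less_iff[of "radial_inv (radial s)" s] radial_less_iff[of s "radial_inv (radial s)"]
  by (simp add: radial_radial_inv)

lemma smooth_on_radial_inv: "smooth_on radial_inv UNIV"
  by (rule smooth_on_inv_real[OF smooth_on_radial radial_has_derivative radial_deriv_pos
        radial_radial_inv radial_inv_radial])

lemma radial_inv_eq: "1 \<le> s \<Longrightarrow> radial_inv s = s"
  using radial_inv_radial[of s] radial_eq[of s] by simp

lemma radial_inv_0: "radial_inv 0 = 0"
  using radial_inv_radial[of 0] radial_0 by simp

lemma radial_inv_nonneg: "0 \<le> s \<Longrightarrow> 0 \<le> radial_inv s"
  using radial_le_iff[of 0 "radial_inv s"] by (simp add: radial_radial_inv radial_0)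

lemma radial_inv_less: "0 < s \<Longrightarrow> s < 1 \<Longrightarrow> radial_inv s < s"
  using radial_less_iff[of "radial_inv s" s] radial_greater[of s] by (simp add: radial_radial_inv)

lemma radial_inv_le: "0 \<le> s \<Longrightarrow> radial_inv s \<le> s"
  using radial_inv_less[of s] radial_inv_eq[of s] radial_inv_0
  by (cases "s = 0"; cases "s < 1") auto

text \<open>The iterates decrease, so they converge, and the limit is a fixed point; the only fixed point in
  \<open>[0, 1)\<close> is 0.\<close>

lemma radial_inv_iterates_tendsto_0:
  assumes "0 \<le> s" "s < 1"
  shows "(\<lambda>n. (radial_inv ^^ n) s) \<longlonglongrightarrow> 0"
proof -
  let ?a = "\<lambda>n. (radial_inv ^^ n) s"
  have nonneg: "0 \<le> ?a n" for n
    by (induction n) (use assms radial_inv_nonneg in auto)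
  have dec: "decseq ?a"
    by (rule decseq_SucI) (use nonneg radial_inv_le in auto)
  have "convergent ?a"
    by (rule Bseq_monoseq_convergent)
      (use decseq_bounded[OF dec, of 0] nonneg dec decseq_imp_monoseq in auto)
  then obtain L where L: "?a \<longlonglongrightarrow> L" by (auto simp: convergent_def)
  have "isCont radial_inv L"
    using smooth_on_continuous_on[OF smooth_on_radial_inv] by (simp add: continuous_on_eq_continuous_at)
  then have "(\<lambda>n. radial_inv (?a n)) \<longlonglongrightarrow> radial_inv L"
    using L isCont_tendsto_compose by blast
  then have "?a \<longlonglongrightarrow> radial_inv L" by (intro LIMSEQ_imp_Suc[of "?a"]) simp
  then have "radial_inv L = L" using L LIMSEQ_unique by blast
  moreover have "0 \<le> L" using L nonneg LIMSEQ_le_const by blast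
  moreover have "L \<le> s" using decseq_ge[OF dec L, of 0] by simp
  ultimately have "L = 0" using radial_inv_less[of L] assms by force
  then show ?thesis using L by simp
qed

text \<open>That the iterates of the inverse \<open>\<sigma>\<close> draw every point of the ball to the centre means that the images
  of any neighbourhood of the centre under the iterates of \<open>\<rho>\<close> exhaust the ball.\<close>

lemma expanding_diffeomorphism_unit_ball:
  "\<exists>\<rho> \<sigma> :: 'a::euclidean_space \<Rightarrow> 'a. smooth_on \<rho> UNIV \<and> smooth_on \<sigma> UNIV \<and>
    (\<forall>x. \<sigma> (\<rho> x) = x) \<and> (\<forall>x. \<rho> (\<sigma> x) = x) \<and> (\<forall>x. 1 \<le> norm x \<longrightarrow> \<rho> x = x) \<and>
    (\<forall>x. norm (\<sigma> x) \<le> norm x) \<and> (\<forall>x. norm x < 1 \<longrightarrow> (\<lambda>n. (\<sigma> ^^ n) x) \<longlonglongrightarrow> 0)"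
proof -
  define \<rho> :: "'a \<Rightarrow> 'a" where "\<rho> x = stretch (x \<bullet> x) *\<^sub>R x" for x
  define \<sigma> :: "'a \<Rightarrow> 'a" where "\<sigma> x = inverse (stretch (radial_inv (x \<bullet> x))) *\<^sub>R x" for x
  have sq: "smooth_on (\<lambda>x::'a. x \<bullet> x) UNIV"
    by (intro smooth_on_inner smooth_on_ident open_UNIV)
  have comp: "smooth_on (\<lambda>x::'a. f (x \<bullet> x)) UNIV" if "smooth_on f UNIV" for f :: "real \<Rightarrow> real"
    by (rule smooth_on_compose[OF open_UNIV open_UNIV _ sq that]) simp
  have S1: "smooth_on \<rho> UNIV"
    unfolding \<rho>_def[abs_def]
    by (intro smooth_on_scaleR comp smooth_on_stretch smooth_on_ident open_UNIV)
  have "smooth_on (\<lambda>s. stretch (radial_inv s)) UNIV"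
    by (rule smooth_on_compose[OF open_UNIV open_UNIV _ smooth_on_radial_inv smooth_on_stretch]) simp
  then have "smooth_on (\<lambda>s. inverse (stretch (radial_inv s))) UNIV"
    by (rule smooth_on_inverse_compose[OF open_UNIV]) (metis stretch_pos less_irrefl)
  then have S2: "smooth_on \<sigma> UNIV"
    unfolding \<sigma>_def[abs_def] by (intro smooth_on_scaleR comp smooth_on_ident open_UNIV)
  have \<rho>2: "\<rho> x \<bullet> \<rho> x = radial (x \<bullet> x)" for x
    by (simp add: \<rho>_def radial_def power2_eq_square)
  have \<sigma>2: "\<sigma> x \<bullet> \<sigma> x = radial_inv (x \<bullet> x)" for x
  proof -
    let ?k = "radial_inv (x \<bullet> x)"
    have "x \<bullet> x = ?k * (stretch ?k)\<^sup>2"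
      using radial_radial_inv[of "x \<bullet> x"] by (simp add: radial_def)
    then have "inverse (stretch ?k) * (inverse (stretch ?k) * (x \<bullet> x)) = ?k"
      using stretch_pos[of ?k] by (simp add: field_simps power2_eq_square)
    then show ?thesis by (simp add: \<sigma>_def)
  qed
  have nz: "stretch s \<noteq> 0" for s using stretch_pos[of s] by simp
  have S3: "\<sigma> (\<rho> x) = x" for x
    by (simp add: \<sigma>_def[of "\<rho> x"] \<rho>2 radial_inv_radial) (simp add: \<rho>_def nz)
  have S4: "\<rho> (\<sigma> x) = x" for x
    by (simp add: \<rho>_def[of "\<sigma> x"] \<sigma>2) (simp add: \<sigma>_def nz)
  have S5: "\<rho> x = x" if "1 \<le> norm x" for x
  proof -
    have "1 \<le> x \<bullet> x" using that by (simp add: dot_square_norm one_le_power)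
    then show ?thesis by (simp add: \<rho>_def stretch_eq_1)
  qed
  have S6: "norm (\<sigma> x) \<le> norm x" for x
    by (simp add: norm_le \<sigma>2 radial_inv_le)
  have S7: "(\<lambda>n. (\<sigma> ^^ n) x) \<longlonglongrightarrow> 0" if "norm x < 1" for x
  proof -
    have "(\<sigma> ^^ n) x \<bullet> (\<sigma> ^^ n) x = (radial_inv ^^ n) (x \<bullet> x)" for n
      by (induction n) (auto simp: \<sigma>2)
    moreover have "x \<bullet> x < 1" using that by (simp add: dot_square_norm abs_square_less_1)
    ultimately have "(\<lambda>n. (\<sigma> ^^ n) x \<bullet> (\<sigma> ^^ n) x) \<longlonglongrightarrow> 0"
      using radial_inv_iterates_tendsto_0[of "x \<bullet> x"] by simp
    then have "(\<lambda>n. sqrt ((\<sigma> ^^ n) x \<bullet> (\<sigma> ^^ n) x)) \<longlonglongrightarrow> sqrt 0"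
      by (rule tendsto_real_sqrt)
    then show ?thesis
      by (simp add: norm_eq_sqrt_inner[symmetric] tendsto_norm_zero_iff)
  qed
  show ?thesis using S1 S2 S3 S4 S5 S6 S7 by blast
qed

lemma expanding_diffeomorphism_ball:
  fixes q :: "'a::euclidean_space"
  assumes "R > 0"
  obtains \<rho> \<sigma> :: "'a \<Rightarrow> 'a" where
    "smooth_on \<rho> UNIV" "smooth_on \<sigma> UNIV" "\<And>x. \<sigma> (\<rho> x) = x" "\<And>x. \<rho> (\<sigma> x) = x"
    "\<And>x. x \<notin> ball q R \<Longrightarrow> \<rho> x = x"
    "\<And>x. dist q (\<sigma> x) \<le> dist q x"
    "\<And>x. x \<in> ball q R \<Longrightarrow> (\<lambda>n. (\<sigma> ^^ n) x) \<longlonglongrightarrow> q"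
proof -
  obtain \<rho> \<sigma> :: "'a \<Rightarrow> 'a" where
    sm: "smooth_on \<rho> UNIV" "smooth_on \<sigma> UNIV" and inv: "\<And>x. \<sigma> (\<rho> x) = x" "\<And>x. \<rho> (\<sigma> x) = x"
    and out: "\<And>x. 1 \<le> norm x \<Longrightarrow> \<rho> x = x"
    and le: "\<And>x. norm (\<sigma> x) \<le> norm x"
    and lim: "\<And>x. norm x < 1 \<Longrightarrow> (\<lambda>n. (\<sigma> ^^ n) x) \<longlonglongrightarrow> 0"
    using expanding_diffeomorphism_unit_ball by blast
  define N where "N x = inverse R *\<^sub>R (x - q)" for x
  define M where "M y = q + R *\<^sub>R y" for y
  have NM: "N (M y) = y" "M (N x) = x" for x y
    using assms by (simp_all add: N_def M_def)
  have normN: "norm (N x) = dist q x / R" for x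
    using assms by (simp add: N_def dist_norm norm_minus_commute divide_inverse_commute)
  have distM: "dist q (M y) = R * norm y" for y
    using assms by (simp add: M_def dist_norm)
  have smN: "smooth_on N UNIV"
  proof -
    have "smooth_on (\<lambda>x. inverse R *\<^sub>R (x + - q)) UNIV"
      by (intro smooth_on_linear[OF open_UNIV bounded_linear_scaleR_right] smooth_on_add
          smooth_on_const smooth_on_ident open_UNIV)
    then show ?thesis by (simp add: N_def[abs_def])
  qed
  have smM: "smooth_on M UNIV"
    unfolding M_def[abs_def]
    by (intro smooth_on_linear[OF open_UNIV bounded_linear_scaleR_right] smooth_on_add
        smooth_on_const smooth_on_ident open_UNIV)
  have conj: "smooth_on (\<lambda>x. M (f (N x))) UNIV" if "smooth_on f UNIV" for f
    by (rule smooth_on_compose[OF open_UNIV open_UNIV _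
          smooth_on_compose[OF open_UNIV open_UNIV _ smN that] smM])
      auto
  show thesis
  proof (rule that[of "\<lambda>x. M (\<rho> (N x))" "\<lambda>x. M (\<sigma> (N x))"])
    show "smooth_on (\<lambda>x. M (\<rho> (N x))) UNIV" "smooth_on (\<lambda>x. M (\<sigma> (N x))) UNIV"
      using conj sm by auto
    show "M (\<rho> (N x)) = x" if "x \<notin> ball q R" for x
      using that assms by (subst out) (auto simp: normN NM)
    show "dist q (M (\<sigma> (N x))) \<le> dist q x" for x
      using le[of "N x"] assms by (simp add: distM normN field_simps)
    show "(\<lambda>n. ((\<lambda>x. M (\<sigma> (N x))) ^^ n) x) \<longlonglongrightarrow> q" if "x \<in> ball q R" for x
    proof -
      have "((\<lambda>x. M (\<sigma> (N x))) ^^ n) x = M ((\<sigma> ^^ n) (N x))" for n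
        by (induction n) (auto simp: NM)
      moreover have "(\<lambda>n. q + R *\<^sub>R (\<sigma> ^^ n) (N x)) \<longlonglongrightarrow> q + R *\<^sub>R 0"
        using that assms by (intro tendsto_intros lim) (auto simp: normN)
      ultimately show ?thesis by (simp add: M_def)
    qed
  qed (auto simp: NM inv)
qed

section \<open>Charts of a surface\<close>

locale surface_atlas =
  fixes X :: "'a topology" and A :: "'a chart set"
  assumes atlas: "smooth_atlas X A"
begin

lemma is_chart: "c \<in> A \<Longrightarrow> is_chart X c"
  using atlas by (simp add: smooth_atlas_def)

lemma openin_dom: "c \<in> A \<Longrightarrow> openin X (chart_dom c)"
  using is_chart by (simp add: is_chart_def)

lemma dom_subset: "c \<in> A \<Longrightarrow> chart_dom c \<subseteq> topspace X"
  using openin_dom openin_subset by blast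

lemma ex_chart: "x \<in> topspace X \<Longrightarrow> \<exists>c\<in>A. x \<in> chart_dom c"
  using atlas by (auto simp: smooth_atlas_def)

lemma chart_at: "x \<in> topspace X \<Longrightarrow> chart_at A x \<in> A \<and> x \<in> chart_dom (chart_at A x)"
  unfolding chart_at_def using ex_chart by (metis (mono_tags, lifting) someI_ex)

lemma homeomorphic_coord:
  "c \<in> A \<Longrightarrow> homeomorphic_map (subtopology X (chart_dom c)) (top_of_set (chart_img c)) (coord c)"
  using is_chart by (simp add: is_chart_def)

lemma topspace_dom: "c \<in> A \<Longrightarrow> topspace (subtopology X (chart_dom c)) = chart_dom c"
  using dom_subset by (simp add: Int_absorb1)

lemma inj_on_coord: "c \<in> A \<Longrightarrow> inj_on (coord c) (chart_dom c)"
  using homeomorphic_imp_injective_map[OF homeomorphic_coord] topspace_dom by simp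

lemma chart_inv_coord [simp]: "c \<in> A \<Longrightarrow> x \<in> chart_dom c \<Longrightarrow> chart_inv c (coord c x) = x"
  by (simp add: chart_inv_def inj_on_coord)

lemma coord_chart_inv [simp]: "y \<in> chart_img c \<Longrightarrow> coord c (chart_inv c y) = y"
  by (simp add: chart_inv_def f_inv_into_f)

lemma chart_inv_dom: "y \<in> chart_img c \<Longrightarrow> chart_inv c y \<in> chart_dom c"
  unfolding chart_inv_def by (rule inv_into_into)

lemma open_chart_img: "c \<in> A \<Longrightarrow> open (chart_img c)"
  using is_chart by (simp add: is_chart_def)

lemma open_coord_image:
  assumes "c \<in> A" "openin X U" "U \<subseteq> chart_dom c"
  shows "open (coord c ` U)"
proof -
  have "openin (subtopology X (chart_dom c)) U"
    using assms by (simp add: openin_open_subtopology openin_dom)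
  then have "openin (top_of_set (chart_img c)) (coord c ` U)"
    using homeomorphic_map_openness_eq[OF homeomorphic_coord[OF assms(1)]] by blast
  then show ?thesis using open_chart_img[OF assms(1)] openin_open_trans by blast
qed

lemma coord_image_eq:
  "c \<in> A \<Longrightarrow> V \<subseteq> chart_img c \<Longrightarrow> coord c ` (chart_inv c ` V) = V"
  by (force simp: image_image)

lemma chart_inv_image_eq:
  "c \<in> A \<Longrightarrow> U \<subseteq> chart_dom c \<Longrightarrow> chart_inv c ` (coord c ` U) = U"
  by (force simp: image_image)

lemma chart_inv_image_subset: "V \<subseteq> chart_img c \<Longrightarrow> chart_inv c ` V \<subseteq> chart_dom c"
  by (rule image_subsetI) (rule chart_inv_dom, erule subsetD)

lemma openin_chart_inv_image:
  assumes "c \<in> A" "open V" "V \<subseteq> chart_img c"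
  shows "openin X (chart_inv c ` V)"
proof -
  have "openin (top_of_set (chart_img c)) (coord c ` (chart_inv c ` V))"
    unfolding coord_image_eq[OF assms(1,3)] using assms by (intro open_subset)
  moreover have "chart_inv c ` V \<subseteq> topspace (subtopology X (chart_dom c))"
    using chart_inv_image_subset[OF assms(3)] topspace_dom[OF assms(1)] by simp
  ultimately have "openin (subtopology X (chart_dom c)) (chart_inv c ` V)"
    using homeomorphic_map_openness[OF homeomorphic_coord[OF assms(1)]] by blast
  then show ?thesis using openin_dom[OF assms(1)] by (simp add: openin_open_subtopology)
qed

lemma continuous_map_chart_inv:
  assumes "c \<in> A"
  shows "continuous_map (top_of_set (chart_img c)) X (chart_inv c)"
  unfolding continuous_map_def
proof (intro conjI allI impI)
  show "chart_inv c \<in> topspace (top_of_set (chart_img c)) \<rightarrow> topspace X"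
    using chart_inv_dom[of _ c] dom_subset[OF assms] by (intro funcsetI) (simp add: subset_iff)
  fix U assume U: "openin X U"
  have "{y \<in> chart_img c. chart_inv c y \<in> U} = coord c ` (U \<inter> chart_dom c)"
    using assms by auto
  then have "open {y \<in> chart_img c. chart_inv c y \<in> U}"
    using open_coord_image[OF assms, of "U \<inter> chart_dom c"] U openin_dom[OF assms] by auto
  then show "openin (top_of_set (chart_img c)) {y \<in> topspace (top_of_set (chart_img c)). chart_inv c y \<in> U}"
    by (simp add: open_subset)
qed

lemma compactin_chart_inv_image:
  assumes "c \<in> A" "compact K" "K \<subseteq> chart_img c"
  shows "compactin X (chart_inv c ` K)"
proof (rule image_compactin[OF _ continuous_map_chart_inv[OF assms(1)]])
  show "compactin (top_of_set (chart_img c)) K"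
    using assms by (simp add: compactin_subtopology)
qed

section \<open>Smooth maps in charts\<close>

text \<open>Fixing one pair of charts, and an open set that is mapped from the first into the second, gives a
  notion of smoothness that composes without case distinctions.\<close>

definition smooth_rep :: "'a chart \<Rightarrow> 'a chart \<Rightarrow> ('a \<Rightarrow> 'a) \<Rightarrow> 'a set \<Rightarrow> bool" where
  "smooth_rep c d \<phi> U \<longleftrightarrow> c \<in> A \<and> d \<in> A \<and> openin X U \<and> U \<subseteq> chart_dom c \<and> \<phi> ` U \<subseteq> chart_dom d \<and>
     smooth_on (coord d \<circ> \<phi> \<circ> chart_inv c) (coord c ` U)"

definition Jac :: "'a chart \<Rightarrow> 'a chart \<Rightarrow> ('a \<Rightarrow> 'a) \<Rightarrow> 'a \<Rightarrow> real^2^2" where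
  "Jac c d \<phi> x = jacobian (coord d \<circ> \<phi> \<circ> chart_inv c) (at (coord c x))"

lemma smooth_rep_subset: "smooth_rep c d \<phi> U \<Longrightarrow> openin X V \<Longrightarrow> V \<subseteq> U \<Longrightarrow> smooth_rep c d \<phi> V"
  by (auto simp: smooth_rep_def elim!: smooth_on_subset)

lemma smooth_rep_open: "smooth_rep c d \<phi> U \<Longrightarrow> open (coord c ` U)"
  unfolding smooth_rep_def using open_coord_image by blast

lemma smooth_rep_cong:
  assumes "smooth_rep c d \<phi> U" "\<And>x. x \<in> U \<Longrightarrow> \<phi> x = \<psi> x"
  shows "smooth_rep c d \<psi> U"
proof -
  have c: "c \<in> A" and U: "U \<subseteq> chart_dom c" using assms(1) by (auto simp: smooth_rep_def)
  have "smooth_on (coord d \<circ> \<psi> \<circ> chart_inv c) (coord c ` U)"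
    by (rule smooth_on_cong[OF smooth_rep_open[OF assms(1)], where f = "coord d \<circ> \<phi> \<circ> chart_inv c"])
      (use assms c U in \<open>auto simp: smooth_rep_def subset_eq\<close>)
  moreover have "\<psi> ` U = \<phi> ` U" using assms(2) by force
  ultimately show ?thesis using assms(1) unfolding smooth_rep_def by metis
qed

lemma smooth_rep_comp:
  assumes \<phi>: "smooth_rep c d \<phi> U" and \<psi>: "smooth_rep d e \<psi> V" and sub: "\<phi> ` U \<subseteq> V"
  shows "smooth_rep c e (\<psi> \<circ> \<phi>) U"
proof -
  have cd: "c \<in> A" "d \<in> A" and U: "U \<subseteq> chart_dom c" and V: "V \<subseteq> chart_dom d"
    and UV: "openin X U" "e \<in> A" "\<psi> ` V \<subseteq> chart_dom e"
    using \<phi> \<psi> by (auto simp: smooth_rep_def)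
  have "smooth_on (\<lambda>y. (coord e \<circ> \<psi> \<circ> chart_inv d) ((coord d \<circ> \<phi> \<circ> chart_inv c) y)) (coord c ` U)"
  proof (rule smooth_on_compose[OF smooth_rep_open[OF \<phi>] smooth_rep_open[OF \<psi>],
        where f = "coord d \<circ> \<phi> \<circ> chart_inv c" and g = "coord e \<circ> \<psi> \<circ> chart_inv d"])
    show "(coord d \<circ> \<phi> \<circ> chart_inv c) ` coord c ` U \<subseteq> coord d ` V"
      using sub cd U by (force simp: subset_eq)
  qed (use \<phi> \<psi> in \<open>simp_all add: smooth_rep_def\<close>)
  moreover have "(coord e \<circ> \<psi> \<circ> chart_inv d) ((coord d \<circ> \<phi> \<circ> chart_inv c) y) =
      (coord e \<circ> (\<psi> \<circ> \<phi>) \<circ> chart_inv c) y" if y: "y \<in> coord c ` U" for y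
  proof -
    obtain x where x: "x \<in> U" "y = coord c x" using y by blast
    then have "x \<in> chart_dom c" "\<phi> x \<in> chart_dom d" using U sub V by auto
    then show ?thesis using x cd by simp
  qed
  ultimately have "smooth_on (coord e \<circ> (\<psi> \<circ> \<phi>) \<circ> chart_inv c) (coord c ` U)"
    by (rule smooth_on_cong[OF smooth_rep_open[OF \<phi>], rotated])
  then show ?thesis using cd U UV sub by (auto simp: smooth_rep_def subset_eq)
qed

lemma smooth_rep_id: "c \<in> A \<Longrightarrow> d \<in> A \<Longrightarrow> smooth_rep c d id (chart_dom c \<inter> chart_dom d)"
  using atlas openin_Int[OF openin_dom[of c] openin_dom[of d]]
  by (simp add: smooth_rep_def smooth_atlas_def)

lemma smooth_rep_change_charts:
  assumes \<phi>: "smooth_rep c d \<phi> U" and "c' \<in> A" "d' \<in> A"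
    and V: "openin X V" "V \<subseteq> U" "V \<subseteq> chart_dom c'" "\<phi> ` V \<subseteq> chart_dom d'"
  shows "smooth_rep c' d' \<phi> V"
proof -
  have cd: "c \<in> A" "d \<in> A" and U: "U \<subseteq> chart_dom c" "\<phi> ` U \<subseteq> chart_dom d"
    using \<phi> by (auto simp: smooth_rep_def)
  have "smooth_rep c' c id V"
    by (rule smooth_rep_subset[OF smooth_rep_id]) (use assms(2) cd U V in \<open>auto simp: subset_eq\<close>)
  then have 1: "smooth_rep c' d (\<phi> \<circ> id) V"
    by (rule smooth_rep_comp) (use \<phi> V in auto)
  have "smooth_rep c' d' (id \<circ> (\<phi> \<circ> id)) V"
    by (rule smooth_rep_comp[OF 1 smooth_rep_id]) (use assms(3) cd U V in \<open>auto simp: subset_eq\<close>)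
  then show ?thesis by simp
qed

lemma openin_self_map_preimage:
  "smooth_self_map X A \<phi> \<Longrightarrow> openin X U \<Longrightarrow> openin X {x \<in> topspace X. \<phi> x \<in> U}"
  by (rule openin_continuous_map_preimage[of X X]) (simp_all add: smooth_self_map_def)

lemma smooth_self_map_rep:
  assumes "smooth_self_map X A \<phi>" "c \<in> A" "d \<in> A"
  shows "smooth_rep c d \<phi> {x \<in> chart_dom c. \<phi> x \<in> chart_dom d}"
proof -
  have "openin X {x \<in> topspace X. \<phi> x \<in> chart_dom d}"
    by (rule openin_self_map_preimage[OF assms(1) openin_dom[OF assms(3)]])
  then have "openin X (chart_dom c \<inter> {x \<in> topspace X. \<phi> x \<in> chart_dom d})"
    using openin_dom[OF assms(2)] by blast
  moreover have "chart_dom c \<inter> {x \<in> topspace X. \<phi> x \<in> chart_dom d} = {x \<in> chart_dom c. \<phi> x \<in> chart_dom d}"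
    using dom_subset[OF assms(2)] by auto
  ultimately show ?thesis using assms by (auto simp: smooth_rep_def smooth_self_map_def)
qed

lemma smooth_rep_openin_preimage:
  assumes \<phi>: "smooth_rep c d \<phi> U" and V: "openin X V"
  shows "openin X {x \<in> U. \<phi> x \<in> V}"
proof -
  let ?F = "coord d \<circ> \<phi> \<circ> chart_inv c"
  have cd: "c \<in> A" "d \<in> A" "U \<subseteq> chart_dom c" "\<phi> ` U \<subseteq> chart_dom d"
    using \<phi> by (auto simp: smooth_rep_def)
  have "open (coord d ` (V \<inter> chart_dom d))"
    using V openin_dom[OF cd(2)] by (intro open_coord_image[OF cd(2)]) auto
  moreover have "continuous_on (coord c ` U) ?F"
    using \<phi> by (intro smooth_on_continuous_on) (simp add: smooth_rep_def)
  ultimately have "open (coord c ` U \<inter> ?F -` (coord d ` (V \<inter> chart_dom d)))"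
    using smooth_rep_open[OF \<phi>] by (intro continuous_open_preimage)
  moreover have "coord c ` U \<inter> ?F -` (coord d ` (V \<inter> chart_dom d)) = coord c ` {x \<in> U. \<phi> x \<in> V}"
  proof -
    have target: "coord d (\<phi> x) \<in> coord d ` (V \<inter> chart_dom d) \<longleftrightarrow> \<phi> x \<in> V" if "x \<in> U" for x
      using that cd(4) inj_onD[OF inj_on_coord[OF cd(2)]] by blast
    have source: "chart_inv c (coord c x) = x" if "x \<in> U" for x
      using that cd by auto
    show ?thesis
    proof (intro set_eqI iffI)
      fix y assume "y \<in> coord c ` U \<inter> ?F -` (coord d ` (V \<inter> chart_dom d))"
      then obtain x where x: "x \<in> U" "y = coord c x" "?F y \<in> coord d ` (V \<inter> chart_dom d)" by blast
      then have "\<phi> x \<in> V" using target[OF x(1)] source[OF x(1)] by simp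
      then show "y \<in> coord c ` {x \<in> U. \<phi> x \<in> V}" using x by blast
    next
      fix y assume "y \<in> coord c ` {x \<in> U. \<phi> x \<in> V}"
      then obtain x where x: "x \<in> U" "\<phi> x \<in> V" "y = coord c x" by blast
      then have "?F y \<in> coord d ` (V \<inter> chart_dom d)" using target[OF x(1)] source[OF x(1)] by simp
      then show "y \<in> coord c ` U \<inter> ?F -` (coord d ` (V \<inter> chart_dom d))" using x by blast
    qed
  qed
  ultimately have "open (coord c ` {x \<in> U. \<phi> x \<in> V})" by simp
  moreover have U': "{x \<in> U. \<phi> x \<in> V} \<subseteq> chart_dom c" using cd(3) by blast
  ultimately have "openin X (chart_inv c ` coord c ` {x \<in> U. \<phi> x \<in> V})"
    by (intro openin_chart_inv_image[OF cd(1)] image_mono)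
  then show ?thesis using chart_inv_image_eq[OF cd(1) U'] by simp
qed

text \<open>Smoothness has to be checked in a single pair of charts around each point only; changes of charts
  take care of all other pairs, and continuity follows.\<close>

lemma smooth_self_mapI:
  assumes loc: "\<And>x. x \<in> topspace X \<Longrightarrow> \<exists>c d U. x \<in> U \<and> smooth_rep c d \<phi> U"
  shows "smooth_self_map X A \<phi>"
  unfolding smooth_self_map_def
proof (intro conjI ballI)
  show cont: "continuous_map X X \<phi>"
    unfolding continuous_map_def
  proof (intro conjI allI impI)
    show "\<phi> \<in> topspace X \<rightarrow> topspace X"
    proof
      fix x assume "x \<in> topspace X"
      with loc obtain c d U where "x \<in> U" "smooth_rep c d \<phi> U" by blast
      then have "d \<in> A" "\<phi> x \<in> chart_dom d" by (auto simp: smooth_rep_def)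
      then show "\<phi> x \<in> topspace X" using dom_subset by blast
    qed
    fix V assume V: "openin X V"
    show "openin X {x \<in> topspace X. \<phi> x \<in> V}"
    proof (subst openin_subopen, intro ballI)
      fix x assume "x \<in> {x \<in> topspace X. \<phi> x \<in> V}"
      then obtain c d U where U: "x \<in> U" "\<phi> x \<in> V" "smooth_rep c d \<phi> U" using loc by blast
      have "{x \<in> U. \<phi> x \<in> V} \<subseteq> {x \<in> topspace X. \<phi> x \<in> V}"
        using openin_subset[of X U] U(3) by (auto simp: smooth_rep_def)
      then show "\<exists>T. openin X T \<and> x \<in> T \<and> T \<subseteq> {x \<in> topspace X. \<phi> x \<in> V}"
        using smooth_rep_openin_preimage[OF U(3) V] U by blast
    qed
  qed
  fix c d assume cd: "c \<in> A" "d \<in> A"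
  show "smooth_on (coord d \<circ> \<phi> \<circ> chart_inv c) (coord c ` {x \<in> chart_dom c. \<phi> x \<in> chart_dom d})"
  proof (rule smooth_on_local)
    fix y assume "y \<in> coord c ` {x \<in> chart_dom c. \<phi> x \<in> chart_dom d}"
    then obtain x where x: "x \<in> chart_dom c" "\<phi> x \<in> chart_dom d" "y = coord c x" by blast
    then obtain c' d' U where U: "x \<in> U" "smooth_rep c' d' \<phi> U"
      using loc dom_subset[OF cd(1)] by blast
    define V where "V = U \<inter> chart_dom c \<inter> {x \<in> topspace X. \<phi> x \<in> chart_dom d}"
    have "openin X V"
      using U openin_dom cd unfolding V_def smooth_rep_def
      by (intro openin_Int openin_continuous_map_preimage[OF cont]) auto
    then have "smooth_rep c d \<phi> V"
      by (rule smooth_rep_change_charts[OF U(2) cd]) (auto simp: V_def)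
    moreover have "x \<in> V" using x U dom_subset[OF cd(1)] by (auto simp: V_def)
    ultimately show "\<exists>T. open T \<and> y \<in> T \<and> smooth_on (coord d \<circ> \<phi> \<circ> chart_inv c) T"
      using x smooth_rep_open[of c d \<phi> V] by (auto simp: smooth_rep_def)
  qed
qed

lemma smooth_self_map_in_topspace:
  "smooth_self_map X A \<phi> \<Longrightarrow> x \<in> topspace X \<Longrightarrow> \<phi> x \<in> topspace X"
  by (auto simp: smooth_self_map_def continuous_map_def)

lemma smooth_self_map_rep_at:
  assumes "smooth_self_map X A \<phi>" "x \<in> topspace X"
  obtains c d U where "x \<in> U" "smooth_rep c d \<phi> U"
proof -
  obtain c where c: "c \<in> A" "x \<in> chart_dom c" using ex_chart[OF assms(2)] by blast
  obtain d where d: "d \<in> A" "\<phi> x \<in> chart_dom d"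
    using ex_chart[OF smooth_self_map_in_topspace[OF assms]] by blast
  show thesis
    by (rule that[OF _ smooth_self_map_rep[OF assms(1) c(1) d(1)]]) (use c d in simp)
qed

lemma smooth_self_map_comp:
  assumes \<phi>: "smooth_self_map X A \<phi>" and \<psi>: "smooth_self_map X A \<psi>"
  shows "smooth_self_map X A (\<psi> \<circ> \<phi>)"
proof (rule smooth_self_mapI)
  fix x assume x: "x \<in> topspace X"
  obtain c d U where U: "x \<in> U" "smooth_rep c d \<phi> U" using smooth_self_map_rep_at[OF \<phi> x] .
  obtain d' e V where V: "\<phi> x \<in> V" "smooth_rep d' e \<psi> V"
    using smooth_self_map_rep_at[OF \<psi> smooth_self_map_in_topspace[OF \<phi> x]] .
  define U' where "U' = U \<inter> {x \<in> topspace X. \<phi> x \<in> V}"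
  have d': "d' \<in> A" "V \<subseteq> chart_dom d'" "openin X V" using V by (auto simp: smooth_rep_def)
  have c: "c \<in> A" "U \<subseteq> chart_dom c" "openin X U" using U by (auto simp: smooth_rep_def)
  have "openin X U'"
    using c d' unfolding U'_def by (intro openin_Int openin_self_map_preimage[OF \<phi>])
  then have "smooth_rep c d' \<phi> U'"
    by (rule smooth_rep_change_charts[OF U(2) c(1) d'(1)]) (use c d' in \<open>auto simp: U'_def\<close>)
  then have "smooth_rep c e (\<psi> \<circ> \<phi>) U'"
    by (rule smooth_rep_comp[OF _ V(2)]) (auto simp: U'_def)
  moreover have "x \<in> U'" using U V x by (simp add: U'_def)
  ultimately show "\<exists>c d U. x \<in> U \<and> smooth_rep c d (\<psi> \<circ> \<phi>) U" by (intro exI conjI)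
qed

lemma smooth_self_map_id: "smooth_self_map X A id"
proof (rule smooth_self_mapI)
  show "\<exists>c d U. x \<in> U \<and> smooth_rep c d id U" if "x \<in> topspace X" for x
    using ex_chart[OF that] smooth_rep_id by blast
qed

lemma smooth_self_map_cong:
  assumes \<phi>: "smooth_self_map X A \<phi>" and eq: "\<And>x. x \<in> topspace X \<Longrightarrow> \<phi> x = \<psi> x"
  shows "smooth_self_map X A \<psi>"
proof (rule smooth_self_mapI)
  fix x assume "x \<in> topspace X"
  with \<phi> obtain c d U where U: "x \<in> U" "smooth_rep c d \<phi> U" by (rule smooth_self_map_rep_at)
  then have "smooth_rep c d \<psi> U"
    by (intro smooth_rep_cong[OF U(2)] eq) (auto simp: smooth_rep_def dest: openin_subset)
  then show "\<exists>c d U. x \<in> U \<and> smooth_rep c d \<psi> U" using U by blast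
qed

lemma diffeomorphismI:
  assumes \<phi>: "smooth_self_map X A \<phi>" and \<psi>: "smooth_self_map X A \<psi>"
    and "\<And>x. x \<in> topspace X \<Longrightarrow> \<psi> (\<phi> x) = x" "\<And>x. x \<in> topspace X \<Longrightarrow> \<phi> (\<psi> x) = x"
  shows "diffeomorphism X A \<phi>"
proof -
  note in_top = smooth_self_map_in_topspace[OF \<phi>] smooth_self_map_in_topspace[OF \<psi>]
  have bij: "bij_betw \<phi> (topspace X) (topspace X)"
    by (rule bij_betw_byWitness[where f' = \<psi>]) (use assms in_top in auto)
  have "smooth_self_map X A (inv_into (topspace X) \<phi>)"
    by (rule smooth_self_map_cong[OF \<psi>])
      (metis assms(4) bij bij_betw_def in_top(2) inv_into_f_f)
  then show ?thesis using bij \<phi> by (simp add: diffeomorphism_def)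
qed

definition smooth_inverses :: "('a \<Rightarrow> 'a) \<Rightarrow> ('a \<Rightarrow> 'a) \<Rightarrow> bool" where
  "smooth_inverses \<phi> \<psi> \<longleftrightarrow> smooth_self_map X A \<phi> \<and> smooth_self_map X A \<psi> \<and>
     (\<forall>x\<in>topspace X. \<psi> (\<phi> x) = x \<and> \<phi> (\<psi> x) = x)"

lemma smooth_inversesD:
  assumes "smooth_inverses \<phi> \<psi>"
  shows "smooth_self_map X A \<phi>" "smooth_self_map X A \<psi>"
    "\<And>x. x \<in> topspace X \<Longrightarrow> \<psi> (\<phi> x) = x" "\<And>x. x \<in> topspace X \<Longrightarrow> \<phi> (\<psi> x) = x"
  using assms by (auto simp: smooth_inverses_def)

lemma diffeomorphism_smooth_inverse:
  assumes "diffeomorphism X A \<phi>"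
  shows "\<exists>\<psi>. smooth_inverses \<phi> \<psi>"
proof
  show "smooth_inverses \<phi> (inv_into (topspace X) \<phi>)"
    using assms
    by (auto simp: smooth_inverses_def diffeomorphism_def bij_betw_def inv_into_f_f f_inv_into_f)
qed

lemma diffeomorphism_comp:
  assumes \<phi>: "diffeomorphism X A \<phi>" and \<psi>: "diffeomorphism X A \<psi>"
  shows "diffeomorphism X A (\<psi> \<circ> \<phi>)"
proof -
  obtain \<phi>' where "smooth_inverses \<phi> \<phi>'"
    using diffeomorphism_smooth_inverse[OF \<phi>] by blast
  note \<phi>' = smooth_inversesD[OF this]
  obtain \<psi>' where "smooth_inverses \<psi> \<psi>'"
    using diffeomorphism_smooth_inverse[OF \<psi>] by blast
  note \<psi>' = smooth_inversesD[OF this]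
  show ?thesis
    by (rule diffeomorphismI[OF smooth_self_map_comp[OF \<phi>'(1) \<psi>'(1)]
          smooth_self_map_comp[OF \<psi>'(2) \<phi>'(2)]])
      (use \<phi>' \<psi>' smooth_self_map_in_topspace in auto)
qed

section \<open>Jacobians and the pullback of tensors\<close>

lemma smooth_rep_has_derivative:
  assumes "smooth_rep c d \<phi> U" "x \<in> U"
  shows "((coord d \<circ> \<phi> \<circ> chart_inv c) has_derivative (\<lambda>h. Jac c d \<phi> x *v h)) (at (coord c x))"
  unfolding Jac_def
  using assms smooth_on_differentiable[of "coord d \<circ> \<phi> \<circ> chart_inv c" "coord c ` U" "coord c x"]
  by (simp add: smooth_rep_def jacobian_works[symmetric])

lemma Jac_eqI:
  assumes "((coord d \<circ> \<phi> \<circ> chart_inv c) has_derivative (\<lambda>h. M *v h)) (at (coord c x))"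
  shows "Jac c d \<phi> x = M"
  using frechet_derivative_eqI[OF assms] by (simp add: Jac_def jacobian_def)

lemma Jac_cong:
  assumes "smooth_rep c d \<phi> U" "\<And>x. x \<in> U \<Longrightarrow> \<phi> x = \<psi> x" "x \<in> U"
  shows "Jac c d \<psi> x = Jac c d \<phi> x"
proof (rule Jac_eqI, rule has_derivative_transform_within_open[OF
      smooth_rep_has_derivative[OF assms(1,3)] smooth_rep_open[OF assms(1)]])
  show "coord c x \<in> coord c ` U" using assms by blast
  show "(coord d \<circ> \<phi> \<circ> chart_inv c) y = (coord d \<circ> \<psi> \<circ> chart_inv c) y" if "y \<in> coord c ` U" for y
    using that assms by (auto simp: smooth_rep_def subset_eq)
qed

lemma Jac_comp:
  assumes \<phi>: "smooth_rep c d \<phi> U" and \<psi>: "smooth_rep d e \<psi> V" and sub: "\<phi> ` U \<subseteq> V" and x: "x \<in> U"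
  shows "Jac c e (\<psi> \<circ> \<phi>) x = Jac d e \<psi> (\<phi> x) ** Jac c d \<phi> x"
proof (rule Jac_eqI)
  have cd: "c \<in> A" "d \<in> A" and U: "U \<subseteq> chart_dom c" and V: "V \<subseteq> chart_dom d"
    using \<phi> \<psi> by (auto simp: smooth_rep_def)
  let ?f = "coord d \<circ> \<phi> \<circ> chart_inv c" and ?g = "coord e \<circ> \<psi> \<circ> chart_inv d"
  have fx: "?f (coord c x) = coord d (\<phi> x)" using cd U x by auto
  have "\<phi> x \<in> V" using sub x by blast
  then have "(?g has_derivative (\<lambda>h. Jac d e \<psi> (\<phi> x) *v h)) (at (?f (coord c x)))"
    unfolding fx by (rule smooth_rep_has_derivative[OF \<psi>])
  from has_derivative_compose[OF smooth_rep_has_derivative[OF \<phi> x] this]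
  have "((\<lambda>y. ?g (?f y)) has_derivative (\<lambda>h. Jac d e \<psi> (\<phi> x) *v (Jac c d \<phi> x *v h))) (at (coord c x))" .
  then have "((coord e \<circ> (\<psi> \<circ> \<phi>) \<circ> chart_inv c) has_derivative
      (\<lambda>h. Jac d e \<psi> (\<phi> x) *v (Jac c d \<phi> x *v h))) (at (coord c x))"
  proof (rule has_derivative_transform_within_open[OF _ smooth_rep_open[OF \<phi>]])
    show "coord c x \<in> coord c ` U" using x by blast
    show "?g (?f y) = (coord e \<circ> (\<psi> \<circ> \<phi>) \<circ> chart_inv c) y" if "y \<in> coord c ` U" for y
      using that sub cd U V by (auto simp: subset_eq)
  qed
  then show "((coord e \<circ> (\<psi> \<circ> \<phi>) \<circ> chart_inv c) has_derivative
      (\<lambda>h. (Jac d e \<psi> (\<phi> x) ** Jac c d \<phi> x) *v h)) (at (coord c x))"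
    by (simp add: matrix_vector_mul_assoc)
qed

lemma Jac_id: "c \<in> A \<Longrightarrow> x \<in> chart_dom c \<Longrightarrow> Jac c c id x = mat 1"
proof (rule Jac_eqI)
  assume c: "c \<in> A" "x \<in> chart_dom c"
  have "((\<lambda>y. y) has_derivative (\<lambda>h. h)) (at (coord c x))" by simp
  then have "((coord c \<circ> id \<circ> chart_inv c) has_derivative (\<lambda>h. h)) (at (coord c x))"
    by (rule has_derivative_transform_within_open[OF _ open_chart_img[OF c(1)]]) (use c in auto)
  then show "((coord c \<circ> id \<circ> chart_inv c) has_derivative (\<lambda>h. mat 1 *v h)) (at (coord c x))"
    by simp
qed

lemma Jac_self_map_comp:
  assumes \<phi>: "smooth_self_map X A \<phi>" and \<psi>: "smooth_self_map X A \<psi>"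
    and c: "c \<in> A" "d \<in> A" "e \<in> A" and x: "x \<in> chart_dom c" "\<phi> x \<in> chart_dom d" "\<psi> (\<phi> x) \<in> chart_dom e"
  shows "Jac c e (\<psi> \<circ> \<phi>) x = Jac d e \<psi> (\<phi> x) ** Jac c d \<phi> x"
proof -
  let ?V = "{y \<in> chart_dom d. \<psi> y \<in> chart_dom e}"
  let ?U = "{x \<in> chart_dom c. \<phi> x \<in> chart_dom d} \<inter> {x \<in> topspace X. \<phi> x \<in> ?V}"
  have \<psi>V: "smooth_rep d e \<psi> ?V" by (rule smooth_self_map_rep[OF \<psi> c(2,3)])
  then have "openin X {x \<in> topspace X. \<phi> x \<in> ?V}"
    by (intro openin_self_map_preimage[OF \<phi>]) (simp add: smooth_rep_def)
  then have "smooth_rep c d \<phi> ?U"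
    using smooth_self_map_rep[OF \<phi> c(1,2)]
    by (intro smooth_rep_subset[OF smooth_self_map_rep[OF \<phi> c(1,2)]]) (auto simp: smooth_rep_def)
  then show ?thesis
    by (rule Jac_comp[OF _ \<psi>V]) (use x dom_subset[OF c(1)] in auto)
qed

lemma Jac_inverse:
  assumes \<phi>: "smooth_self_map X A \<phi>" and \<psi>: "smooth_self_map X A \<psi>"
    and inv: "\<And>x. x \<in> topspace X \<Longrightarrow> \<psi> (\<phi> x) = x"
    and c: "c \<in> A" "d \<in> A" and x: "x \<in> chart_dom c" "\<phi> x \<in> chart_dom d"
  shows "Jac d c \<psi> (\<phi> x) ** Jac c d \<phi> x = mat 1"
proof -
  have "Jac d c \<psi> (\<phi> x) ** Jac c d \<phi> x = Jac c c (\<psi> \<circ> \<phi>) x"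
    using Jac_self_map_comp[OF \<phi> \<psi> c c(1)] x inv dom_subset[OF c(1)] by force
  also have "\<dots> = Jac c c id x"
    using smooth_rep_id[OF c(1) c(1)] inv dom_subset[OF c(1)] x(1)
    by (intro Jac_cong[where U = "chart_dom c"]) auto
  finally show ?thesis using Jac_id c x by simp
qed

text \<open>The relation \<open>g' = \<phi>\<^sup>* g\<close> between component matrices, for every choice of charts at source
  and target. In contrast to \<^const>\<open>pullback\<close>, which picks one chart at the target, it can be
  composed and inverted by calculating with matrices.\<close>

definition pulls_back :: "('a \<Rightarrow> 'a) \<Rightarrow> 'a tensor2 \<Rightarrow> 'a tensor2 \<Rightarrow> bool" where
  "pulls_back \<phi> g g' \<longleftrightarrow> (\<forall>c\<in>A. \<forall>d\<in>A. \<forall>x\<in>chart_dom c. \<phi> x \<in> chart_dom d \<longrightarrow>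
     g' c x = transpose (Jac c d \<phi> x) ** g d (\<phi> x) ** Jac c d \<phi> x)"

lemma pulls_backD:
  "pulls_back \<phi> g g' \<Longrightarrow> c \<in> A \<Longrightarrow> d \<in> A \<Longrightarrow> x \<in> chart_dom c \<Longrightarrow> \<phi> x \<in> chart_dom d \<Longrightarrow>
    g' c x = transpose (Jac c d \<phi> x) ** g d (\<phi> x) ** Jac c d \<phi> x"
  by (simp add: pulls_back_def)

lemma riemannian_metric_pulls_back_id: "riemannian_metric A g \<Longrightarrow> pulls_back id g g"
  unfolding riemannian_metric_def pulls_back_def Jac_def Let_def comp_id id_apply by blast

lemma congruence_assoc:
  fixes G :: "real^2^2"
  shows "transpose J ** (transpose K ** G ** K) ** J = transpose (K ** J) ** G ** (K ** J)"
  by (simp add: matrix_transpose_mul matrix_mul_assoc)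

lemma pulls_back_pullback:
  assumes \<phi>: "smooth_self_map X A \<phi>" and g: "riemannian_metric A g"
    and g': "\<And>c x. c \<in> A \<Longrightarrow> x \<in> chart_dom c \<Longrightarrow> g' c x = pullback A \<phi> g c x"
  shows "pulls_back \<phi> g g'"
  unfolding pulls_back_def
proof (intro ballI impI)
  fix c d x assume c: "c \<in> A" "d \<in> A" "x \<in> chart_dom c" "\<phi> x \<in> chart_dom d"
  define e where "e = chart_at A (\<phi> x)"
  have e: "e \<in> A" "\<phi> x \<in> chart_dom e"
    using chart_at dom_subset[OF c(2)] c(4) by (auto simp: e_def)
  have "g' c x = transpose (Jac c e \<phi> x) ** g e (\<phi> x) ** Jac c e \<phi> x"
    using g' c by (simp add: pullback_def Let_def e_def Jac_def)
  also have "g e (\<phi> x) = transpose (Jac e d id (\<phi> x)) ** g d (\<phi> x) ** Jac e d id (\<phi> x)"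
    using pulls_backD[OF riemannian_metric_pulls_back_id[OF g], of e d "\<phi> x"] c e by simp
  also have "transpose (Jac c e \<phi> x) ** \<dots> ** Jac c e \<phi> x =
      transpose (Jac c d (id \<circ> \<phi>) x) ** g d (\<phi> x) ** Jac c d (id \<circ> \<phi>) x"
  proof -
    have "Jac c d (id \<circ> \<phi>) x = Jac e d id (\<phi> x) ** Jac c e \<phi> x"
      by (rule Jac_self_map_comp[OF \<phi> smooth_self_map_id]) (use c e in auto)
    then show ?thesis by (simp add: congruence_assoc)
  qed
  finally show "g' c x = transpose (Jac c d \<phi> x) ** g d (\<phi> x) ** Jac c d \<phi> x" by simp
qed

lemma pullback_if_pulls_back:
  assumes "smooth_self_map X A \<phi>" "pulls_back \<phi> g g'" "c \<in> A" "x \<in> chart_dom c"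
  shows "g' c x = pullback A \<phi> g c x"
  using pulls_backD[OF assms(2,3), of "chart_at A (\<phi> x)" x] assms
    chart_at[OF smooth_self_map_in_topspace[OF assms(1)], of x] dom_subset[OF assms(3)]
  by (auto simp: pullback_def Let_def Jac_def)

lemma pulls_back_comp:
  assumes \<phi>: "smooth_self_map X A \<phi>" and \<psi>: "smooth_self_map X A \<psi>"
    and g: "pulls_back \<phi> g g'" "pulls_back \<psi> g' g''"
  shows "pulls_back (\<phi> \<circ> \<psi>) g g''"
  unfolding pulls_back_def
proof (intro ballI impI)
  fix c e x assume c: "c \<in> A" "e \<in> A" "x \<in> chart_dom c" "(\<phi> \<circ> \<psi>) x \<in> chart_dom e"
  then obtain d where d: "d \<in> A" "\<psi> x \<in> chart_dom d"
    using ex_chart smooth_self_map_in_topspace[OF \<psi>] dom_subset by blast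
  show "g'' c x = transpose (Jac c e (\<phi> \<circ> \<psi>) x) ** g e ((\<phi> \<circ> \<psi>) x) ** Jac c e (\<phi> \<circ> \<psi>) x"
    using c d by (simp add: pulls_backD[OF g(2), of c d x] pulls_backD[OF g(1), of d e "\<psi> x"]
        congruence_assoc Jac_self_map_comp[OF \<psi> \<phi>, of c d e x])
qed

lemma pulls_back_inverse:
  assumes \<phi>: "smooth_self_map X A \<phi>" and \<psi>: "smooth_self_map X A \<psi>"
    and "\<And>x. x \<in> topspace X \<Longrightarrow> \<phi> (\<psi> x) = x"
    and g: "pulls_back \<phi> g g'"
  shows "pulls_back \<psi> g' g"
  unfolding pulls_back_def
proof (intro ballI impI)
  fix c d x assume c: "c \<in> A" "d \<in> A" "x \<in> chart_dom c" "\<psi> x \<in> chart_dom d"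
  have x: "\<phi> (\<psi> x) = x" using assms(3) c dom_subset by blast
  have "g' d (\<psi> x) = transpose (Jac d c \<phi> (\<psi> x)) ** g c x ** Jac d c \<phi> (\<psi> x)"
    using pulls_backD[OF g c(2,1,4)] x c by simp
  moreover have "Jac d c \<phi> (\<psi> x) ** Jac c d \<psi> x = mat 1"
    by (rule Jac_inverse[OF \<psi> \<phi> assms(3)]) (use c in auto)
  ultimately show "g c x = transpose (Jac c d \<psi> x) ** g' d (\<psi> x) ** Jac c d \<psi> x"
    by (simp add: congruence_assoc)
qed

lemma smooth_rep_Jac:
  assumes "smooth_rep c d \<phi> U"
  shows "smooth_on (\<lambda>y. Jac c d \<phi> (chart_inv c y)) (coord c ` U)"
proof -
  let ?f = "coord d \<circ> \<phi> \<circ> chart_inv c"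
  note U = smooth_rep_open[OF assms]
  have sm: "smooth_on ?f (coord c ` U)" using assms by (simp add: smooth_rep_def)
  have "smooth_on (\<lambda>y. jacobian ?f (at y)) (coord c ` U)"
  proof (rule smooth_on_componentwise[OF U])
    fix b :: "real^2^2" assume "b \<in> Basis"
    then obtain i j where b: "b = axis i (axis j 1)" by (auto simp: Basis_vec_def)
    have "jacobian ?f (at y) \<bullet> b = frechet_derivative ?f (at y) (axis j 1) \<bullet> axis i 1" for y
      by (simp add: b inner_axis jacobian_def matrix_def)
    then show "smooth_on (\<lambda>y. jacobian ?f (at y) \<bullet> b) (coord c ` U)"
      using smooth_on_linear[OF U bounded_linear_inner_left smooth_on_frechet_derivative[OF sm]] by simp
  qed
  then show ?thesis
    by (rule smooth_on_cong[OF U, rotated]) (use assms in \<open>auto simp: Jac_def smooth_rep_def subset_eq\<close>)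
qed

lemma smooth_on_matrix_mult:
  fixes F G :: "'b::real_normed_vector \<Rightarrow> real^2^2"
  assumes "open S" "smooth_on F S" "smooth_on G S"
  shows "smooth_on (\<lambda>y. F y ** G y) S"
proof (rule smooth_on_bilinear[OF assms(1) _ assms(2,3)])
  have "bilinear ((**) :: real^2^2 \<Rightarrow> real^2^2 \<Rightarrow> real^2^2)"
    by (auto simp: bilinear_def linear_iff matrix_matrix_mult_def vec_eq_iff algebra_simps
        sum.distrib sum_distrib_left)
  then show "bounded_bilinear ((**) :: real^2^2 \<Rightarrow> real^2^2 \<Rightarrow> real^2^2)"
    by (simp add: bilinear_conv_bounded_bilinear)
qed

lemma smooth_on_transpose:
  fixes F :: "'b::real_normed_vector \<Rightarrow> real^2^2"
  assumes "open S" "smooth_on F S"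
  shows "smooth_on (\<lambda>y. transpose (F y)) S"
proof (rule smooth_on_linear[OF assms(1) _ assms(2)])
  have "linear (transpose :: real^2^2 \<Rightarrow> real^2^2)"
    by (auto simp: linear_iff transpose_def vec_eq_iff)
  then show "bounded_linear (transpose :: real^2^2 \<Rightarrow> real^2^2)"
    by (simp add: linear_conv_bounded_linear)
qed

lemma smooth_rep_tensor:
  assumes \<phi>: "smooth_rep c d \<phi> U" and g: "smooth_on (g \<circ> chart_inv d) (chart_img d)"
  shows "smooth_on (\<lambda>y. (g :: 'a \<Rightarrow> 'b::real_normed_vector) (\<phi> (chart_inv c y))) (coord c ` U)"
proof -
  note U = smooth_rep_open[OF \<phi>]
  have d: "c \<in> A" "d \<in> A" "U \<subseteq> chart_dom c" "\<phi> ` U \<subseteq> chart_dom d" using \<phi> by (auto simp: smooth_rep_def)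
  have "smooth_on (\<lambda>y. (g \<circ> chart_inv d) ((coord d \<circ> \<phi> \<circ> chart_inv c) y)) (coord c ` U)"
    by (rule smooth_on_compose[OF U open_chart_img[OF d(2)] _ _ g,
          where f = "coord d \<circ> \<phi> \<circ> chart_inv c"])
      (use \<phi> d in \<open>auto simp: smooth_rep_def subset_eq\<close>)
  then show ?thesis
    by (rule smooth_on_cong[OF U, rotated]) (use d in \<open>auto simp: subset_eq\<close>)
qed

text \<open>Smoothness and positivity are inherited from \<open>g\<close> through the matrix formula, positivity because the
  Jacobian of a diffeomorphism is injective.\<close>

lemma riemannian_metric_pulls_back:
  assumes \<phi>: "diffeomorphism X A \<phi>" and g: "riemannian_metric A g" and pb: "pulls_back \<phi> g g'"
  shows "riemannian_metric A g'"
proof -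
  obtain \<psi> where inverse: "smooth_inverses \<phi> \<psi>"
    using diffeomorphism_smooth_inverse[OF \<phi>] by blast
  note \<phi>s = smooth_inversesD(1)[OF inverse] and \<psi> = smooth_inversesD(2-4)[OF inverse]
  have target: "\<exists>d\<in>A. \<phi> x \<in> chart_dom d" if "x \<in> chart_dom c" "c \<in> A" for c x
    using ex_chart smooth_self_map_in_topspace[OF \<phi>s] dom_subset that by blast
  have smooth: "smooth_on (g' c \<circ> chart_inv c) (chart_img c)" if c: "c \<in> A" for c
  proof (rule smooth_on_local)
    fix y assume "y \<in> chart_img c"
    then obtain x where x: "x \<in> chart_dom c" "y = coord c x" by blast
    with target c obtain d where d: "d \<in> A" "\<phi> x \<in> chart_dom d" by blast
    let ?U = "{x \<in> chart_dom c. \<phi> x \<in> chart_dom d}"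
    let ?J = "\<lambda>y. Jac c d \<phi> (chart_inv c y)"
    have rep: "smooth_rep c d \<phi> ?U" by (rule smooth_self_map_rep[OF \<phi>s c d(1)])
    note U = smooth_rep_open[OF rep]
    have "smooth_on (\<lambda>y. transpose (?J y) ** g d (\<phi> (chart_inv c y)) ** ?J y) (coord c ` ?U)"
      using g d by (intro smooth_on_matrix_mult smooth_on_transpose smooth_rep_Jac[OF rep]
          smooth_rep_tensor[OF rep] U) (auto simp: riemannian_metric_def)
    then have "smooth_on (g' c \<circ> chart_inv c) (coord c ` ?U)"
      by (rule smooth_on_cong[OF U, rotated]) (use pulls_backD[OF pb c d(1)] c in auto)
    then show "\<exists>T. open T \<and> y \<in> T \<and> smooth_on (g' c \<circ> chart_inv c) T"
      using U x d by blast
  qed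
  have pos: "transpose (g' c x) = g' c x \<and> (\<forall>v. v \<noteq> 0 \<longrightarrow> v \<bullet> (g' c x *v v) > 0)"
    if c: "c \<in> A" "x \<in> chart_dom c" for c x
  proof -
    obtain d where d: "d \<in> A" "\<phi> x \<in> chart_dom d" using target c by blast
    define J where "J = Jac c d \<phi> x"
    define G where "G = g d (\<phi> x)"
    have eq: "g' c x = transpose J ** G ** J"
      using pulls_backD[OF pb c(1) d(1) c(2) d(2)] by (simp add: J_def G_def)
    have G: "transpose G = G" "\<And>v. v \<noteq> 0 \<Longrightarrow> v \<bullet> (G *v v) > 0"
      using g d by (auto simp: riemannian_metric_def G_def)
    have inv: "Jac d c \<psi> (\<phi> x) ** J = mat 1"
      unfolding J_def by (rule Jac_inverse[OF \<phi>s \<psi>(1,2)]) (use c d in auto)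
    show ?thesis
    proof (intro conjI allI impI)
      show "transpose (g' c x) = g' c x"
        by (simp add: eq matrix_transpose_mul G(1) matrix_mul_assoc)
      fix v :: "real^2" assume "v \<noteq> 0"
      then have "J *v v \<noteq> 0"
        using inv by (metis matrix_vector_mul_assoc matrix_vector_mul_lid matrix_vector_mult_0_right)
      moreover have "v \<bullet> (g' c x *v v) = (J *v v) \<bullet> (G *v (J *v v))"
      proof -
        have "g' c x *v v = transpose J *v (G *v (J *v v))"
          by (simp add: eq matrix_vector_mul_assoc matrix_mul_assoc)
        then show ?thesis using dot_lmul_matrix[of v "transpose J" "G *v (J *v v)"] by simp
      qed
      ultimately show "v \<bullet> (g' c x *v v) > 0" using G(2) by simp
    qed
  qed
  \<comment> \<open>The transformation law of \<open>g'\<close> says that \<open>g'\<close> is its own pullback under the identity,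
    which is \<open>\<psi> \<circ> \<phi>\<close> on the surface.\<close>
  have comp: "pulls_back (\<psi> \<circ> \<phi>) g' g'"
    by (rule pulls_back_comp[OF \<psi>(1) \<phi>s pulls_back_inverse[OF \<phi>s \<psi>(1,3) pb] pb])
  have "pulls_back id g' g'"
    unfolding pulls_back_def
  proof (intro ballI impI)
    fix c d x assume c: "c \<in> A" "d \<in> A" "x \<in> chart_dom c" "id x \<in> chart_dom d"
    have "\<psi> (\<phi> y) = y" if "y \<in> chart_dom c" for y
      using \<psi>(2) that dom_subset[OF c(1)] by blast
    then have "Jac c d (\<psi> \<circ> \<phi>) x = Jac c d id x" "(\<psi> \<circ> \<phi>) x = x"
      using c by (auto intro!: Jac_cong[OF smooth_rep_id[OF c(1,2)]])
    then show "g' c x = transpose (Jac c d id x) ** g' d (id x) ** Jac c d id x"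
      using pulls_backD[OF comp c(1,2,3)] c(4) by simp
  qed
  then show ?thesis
    using smooth pos
    unfolding riemannian_metric_def pulls_back_def Jac_def Let_def comp_id id_apply by blast
qed

lemma isometric_iff:
  assumes "riemannian_metric A g"
  shows "isometric X A g g' \<longleftrightarrow> (\<exists>\<phi>. diffeomorphism X A \<phi> \<and> pulls_back \<phi> g g')"
proof -
  have "(\<forall>c\<in>A. \<forall>x\<in>chart_dom c. g' c x = pullback A \<phi> g c x) \<longleftrightarrow> pulls_back \<phi> g g'"
    if "diffeomorphism X A \<phi>" for \<phi>
    using that pulls_back_pullback[OF _ assms] pullback_if_pulls_back
    unfolding diffeomorphism_def by blast
  then show ?thesis unfolding isometric_def by blast
qed

lemma isometric_sym:
  assumes g: "riemannian_metric A g" and "isometric X A g g'"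
  shows "isometric X A g' g"
proof -
  obtain \<phi> where \<phi>: "diffeomorphism X A \<phi>" "pulls_back \<phi> g g'"
    using assms isometric_iff by blast
  obtain \<psi> where "smooth_inverses \<phi> \<psi>"
    using diffeomorphism_smooth_inverse[OF \<phi>(1)] by blast
  note \<psi> = smooth_inversesD[OF this]
  have "riemannian_metric A g'" using riemannian_metric_pulls_back[OF \<phi>(1) g \<phi>(2)] .
  moreover have "diffeomorphism X A \<psi>" using diffeomorphismI[OF \<psi>(2,1,4,3)] .
  moreover have "pulls_back \<psi> g' g" using pulls_back_inverse[OF \<psi>(1,2,4) \<phi>(2)] .
  ultimately show ?thesis using isometric_iff by blast
qed

lemma isometric_trans:
  assumes g: "riemannian_metric A g" and "isometric X A g g'" "isometric X A g' g''"
  shows "isometric X A g g''"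
proof -
  obtain \<phi> where \<phi>: "diffeomorphism X A \<phi>" "pulls_back \<phi> g g'"
    using assms isometric_iff by blast
  have "riemannian_metric A g'" using riemannian_metric_pulls_back[OF \<phi>(1) g \<phi>(2)] .
  then obtain \<psi> where \<psi>: "diffeomorphism X A \<psi>" "pulls_back \<psi> g' g''"
    using assms isometric_iff by blast
  have "pulls_back (\<phi> \<circ> \<psi>) g g''"
    using pulls_back_comp \<phi> \<psi> by (auto simp: diffeomorphism_def)
  then show ?thesis using isometric_iff[OF g] diffeomorphism_comp[OF \<psi>(1) \<phi>(1)] by blast
qed

end

section \<open>Change of variables for nonnegative integrals\<close>

lemma absolutely_integrable_iff_nn_integral:
  fixes f :: "'a::euclidean_space \<Rightarrow> real"
  assumes f: "set_borel_measurable borel S f" "\<And>x. x \<in> S \<Longrightarrow> 0 \<le> f x"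
  shows "f absolutely_integrable_on S \<longleftrightarrow> (\<integral>\<^sup>+x\<in>S. ennreal (f x) \<partial>lborel) < \<infinity>"
proof -
  have m: "(\<lambda>x. indicator S x *\<^sub>R f x) \<in> borel_measurable lborel"
    using f(1) by (simp add: set_borel_measurable_def)
  have eq: "ennreal (norm (indicator S x *\<^sub>R f x)) = ennreal (f x) * indicator S x" for x
    using f(2)[of x] by (auto simp: indicator_def)
  have "f absolutely_integrable_on S \<longleftrightarrow> integrable lborel (\<lambda>x. indicator S x *\<^sub>R f x)"
    unfolding set_integrable_def using integrable_completion[OF m] .
  also have "\<dots> \<longleftrightarrow> (\<integral>\<^sup>+x\<in>S. ennreal (f x) \<partial>lborel) < \<infinity>"
    using m unfolding integrable_iff_bounded eq by simp
  finally show ?thesis .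
qed

text \<open>Changes of variables preserve absolute integrability in both directions, so the two
  integrals are infinite together. This is the form needed for measures, where finiteness is not
  known beforehand.\<close>

lemma nn_integral_change_of_variables:
  fixes F :: "real^'n::{finite,wellorder} \<Rightarrow> real^'n::_" and f :: "real^'n::_ \<Rightarrow> real"
  assumes S: "S \<in> sets borel"
    and der: "\<And>x. x \<in> S \<Longrightarrow> (F has_derivative F' x) (at x)" and inj: "inj_on F S"
    and f: "set_borel_measurable borel (F ` S) f" "\<And>y. y \<in> F ` S \<Longrightarrow> 0 \<le> f y"
    and g: "set_borel_measurable borel S g" "\<And>x. x \<in> S \<Longrightarrow> g x = \<bar>det (matrix (F' x))\<bar> * f (F x)"
  shows "(\<integral>\<^sup>+y\<in>F ` S. ennreal (f y) \<partial>lborel) = (\<integral>\<^sup>+x\<in>S. ennreal (g x) \<partial>lborel)"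
proof -
  have gnn: "0 \<le> g x" if "x \<in> S" for x using g(2) f(2) that by simp
  \<comment> \<open>The change of variables theorem is about vector-valued functions, so \<open>f\<close> takes values in
    the one-dimensional space for a moment.\<close>
  let ?v = "\<lambda>r. (\<chi> i. r) :: real^1"
  have lv: "bounded_linear ?v"
    by (simp add: linear_conv_bounded_linear[symmetric] linear_iff vec_eq_iff)
  have ld: "bounded_linear (\<lambda>y::real^1. y $ 1)" by (rule bounded_linear_vec_nth)
  have abs: "h absolutely_integrable_on T \<longleftrightarrow> (\<lambda>x. ?v (h x)) absolutely_integrable_on T"
    for h :: "real^'n::_ \<Rightarrow> real" and T
    using absolutely_integrable_linear[OF _ lv, where f = h]
      absolutely_integrable_linear[OF _ ld, where f = "\<lambda>x. ?v (h x)"]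
    by (auto simp: o_def)
  have int: "integral T (\<lambda>x. ?v (h x)) = ?v (integral T h)"
    if "h absolutely_integrable_on T" for h :: "real^'n::_ \<Rightarrow> real" and T
    using integral_linear[OF _ lv, where f = h] that by (simp add: o_def set_lebesgue_integral_eq_integral)
  have gv: "g absolutely_integrable_on S \<longleftrightarrow> (\<lambda>x. \<bar>det (matrix (F' x))\<bar> *\<^sub>R ?v (f (F x))) absolutely_integrable_on S"
    unfolding abs[where h = g] by (rule set_integrable_cong) (auto simp: g(2) vec_eq_iff)
  have gi: "integral S (\<lambda>x. \<bar>det (matrix (F' x))\<bar> *\<^sub>R ?v (f (F x))) = integral S (\<lambda>x. ?v (g x))"
    by (rule integral_cong) (auto simp: g(2) vec_eq_iff)
  have cov: "(\<lambda>x. \<bar>det (matrix (F' x))\<bar> *\<^sub>R ?v (f (F x))) absolutely_integrable_on S \<and>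
      integral S (\<lambda>x. \<bar>det (matrix (F' x))\<bar> *\<^sub>R ?v (f (F x))) = b \<longleftrightarrow>
      (\<lambda>y. ?v (f y)) absolutely_integrable_on F ` S \<and> integral (F ` S) (\<lambda>y. ?v (f y)) = b" for b
    by (rule has_absolute_integral_change_of_variables)
      (use S der inj in \<open>auto intro: has_derivative_at_withinI\<close>)
  have iff: "f absolutely_integrable_on F ` S \<longleftrightarrow> g absolutely_integrable_on S"
    unfolding gv abs[where h = f] using cov by blast
  have fin_f: "f absolutely_integrable_on F ` S \<longleftrightarrow> (\<integral>\<^sup>+y\<in>F ` S. ennreal (f y) \<partial>lborel) < \<infinity>"
    by (rule absolutely_integrable_iff_nn_integral[OF f])
  have fin_g: "g absolutely_integrable_on S \<longleftrightarrow> (\<integral>\<^sup>+x\<in>S. ennreal (g x) \<partial>lborel) < \<infinity>"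
    by (rule absolutely_integrable_iff_nn_integral[OF g(1) gnn])
  show ?thesis
  proof (cases "f absolutely_integrable_on F ` S")
    case True
    then have g': "g absolutely_integrable_on S" using iff by simp
    have "?v (integral (F ` S) f) = ?v (integral S g)"
      using cov g' True unfolding int[OF True, symmetric] int[OF g', symmetric] gi[symmetric] gv abs[where h = f]
      by blast
    then have "integral (F ` S) f = integral S g" by (simp add: vec_eq_iff)
    moreover have "(\<integral>\<^sup>+y\<in>F ` S. ennreal (f y) \<partial>lborel) = integral (F ` S) f"
      by (rule set_nn_integral_lborel_eq_integral[OF f]) (use fin_f True in auto)
    moreover have "(\<integral>\<^sup>+x\<in>S. ennreal (g x) \<partial>lborel) = integral S g"
      by (rule set_nn_integral_lborel_eq_integral[OF g(1) gnn]) (use fin_g g' in auto)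
    ultimately show ?thesis by simp
  next
    case False
    then have "\<not> (\<integral>\<^sup>+y\<in>F ` S. ennreal (f y) \<partial>lborel) < \<infinity>" "\<not> (\<integral>\<^sup>+x\<in>S. ennreal (g x) \<partial>lborel) < \<infinity>"
      using iff fin_f fin_g by blast+
    then show ?thesis by (simp add: less_top[symmetric])
  qed
qed

section \<open>The area measure\<close>

text \<open>For a symmetric matrix with entries \<open>a, b, b, d\<close>, evaluate the form at \<open>(1, 0)\<close>, which gives \<open>a\<close>, and at
  \<open>(- b, a)\<close>, which gives \<open>a\<close> times the determinant.\<close>

lemma det_pos:
  fixes G :: "real^2^2"
  assumes "transpose G = G" "\<And>v. v \<noteq> 0 \<Longrightarrow> v \<bullet> (G *v v) > 0"
  shows "det G > 0"
proof -
  have sym: "G$1$2 = G$2$1" using assms(1) by (simp add: transpose_def vec_eq_iff)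
  have "vector [1, 0] \<noteq> (0 :: real^2)" by (simp add: vec_eq_iff forall_2 vector_2)
  from assms(2)[OF this] have a: "G$1$1 > 0"
    by (simp add: inner_vec_def matrix_vector_mult_def sum_2 vector_2)
  have "vector [- (G$1$2), G$1$1] \<noteq> (0 :: real^2)" using a by (simp add: vec_eq_iff forall_2 vector_2)
  from assms(2)[OF this] have "G$1$1 * det G > 0"
    by (simp add: inner_vec_def matrix_vector_mult_def sum_2 vector_2 det_2 sym algebra_simps)
  then show ?thesis using a by (simp add: zero_less_mult_iff)
qed

lemma emeasure_finite_partition:
  assumes "finite I" "\<And>i. i \<in> I \<Longrightarrow> Q i \<in> sets M" "disjoint_family_on Q I" "B \<in> sets M" "B \<subseteq> (\<Union>i\<in>I. Q i)"
  shows "emeasure M B = (\<Sum>i\<in>I. emeasure M (B \<inter> Q i))"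
proof -
  have "disjoint_family_on (\<lambda>i. B \<inter> Q i) I"
    using assms(3) by (auto simp: disjoint_family_on_def)
  then have "(\<Sum>i\<in>I. emeasure M (B \<inter> Q i)) = emeasure M (\<Union>i\<in>I. B \<inter> Q i)"
    using assms by (intro sum_emeasure) auto
  also have "(\<Union>i\<in>I. B \<inter> Q i) = B" using assms(5) by blast
  finally show ?thesis by simp
qed

context surface_atlas
begin

definition BX :: "'a measure" where
  "BX = sigma (topspace X) {U. openin X U}"

lemma open_sets_Pow: "{U. openin X U} \<subseteq> Pow (topspace X)"
  using openin_subset by blast

lemma sets_BX: "sets BX = borel_sets X"
  using open_sets_Pow by (simp add: BX_def borel_sets_def)

lemma space_BX: "space BX = topspace X"
  by (simp add: BX_def space_measure_of_conv)

lemma sigma_algebra_borel_sets: "sigma_algebra (topspace X) (borel_sets X)"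
  unfolding borel_sets_def by (rule sigma_algebra_sigma_sets[OF open_sets_Pow])

lemma open_borel: "openin X U \<Longrightarrow> U \<in> borel_sets X"
  by (simp add: borel_sets_def sigma_sets.Basic)

lemma borel_sets_subset: "B \<in> borel_sets X \<Longrightarrow> B \<subseteq> topspace X"
  using sigma_sets_into_sp[OF open_sets_Pow] by (simp add: borel_sets_def)

lemma coord_image_borel:
  assumes "c \<in> A" "B \<in> borel_sets X" "B \<subseteq> chart_dom c"
  shows "coord c ` B \<in> sets borel"
proof -
  have "coord c ` (B \<inter> chart_dom c) \<in> sets borel"
    using assms(2) unfolding borel_sets_def
  proof (induction B rule: sigma_sets.induct)
    case (Basic U)
    then have "open (coord c ` (U \<inter> chart_dom c))"
      using openin_dom[OF assms(1)] by (intro open_coord_image[OF assms(1)]) auto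
    then show ?case by simp
  next
    case (Compl B)
    have "coord c ` ((topspace X - B) \<inter> chart_dom c) = chart_img c - coord c ` (B \<inter> chart_dom c)"
      using inj_on_coord[OF assms(1)] dom_subset[OF assms(1)] by (auto simp: inj_on_def)
    then show ?case using Compl open_chart_img[OF assms(1)] by (simp add: sets.Diff)
  next
    case (Union B)
    have "coord c ` ((\<Union>i. B i) \<inter> chart_dom c) = (\<Union>i. coord c ` (B i \<inter> chart_dom c))" by blast
    then show ?case using Union by auto
  qed simp
  then show ?thesis using assms(3) by (simp add: Int_absorb2)
qed

lemma preimage_borel:
  assumes "continuous_map X X \<phi>" "B \<in> borel_sets X"
  shows "{x \<in> topspace X. \<phi> x \<in> B} \<in> borel_sets X"
proof -
  have "\<phi> \<in> measurable BX BX"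
    unfolding BX_def
  proof (rule measurable_measure_of[OF open_sets_Pow], unfold BX_def[symmetric] space_BX sets_BX)
    show "\<phi> \<in> topspace X \<rightarrow> topspace X" using assms(1) by (simp add: continuous_map_def)
    fix U assume "U \<in> {U. openin X U}"
    then have "openin X {x \<in> topspace X. \<phi> x \<in> U}"
      using openin_continuous_map_preimage[OF assms(1)] by simp
    moreover have "{x \<in> topspace X. \<phi> x \<in> U} = \<phi> -` U \<inter> topspace X" by blast
    ultimately show "\<phi> -` U \<inter> topspace X \<in> borel_sets X" using open_borel by simp
  qed
  moreover have "B \<in> sets BX" unfolding sets_BX by fact
  ultimately have "\<phi> -` B \<inter> space BX \<in> sets BX" by (rule measurable_sets)
  moreover have "\<phi> -` B \<inter> space BX = {x \<in> topspace X. \<phi> x \<in> B}" by (auto simp: space_BX)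
  ultimately show ?thesis by (simp add: sets_BX)
qed

lemma diffeomorphism_image_eq:
  assumes "\<And>x. x \<in> topspace X \<Longrightarrow> \<psi> (\<phi> x) = x" "\<And>x. x \<in> topspace X \<Longrightarrow> \<phi> (\<psi> x) = x"
    "smooth_self_map X A \<phi>" "smooth_self_map X A \<psi>" "B \<subseteq> topspace X"
  shows "\<phi> ` B = {y \<in> topspace X. \<psi> y \<in> B}"
  using assms smooth_self_map_in_topspace by (auto simp: subset_eq image_iff) metis+

lemma diffeomorphism_image_borel:
  assumes "diffeomorphism X A \<phi>" "B \<in> borel_sets X"
  shows "\<phi> ` B \<in> borel_sets X"
proof -
  obtain \<psi> where "smooth_inverses \<phi> \<psi>"
    using diffeomorphism_smooth_inverse[OF assms(1)] by blast
  note \<psi> = smooth_inversesD[OF this]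
  have "\<phi> ` B = {y \<in> topspace X. \<psi> y \<in> B}"
    by (rule diffeomorphism_image_eq[OF \<psi>(3,4,1,2) borel_sets_subset[OF assms(2)]])
  then show ?thesis
    using preimage_borel[OF _ assms(2), of \<psi>] \<psi>(2) by (simp add: smooth_self_map_def)
qed

definition area_density :: "'a tensor2 \<Rightarrow> 'a chart \<Rightarrow> real^2 \<Rightarrow> real" where
  "area_density g c y = sqrt (det (g c (chart_inv c y)))"

definition chart_area :: "'a tensor2 \<Rightarrow> 'a chart \<Rightarrow> 'a set \<Rightarrow> ennreal" where
  "chart_area g c B = (\<integral>\<^sup>+y\<in>coord c ` B. ennreal (area_density g c y) \<partial>lborel)"

lemma det_metric_pos: "riemannian_metric A g \<Longrightarrow> c \<in> A \<Longrightarrow> x \<in> chart_dom c \<Longrightarrow> det (g c x) > 0"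
  by (rule det_pos) (auto simp: riemannian_metric_def)

lemma continuous_on_area_density:
  assumes "riemannian_metric A g" "c \<in> A"
  shows "continuous_on (chart_img c) (area_density g c)"
proof -
  have "continuous_on (chart_img c) (g c \<circ> chart_inv c)"
    using assms by (intro smooth_on_continuous_on) (simp add: riemannian_metric_def)
  then show ?thesis
    unfolding area_density_def[abs_def] det_2 o_def by (intro continuous_intros)
qed

lemma area_density_measurable:
  assumes "riemannian_metric A g" "c \<in> A" "S \<in> sets borel" "S \<subseteq> chart_img c"
  shows "set_borel_measurable borel S (area_density g c)"
  unfolding set_borel_measurable_def
  using assms continuous_on_subset[OF continuous_on_area_density]
  by (intro borel_measurable_continuous_on_indicator) auto

text \<open>Inside one chart, area is the value of an honest Borel measure of the plane.\<close>

lemma chart_area_eq_emeasure: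
  assumes g: "riemannian_metric A g" "c \<in> A" and B: "B \<in> borel_sets X" "B \<subseteq> chart_dom c"
  shows "chart_area g c B =
    emeasure (density lborel (\<lambda>y. ennreal (indicator (chart_img c) y *\<^sub>R area_density g c y))) (coord c ` B)"
proof -
  have m: "(\<lambda>y. indicator (chart_img c) y *\<^sub>R area_density g c y) \<in> borel_measurable borel"
    using area_density_measurable[OF g, of "chart_img c"] open_chart_img[OF g(2)]
    by (simp add: set_borel_measurable_def)
  have "coord c ` B \<in> sets borel" using coord_image_borel[OF g(2) B] .
  moreover have "ennreal (area_density g c y) * indicator (coord c ` B) y =
      ennreal (indicator (chart_img c) y *\<^sub>R area_density g c y) * indicator (coord c ` B) y" for y
    using image_mono[OF B(2), of "coord c"] by (cases "y \<in> coord c ` B") (simp_all add: subset_iff)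
  ultimately show ?thesis
    using measurable_compose[OF m measurable_ennreal] by (simp add: emeasure_density chart_area_def)
qed

lemma chart_area_sums:
  assumes g: "riemannian_metric A g" "c \<in> A"
    and B: "\<And>k::nat. B k \<in> borel_sets X" "\<And>k. B k \<subseteq> chart_dom c" "disjoint_family B"
  shows "(\<Sum>k. chart_area g c (B k)) = chart_area g c (\<Union>k. B k)"
proof -
  interpret sigma_algebra "topspace X" "borel_sets X" by (rule sigma_algebra_borel_sets)
  have "(\<Union>k. B k) \<in> borel_sets X" using B(1) by blast
  moreover have "(\<Union>k. B k) \<subseteq> chart_dom c" using B(2) by blast
  moreover have "disjoint_family (\<lambda>k. coord c ` B k)"
    using B(2,3) inj_on_coord[OF g(2)] unfolding disjoint_family_on_def inj_on_def by blast
  ultimately show ?thesis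
    using coord_image_borel[OF g(2) B(1,2)]
    by (simp add: chart_area_eq_emeasure[OF g] B image_UN) (rule suminf_emeasure; auto)
qed

lemma chart_area_finite_partition:
  assumes g: "riemannian_metric A g" "c \<in> A" and B: "B \<in> borel_sets X" "B \<subseteq> chart_dom c"
    and Q: "finite I" "\<And>i. i \<in> I \<Longrightarrow> Q i \<in> borel_sets X" "disjoint_family_on Q I" "B \<subseteq> (\<Union>i\<in>I. Q i)"
  shows "chart_area g c B = (\<Sum>i\<in>I. chart_area g c (B \<inter> Q i))"
proof -
  let ?M = "density lborel (\<lambda>y. ennreal (indicator (chart_img c) y *\<^sub>R area_density g c y))"
  interpret sigma_algebra "topspace X" "borel_sets X" by (rule sigma_algebra_borel_sets)
  have BQ: "B \<inter> Q i \<in> borel_sets X" "B \<inter> Q i \<subseteq> chart_dom c" if "i \<in> I" for i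
    using B Q(2)[OF that] by auto
  have "disjoint_family_on (\<lambda>i. coord c ` (B \<inter> Q i)) I"
    using B(2) Q(3) inj_on_coord[OF g(2)] unfolding disjoint_family_on_def inj_on_def by blast
  then have "(\<Sum>i\<in>I. emeasure ?M (coord c ` (B \<inter> Q i))) = emeasure ?M (\<Union>i\<in>I. coord c ` (B \<inter> Q i))"
    using coord_image_borel[OF g(2) BQ] Q(1) by (intro sum_emeasure) auto
  also have "(\<Union>i\<in>I. coord c ` (B \<inter> Q i)) = coord c ` B" using Q(4) by blast
  finally show ?thesis using BQ by (simp add: chart_area_eq_emeasure[OF g] B)
qed

text \<open>The change of variables formula, read on the surface: if \<open>g' = \<phi>\<^sup>* g\<close>, then \<open>\<phi>\<close> takes the area
  of \<open>g'\<close> to the area of \<open>g\<close>. For \<open>\<phi> = id\<close> this says that area does not depend on the chart.\<close>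

lemma chart_area_pulls_back:
  assumes \<phi>: "smooth_self_map X A \<phi>" and g: "riemannian_metric A g" "riemannian_metric A g'"
    and pb: "pulls_back \<phi> g g'" and c: "c \<in> A" "d \<in> A"
    and B: "B \<in> borel_sets X" "B \<subseteq> chart_dom c" "\<phi> ` B \<in> borel_sets X" "\<phi> ` B \<subseteq> chart_dom d"
    and inj: "inj_on \<phi> B"
  shows "chart_area g d (\<phi> ` B) = chart_area g' c B"
proof -
  let ?F = "coord d \<circ> \<phi> \<circ> chart_inv c"
  have rep: "smooth_rep c d \<phi> {x \<in> chart_dom c. \<phi> x \<in> chart_dom d}"
    by (rule smooth_self_map_rep[OF \<phi> c])
  have F: "?F ` (coord c ` B) = coord d ` \<phi> ` B"
    unfolding image_comp[symmetric] chart_inv_image_eq[OF c(1) B(2)] ..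
  have "(\<integral>\<^sup>+y\<in>?F ` (coord c ` B). ennreal (area_density g d y) \<partial>lborel) =
    (\<integral>\<^sup>+y\<in>coord c ` B. ennreal (area_density g' c y) \<partial>lborel)"
  proof (rule nn_integral_change_of_variables[where F' = "\<lambda>y h. Jac c d \<phi> (chart_inv c y) *v h"])
    show "coord c ` B \<in> sets borel" using coord_image_borel[OF c(1) B(1,2)] .
    show "(?F has_derivative (\<lambda>h. Jac c d \<phi> (chart_inv c y) *v h)) (at y)" if y: "y \<in> coord c ` B" for y
    proof -
      obtain x where "x \<in> B" "y = coord c x" using y by blast
      then show ?thesis
        using smooth_rep_has_derivative[OF rep, of x] B(2,4) c by (auto simp: subset_eq)
    qed
    have "inj_on (coord d) (\<phi> ` B)" using inj_on_coord[OF c(2)] B(4) inj_on_subset by blast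
    then show "inj_on ?F (coord c ` B)"
      using inj B(2) c(1) by (auto simp: inj_on_def subset_eq)
    show "set_borel_measurable borel (?F ` (coord c ` B)) (area_density g d)"
      unfolding F using coord_image_borel[OF c(2) B(3,4)] B(4)
      by (intro area_density_measurable[OF g(1) c(2)]) auto
    show "0 \<le> area_density g d y" if y: "y \<in> ?F ` (coord c ` B)" for y
    proof -
      obtain x where "x \<in> B" "y = coord d (\<phi> x)" using y unfolding F by blast
      then show ?thesis
        using det_metric_pos[OF g(1) c(2), of "\<phi> x"] B(4) c(2) by (auto simp: area_density_def subset_eq)
    qed
    show "set_borel_measurable borel (coord c ` B) (area_density g' c)"
      using coord_image_borel[OF c(1) B(1,2)] B(2) by (intro area_density_measurable[OF g(2) c(1)]) auto
    show "area_density g' c y = \<bar>det (matrix ((*v) (Jac c d \<phi> (chart_inv c y))))\<bar> * area_density g d (?F y)"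
      if y: "y \<in> coord c ` B" for y
    proof -
      obtain x where x: "x \<in> B" "y = coord c x" using y by blast
      then have x': "x \<in> chart_dom c" "\<phi> x \<in> chart_dom d" using B by auto
      have "det (g' c x) = (det (Jac c d \<phi> x))\<^sup>2 * det (g d (\<phi> x))"
        by (simp add: pulls_backD[OF pb c x'] det_mul power2_eq_square)
      then show ?thesis
        using x x' c by (simp add: area_density_def real_sqrt_mult)
    qed
  qed
  then show ?thesis unfolding F by (simp add: chart_area_def)
qed

lemma chart_area_change_chart:
  assumes g: "riemannian_metric A g" and c: "c \<in> A" "d \<in> A"
    and B: "B \<in> borel_sets X" "B \<subseteq> chart_dom c" "B \<subseteq> chart_dom d"
  shows "chart_area g d B = chart_area g c B"
  using chart_area_pulls_back[OF smooth_self_map_id g g riemannian_metric_pulls_back_id[OF g] c B(1,2)] B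
  by simp

definition is_area_measure :: "'a tensor2 \<Rightarrow> 'a measure \<Rightarrow> bool" where
  "is_area_measure g \<mu> \<longleftrightarrow> space \<mu> = topspace X \<and> sets \<mu> = borel_sets X \<and>
     (\<forall>c\<in>A. \<forall>B\<in>borel_sets X. B \<subseteq> chart_dom c \<longrightarrow> emeasure \<mu> B = chart_area g c B)"

lemma area_measure_alt: "area_measure X A g = (THE \<mu>. is_area_measure g \<mu>)"
  by (simp add: area_measure_def is_area_measure_def chart_area_def area_density_def)

end

locale compact_surface_atlas = surface_atlas +
  assumes compact: "compact_space X"
begin

text \<open>A finite cover by chart domains, made disjoint. It reduces statements about areas to finitely many
  integrals in the plane.\<close>

definition chart_partition :: "nat \<Rightarrow> (nat \<Rightarrow> 'a chart) \<Rightarrow> (nat \<Rightarrow> 'a set) \<Rightarrow> bool" where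
  "chart_partition n e P \<longleftrightarrow>
     (\<forall>i<n. e i \<in> A \<and> P i \<in> borel_sets X \<and> P i \<subseteq> chart_dom (e i)) \<and>
     disjoint_family_on P {..<n} \<and> (\<Union>i<n. P i) = topspace X"

lemma chart_partitionD:
  assumes "chart_partition n e P"
  shows "\<And>i. i < n \<Longrightarrow> e i \<in> A" "\<And>i. i < n \<Longrightarrow> P i \<in> borel_sets X"
    "\<And>i. i < n \<Longrightarrow> P i \<subseteq> chart_dom (e i)" "disjoint_family_on P {..<n}" "(\<Union>i<n. P i) = topspace X"
  using assms unfolding chart_partition_def by blast+

lemma finite_chart_partition: "\<exists>n e P. chart_partition n e P"
proof -
  have cover: "topspace X \<subseteq> \<Union> (chart_dom ` A)" using atlas by (simp add: smooth_atlas_def)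
  have "\<And>U. U \<in> chart_dom ` A \<Longrightarrow> openin X U" using openin_dom by blast
  then obtain F where F: "finite F" "F \<subseteq> chart_dom ` A" "topspace X \<subseteq> \<Union>F"
    using compact cover unfolding compact_space_alt by (metis (no_types, lifting))
  then obtain C where C: "finite C" "C \<subseteq> A" "F = chart_dom ` C"
    by (meson finite_subset_image)
  obtain e and n :: nat where e: "C = e ` {i. i < n}"
    using finite_imp_nat_seg_image_inj_on[OF C(1)] by blast
  interpret sigma_algebra "topspace X" "borel_sets X" by (rule sigma_algebra_borel_sets)
  define P where "P i = chart_dom (e i) - (\<Union>j<i. chart_dom (e j))" for i
  have eA: "e i \<in> A" if "i < n" for i using e C that by auto
  have "chart_partition n e P"
    unfolding chart_partition_def
  proof (intro conjI allI impI)
    show "e i \<in> A" if "i < n" for i using eA that .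
    show "P i \<in> borel_sets X" if "i < n" for i
    proof -
      have "chart_dom (e j) \<in> borel_sets X" if "j \<le> i" for j
        using that \<open>i < n\<close> by (intro open_borel openin_dom eA) simp
      then show ?thesis unfolding P_def by (intro Diff finite_UN) auto
    qed
    show "P i \<subseteq> chart_dom (e i)" for i by (auto simp: P_def)
    show "disjoint_family_on P {..<n}"
      unfolding disjoint_family_on_def
    proof (intro ballI impI)
      fix i j :: nat assume "i \<noteq> j"
      then show "P i \<inter> P j = {}" by (cases "i < j") (auto simp: P_def)
    qed
    show "(\<Union>i<n. P i) = topspace X"
    proof
      show "(\<Union>i<n. P i) \<subseteq> topspace X" using dom_subset[OF eA] by (auto simp: P_def)
      show "topspace X \<subseteq> (\<Union>i<n. P i)"
      proof
        fix x assume "x \<in> topspace X"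
        then obtain i where i: "i < n" "x \<in> chart_dom (e i)" using F(3) C(3) e by auto
        define k where "k = (LEAST k. x \<in> chart_dom (e k))"
        have "x \<in> chart_dom (e k)" "k \<le> i" unfolding k_def using i(2) LeastI Least_le by metis+
        moreover have "x \<notin> chart_dom (e j)" if "j < k" for j
          using that not_less_Least unfolding k_def by blast
        ultimately show "x \<in> (\<Union>i<n. P i)" using i(1) by (auto simp: P_def intro!: bexI[of _ k])
      qed
    qed
  qed
  then show ?thesis by blast
qed

text \<open>Each piece of a partition lies in one chart, where the measure is prescribed.\<close>

lemma is_area_measure_unique:
  assumes "is_area_measure g \<mu>" "is_area_measure g \<nu>"
  shows "\<mu> = \<nu>"
proof (rule measure_eqI)
  show "sets \<mu> = sets \<nu>" using assms by (simp add: is_area_measure_def)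
  fix B assume "B \<in> sets \<mu>"
  then have B: "B \<in> borel_sets X" using assms by (simp add: is_area_measure_def)
  obtain n e P where "chart_partition n e P" using finite_chart_partition by blast
  note P = chart_partitionD[OF this]
  interpret sigma_algebra "topspace X" "borel_sets X" by (rule sigma_algebra_borel_sets)
  have "emeasure M B = (\<Sum>i<n. chart_area g (e i) (B \<inter> P i))" if M: "is_area_measure g M" for M
  proof -
    have "emeasure M B = (\<Sum>i<n. emeasure M (B \<inter> P i))"
      by (rule emeasure_finite_partition)
        (use M P B borel_sets_subset[OF B] in \<open>auto simp: is_area_measure_def\<close>)
    also have "\<dots> = (\<Sum>i<n. chart_area g (e i) (B \<inter> P i))"
    proof (rule sum.cong[OF refl])
      fix i assume i: "i \<in> {..<n}"
      then have "B \<inter> P i \<in> borel_sets X" "B \<inter> P i \<subseteq> chart_dom (e i)" using B P by auto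
      then show "emeasure M (B \<inter> P i) = chart_area g (e i) (B \<inter> P i)"
        using M P(1) i unfolding is_area_measure_def by blast
    qed
    finally show ?thesis .
  qed
  then show "emeasure \<mu> B = emeasure \<nu> B" using assms by simp
qed

text \<open>The areas of the pieces of a partition, each measured in its own chart, add up to a measure.
  It has the prescribed values in every chart since area does not depend on the chart.\<close>

lemma is_area_measure_exists:
  assumes g: "riemannian_metric A g"
  shows "\<exists>\<mu>. is_area_measure g \<mu>"
proof -
  obtain n e P where "chart_partition n e P" using finite_chart_partition by blast
  note P = chart_partitionD[OF this]
  interpret sigma_algebra "topspace X" "borel_sets X" by (rule sigma_algebra_borel_sets)
  define m where "m B = (\<Sum>i<n. chart_area g (e i) (B \<inter> P i))" for B
  define \<mu> where "\<mu> = measure_of (topspace X) (borel_sets X) m"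
  have "countably_additive (borel_sets X) m"
  proof (rule countably_additiveI)
    fix B :: "nat \<Rightarrow> 'a set"
    assume B: "range B \<subseteq> borel_sets X" "disjoint_family B" "(\<Union>k. B k) \<in> borel_sets X"
    have "(\<Sum>k. chart_area g (e i) (B k \<inter> P i)) = chart_area g (e i) ((\<Union>k. B k) \<inter> P i)" if "i < n" for i
    proof -
      have "(\<Sum>k. chart_area g (e i) (B k \<inter> P i)) = chart_area g (e i) (\<Union>k. B k \<inter> P i)"
      proof (rule chart_area_sums[OF g P(1)[OF that]])
        show "B k \<inter> P i \<in> borel_sets X" for k using B(1) P(2)[OF that] by (intro Int) auto
        show "B k \<inter> P i \<subseteq> chart_dom (e i)" for k using P(3)[OF that] by (rule le_infI2)
        show "disjoint_family (\<lambda>k. B k \<inter> P i)" using B(2) by (auto simp: disjoint_family_on_def)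
      qed
      then show ?thesis by simp
    qed
    then show "(\<Sum>k. m (B k)) = m (\<Union>k. B k)"
      unfolding m_def by (subst suminf_sum) auto
  qed
  moreover have "positive (borel_sets X) m"
    by (simp add: positive_def m_def chart_area_def)
  ultimately have \<mu>: "emeasure \<mu> B = m B" if "B \<in> borel_sets X" for B
    unfolding \<mu>_def using that sigma_algebra_borel_sets by (intro emeasure_measure_of_sigma) auto
  have "is_area_measure g \<mu>"
    unfolding is_area_measure_def
  proof (intro conjI ballI impI)
    have "borel_sets X \<subseteq> Pow (topspace X)" using borel_sets_subset by blast
    then show "space \<mu> = topspace X" "sets \<mu> = borel_sets X"
      by (simp_all add: \<mu>_def space_measure_of sets_measure_of sigma_sets_eq)
    fix c B assume c: "c \<in> A" and B: "B \<in> borel_sets X" "B \<subseteq> chart_dom c"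
    have "emeasure \<mu> B = (\<Sum>i<n. chart_area g (e i) (B \<inter> P i))" using \<mu>[OF B(1)] by (simp add: m_def)
    also have "\<dots> = (\<Sum>i<n. chart_area g c (B \<inter> P i))"
    proof (rule sum.cong[OF refl])
      fix i assume i: "i \<in> {..<n}"
      show "chart_area g (e i) (B \<inter> P i) = chart_area g c (B \<inter> P i)"
        by (rule chart_area_change_chart[OF g c]) (use i P B in auto)
    qed
    also have "\<dots> = chart_area g c B"
      by (rule chart_area_finite_partition[symmetric, OF g c B])
        (use P borel_sets_subset[OF B(1)] in auto)
    finally show "emeasure \<mu> B = chart_area g c B" .
  qed
  then show ?thesis by blast
qed

lemma is_area_measure_area_measure:
  assumes "riemannian_metric A g"
  shows "is_area_measure g (area_measure X A g)"
  unfolding area_measure_alt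
  using is_area_measure_exists[OF assms] is_area_measure_unique by (metis (no_types, lifting) theI)

lemma sets_area_measure: "riemannian_metric A g \<Longrightarrow> sets (area_measure X A g) = borel_sets X"
  and space_area_measure: "riemannian_metric A g \<Longrightarrow> space (area_measure X A g) = topspace X"
  and area_measure_chart: "riemannian_metric A g \<Longrightarrow> c \<in> A \<Longrightarrow> B \<in> borel_sets X \<Longrightarrow>
    B \<subseteq> chart_dom c \<Longrightarrow> emeasure (area_measure X A g) B = chart_area g c B"
  using is_area_measure_area_measure[of g] by (simp_all add: is_area_measure_def)

text \<open>The partition is refined so that each piece lies in one chart and its image lies in one chart
  as well. Then the change of variables formula applies to each piece.\<close>

lemma area_measure_pulls_back:
  assumes \<phi>: "diffeomorphism X A \<phi>" and g: "riemannian_metric A g" and pb: "pulls_back \<phi> g g'"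
    and B: "B \<in> borel_sets X"
  shows "emeasure (area_measure X A g') B = emeasure (area_measure X A g) (\<phi> ` B)"
proof -
  obtain \<psi> where "smooth_inverses \<phi> \<psi>"
    using diffeomorphism_smooth_inverse[OF \<phi>] by blast
  note \<psi> = smooth_inversesD[OF this]
  note g' = riemannian_metric_pulls_back[OF \<phi> g pb]
  obtain n e P where "chart_partition n e P" using finite_chart_partition by blast
  note P = chart_partitionD[OF this]
  interpret sigma_algebra "topspace X" "borel_sets X" by (rule sigma_algebra_borel_sets)
  have inj: "inj_on \<phi> (topspace X)" using \<psi>(3) by (metis inj_on_inverseI)
  let ?I = "{..<n} \<times> {..<n}"
  define Q where "Q k = P (fst k) \<inter> {x \<in> topspace X. \<phi> x \<in> P (snd k)}" for k
  have Q: "Q k \<in> borel_sets X" if "k \<in> ?I" for k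
    using that P(2) preimage_borel[of \<phi>] \<psi>(1) by (auto simp: Q_def smooth_self_map_def)
  have Qdisj: "disjoint_family_on Q ?I"
    using P(4) unfolding disjoint_family_on_def Q_def by (fastforce simp: set_eq_iff)
  have Qcover: "topspace X \<subseteq> (\<Union>k\<in>?I. Q k)"
  proof
    fix x assume x: "x \<in> topspace X"
    then have "\<phi> x \<in> topspace X" using smooth_self_map_in_topspace[OF \<psi>(1)] by blast
    with x obtain i j where "i < n" "x \<in> P i" "j < n" "\<phi> x \<in> P j" using P(5) by blast
    then show "x \<in> (\<Union>k\<in>?I. Q k)" using x by (auto simp: Q_def intro!: bexI[of _ "(i, j)"])
  qed
  have Btop: "B \<subseteq> topspace X" using borel_sets_subset[OF B] .
  have Qtop: "Q k \<subseteq> topspace X" for k by (auto simp: Q_def)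
  have "emeasure (area_measure X A g') B = (\<Sum>k\<in>?I. emeasure (area_measure X A g') (B \<inter> Q k))"
    by (rule emeasure_finite_partition) (use Q Qdisj B Qcover Btop in \<open>auto simp: sets_area_measure[OF g']\<close>)
  also have "\<dots> = (\<Sum>k\<in>?I. emeasure (area_measure X A g) (\<phi> ` B \<inter> \<phi> ` Q k))"
  proof (rule sum.cong[OF refl])
    fix k assume k: "k \<in> ?I"
    let ?B = "B \<inter> Q k"
    have B': "?B \<in> borel_sets X" using B Q[OF k] by blast
    have dom: "?B \<subseteq> chart_dom (e (fst k))" "\<phi> ` ?B \<subseteq> chart_dom (e (snd k))"
      using P(3) k by (auto simp: Q_def subset_eq)
    have eA: "e (fst k) \<in> A" "e (snd k) \<in> A" using k P(1) by auto
    have img: "\<phi> ` ?B \<in> borel_sets X" using diffeomorphism_image_borel[OF \<phi> B'] .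
    have "emeasure (area_measure X A g') ?B = chart_area g' (e (fst k)) ?B"
      by (rule area_measure_chart[OF g' eA(1) B' dom(1)])
    also have "\<dots> = chart_area g (e (snd k)) (\<phi> ` ?B)"
      using chart_area_pulls_back[OF \<psi>(1) g g' pb eA B' dom(1) img dom(2)] inj Btop
      by (metis inj_on_subset le_infI1)
    also have "\<dots> = emeasure (area_measure X A g) (\<phi> ` ?B)"
      by (rule area_measure_chart[OF g eA(2) img dom(2), symmetric])
    also have "\<phi> ` ?B = \<phi> ` B \<inter> \<phi> ` Q k" by (rule inj_on_image_Int[OF inj Btop Qtop])
    finally show "emeasure (area_measure X A g') ?B = emeasure (area_measure X A g) (\<phi> ` B \<inter> \<phi> ` Q k)" .
  qed
  also have "\<dots> = emeasure (area_measure X A g) (\<phi> ` B)"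
  proof (rule emeasure_finite_partition[symmetric])
    show "disjoint_family_on (\<lambda>k. \<phi> ` Q k) ?I"
      using Qdisj inj Qtop unfolding disjoint_family_on_def
      by (metis image_empty inj_on_image_Int)
    show "\<phi> ` B \<subseteq> (\<Union>k\<in>?I. \<phi> ` Q k)" using Qcover Btop by blast
  qed (use Q B diffeomorphism_image_borel[OF \<phi>] in \<open>auto simp: sets_area_measure[OF g]\<close>)
  finally show ?thesis .
qed

lemma unit_area_pulls_back:
  assumes \<phi>: "diffeomorphism X A \<phi>" and g: "g \<in> unit_area_metrics X A" and pb: "pulls_back \<phi> g g'"
  shows "g' \<in> unit_area_metrics X A"
proof -
  have g1: "riemannian_metric A g" "emeasure (area_measure X A g) (topspace X) = 1"
    using g by (auto simp: unit_area_metrics_def)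
  have "topspace X \<in> borel_sets X" by (rule open_borel) simp
  moreover have "\<phi> ` topspace X = topspace X" using \<phi> by (simp add: diffeomorphism_def bij_betw_def)
  ultimately have "emeasure (area_measure X A g') (topspace X) = 1"
    using area_measure_pulls_back[OF \<phi> g1(1) pb, of "topspace X"] g1(2) by simp
  then show ?thesis
    using riemannian_metric_pulls_back[OF \<phi> g1(1) pb] by (simp add: unit_area_metrics_def)
qed

text \<open>The density is positive, so a nonempty open set of area zero would be negligible in a chart.\<close>

lemma area_open_pos:
  assumes g: "riemannian_metric A g" and U: "openin X U" "U \<noteq> {}"
  shows "emeasure (area_measure X A g) U > 0"
proof -
  obtain x where x: "x \<in> U" "x \<in> topspace X" using U openin_subset by blast
  obtain c where c: "c \<in> A" "x \<in> chart_dom c" using ex_chart[OF x(2)] by blast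
  let ?V = "U \<inter> chart_dom c"
  have V: "openin X ?V" "?V \<subseteq> chart_dom c" using U openin_dom[OF c(1)] by auto
  have op: "open (coord c ` ?V)" using open_coord_image[OF c(1) V] .
  have "chart_area g c ?V \<noteq> 0"
  proof
    assume "chart_area g c ?V = 0"
    moreover have "(\<lambda>y. ennreal (area_density g c y) * indicator (coord c ` ?V) y) \<in> borel_measurable lborel"
    proof -
      have "(\<lambda>y. indicator (coord c ` ?V) y *\<^sub>R area_density g c y) \<in> borel_measurable lborel"
        using area_density_measurable[OF g c(1) borel_open[OF op] image_mono[OF V(2)]]
        unfolding set_borel_measurable_def by simp
      from measurable_compose[OF this measurable_ennreal]
      have "(\<lambda>y. ennreal (indicator (coord c ` ?V) y *\<^sub>R area_density g c y)) \<in> borel_measurable lborel" .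
      also have "(\<lambda>y. ennreal (indicator (coord c ` ?V) y *\<^sub>R area_density g c y)) =
          (\<lambda>y. ennreal (area_density g c y) * indicator (coord c ` ?V) y)"
        by (auto simp: indicator_def fun_eq_iff)
      finally show ?thesis .
    qed
    ultimately have "AE y in lborel. ennreal (area_density g c y) * indicator (coord c ` ?V) y = 0"
      unfolding chart_area_def by (simp add: nn_integral_0_iff_AE)
    moreover have "area_density g c y > 0" if "y \<in> coord c ` ?V" for y
      using that det_metric_pos[OF g c(1)] c(1) by (auto simp: area_density_def)
    ultimately have "AE y in lborel. y \<notin> coord c ` ?V"
      by (elim AE_mp, intro AE_I2) (fastforce simp: indicator_def)
    then have "coord c ` ?V \<in> null_sets lborel"
      using op by (simp add: AE_iff_null_sets)
    then have "negligible (coord c ` ?V)"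
      using negligible_iff_null_sets null_sets_completionI by blast
    then have "coord c ` ?V = {}" using op open_not_negligible by blast
    then show False using x c by blast
  qed
  then have "0 < emeasure (area_measure X A g) ?V"
    using area_measure_chart[OF g c(1) open_borel[OF V(1)] V(2)] by (simp add: zero_less_iff_neq_zero)
  also have "\<dots> \<le> emeasure (area_measure X A g) U"
    using open_borel[OF U(1)] by (intro emeasure_mono) (auto simp: sets_area_measure[OF g])
  finally show ?thesis .
qed

end

section \<open>Partial derivatives in the plane\<close>

lemma partial_deriv_eqI: "(u has_derivative u') (at y) \<Longrightarrow> partial_deriv i u y = u' (axis i 1)"
  by (simp add: partial_deriv_def frechet_derivative_eqI)

lemma partial_deriv_local:
  "open S \<Longrightarrow> y \<in> S \<Longrightarrow> (\<And>z. z \<in> S \<Longrightarrow> u z = v z) \<Longrightarrow> partial_deriv i u y = partial_deriv i v y"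
  unfolding partial_deriv_def using frechet_derivative_local[of S y u v] by simp

lemma partial_deriv_mult:
  assumes "u differentiable (at y)" "v differentiable (at y)"
  shows "partial_deriv i (\<lambda>y. u y * v y) y = u y * partial_deriv i v y + partial_deriv i u y * v y"
proof -
  note d = assms[unfolded frechet_derivative_works]
  show ?thesis using partial_deriv_eqI[OF has_derivative_mult[OF d]] by (simp add: partial_deriv_def)
qed

lemma partial_deriv_diff:
  assumes "u differentiable (at y)" "v differentiable (at y)"
  shows "partial_deriv i (\<lambda>y. u y - v y) y = partial_deriv i u y - partial_deriv i v y"
proof -
  note d = assms[unfolded frechet_derivative_works]
  show ?thesis using partial_deriv_eqI[OF has_derivative_diff[OF d]] by (simp add: partial_deriv_def)
qed

lemma partial_deriv_cmult:
  assumes "u differentiable (at y)"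
  shows "partial_deriv i (\<lambda>y. r * u y) y = r * partial_deriv i u y"
proof -
  note d = assms[unfolded frechet_derivative_works]
  show ?thesis using partial_deriv_eqI[OF has_derivative_mult_right[OF d]] by (simp add: partial_deriv_def)
qed

lemma frechet_derivative_partial:
  fixes v :: "real^2 \<Rightarrow> real"
  assumes "v differentiable (at y)"
  shows "frechet_derivative v (at y) h = h $ 1 * partial_deriv 1 v y + h $ 2 * partial_deriv 2 v y"
proof -
  have lin: "linear (frechet_derivative v (at y))" using linear_frechet_derivative[OF assms] .
  have "h = h $ 1 *\<^sub>R axis 1 1 + h $ 2 *\<^sub>R axis 2 1"
    by (simp add: vec_eq_iff forall_2 axis_def)
  then have "frechet_derivative v (at y) h =
      frechet_derivative v (at y) (h $ 1 *\<^sub>R axis 1 1 + h $ 2 *\<^sub>R axis 2 1)" by simp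
  then show ?thesis by (simp add: linear_add[OF lin] linear_cmul[OF lin] partial_deriv_def)
qed

lemma partial_deriv_component:
  assumes "F differentiable (at y)"
  shows "partial_deriv i (\<lambda>y. F y $ k) y = jacobian F (at y) $ k $ i"
proof -
  note d = assms[unfolded frechet_derivative_works]
  show ?thesis
    using partial_deriv_eqI[OF bounded_linear.has_derivative[OF bounded_linear_vec_nth d]]
    by (simp add: jacobian_def matrix_def)
qed

lemma partial_deriv_compose:
  fixes F :: "real^2 \<Rightarrow> real^2"
  assumes "F differentiable (at y)" "v differentiable (at (F y))"
  shows "partial_deriv i (\<lambda>y. v (F y)) y =
    jacobian F (at y) $ 1 $ i * partial_deriv 1 v (F y) + jacobian F (at y) $ 2 $ i * partial_deriv 2 v (F y)"
proof -
  note d = assms[unfolded frechet_derivative_works]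
  show ?thesis
    using partial_deriv_eqI[OF has_derivative_compose[OF d], of i]
    by (simp add: frechet_derivative_partial[OF assms(2)] jacobian_def matrix_def)
qed

lemma differentiable_compose_at:
  "F differentiable (at y) \<Longrightarrow> v differentiable (at (F y)) \<Longrightarrow> (\<lambda>y. v (F y)) differentiable (at y)"
  unfolding differentiable_def using has_derivative_compose by blast

lemma matrix_inv_2:
  fixes G :: "real^2^2"
  assumes "det G \<noteq> 0"
  shows "matrix_inv G = vector [vector [G $ 2 $ 2 / det G, - G $ 1 $ 2 / det G],
    vector [- G $ 2 $ 1 / det G, G $ 1 $ 1 / det G]]" (is "_ = ?B")
proof -
  have "?B ** G = mat 1"
    using assms by (simp add: vec_eq_iff forall_2 matrix_matrix_mult_def mat_def sum_2 vector_2
        field_simps) (simp add: det_2 field_simps)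
  moreover have "G ** matrix_inv G = mat 1"
    using assms someI_ex[of "\<lambda>B. G ** B = mat 1 \<and> B ** G = mat 1"]
    unfolding matrix_inv_def invertible_det_nz[symmetric] invertible_def by blast
  ultimately show ?thesis
    using matrix_mul_assoc[of ?B G "matrix_inv G"] by (simp only: matrix_mul_lid matrix_mul_rid)
qed

section \<open>The Laplacian under a change of coordinates\<close>

text \<open>The vector field \<open>flux G u\<close> is \<open>sqrt (det G) grad u\<close>; the Laplacian is, up to the
  factor \<open>- 1 / sqrt (det G)\<close>, its coordinate divergence.\<close>

definition flux :: "(real^2 \<Rightarrow> real^2^2) \<Rightarrow> (real^2 \<Rightarrow> real) \<Rightarrow> 2 \<Rightarrow> real^2 \<Rightarrow> real" where
  "flux G u i z = sqrt (det (G z)) * (\<Sum>j\<in>UNIV. matrix_inv (G z) $ i $ j * partial_deriv j u z)"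

lemma coord_laplacian_flux:
  "coord_laplacian G u y =
    - (1 / sqrt (det (G y))) * (partial_deriv 1 (flux G u 1) y + partial_deriv 2 (flux G u 2) y)"
  by (simp add: coord_laplacian_def flux_def[abs_def] sum_2)

lemma flux_eq:
  assumes "det (G z) > 0"
  shows "flux G u 1 z = (G z $ 2 $ 2 * partial_deriv 1 u z - G z $ 1 $ 2 * partial_deriv 2 u z) / sqrt (det (G z))"
      (is "_ = ?n1 / _")
    "flux G u 2 z = (G z $ 1 $ 1 * partial_deriv 2 u z - G z $ 2 $ 1 * partial_deriv 1 u z) / sqrt (det (G z))"
      (is "_ = ?n2 / _")
proof -
  have ne: "det (G z) \<noteq> 0" using assms by simp
  have sq: "sqrt (det (G z)) * (r / det (G z)) = r / sqrt (det (G z))" for r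
    using assms real_sqrt_mult_self[of "det (G z)"] by (simp add: field_simps)
  have "flux G u 1 z = sqrt (det (G z)) * (?n1 / det (G z))"
    by (simp add: flux_def sum_2 matrix_inv_2[OF ne] vector_2 diff_divide_distrib)
  then show "flux G u 1 z = ?n1 / sqrt (det (G z))"
    unfolding sq .
  have "flux G u 2 z = sqrt (det (G z)) * (?n2 / det (G z))"
    by (simp add: flux_def sum_2 matrix_inv_2[OF ne] vector_2 diff_divide_distrib)
  then show "flux G u 2 z = ?n2 / sqrt (det (G z))"
    unfolding sq .
qed

text \<open>The flux transforms by the transposed cofactor matrix of the Jacobian, up to the sign of its determinant:
  this is where \<open>sqrt (det G)\<close> and the inverse of \<open>G\<close> combine to a polynomial expression.\<close>

lemma flux_pullback:
  assumes G: "G z = transpose J ** H' (F z) ** J" and h: "det (H' (F z)) > 0" and J: "det J \<noteq> 0"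
    and u: "partial_deriv 1 u z = J $ 1 $ 1 * partial_deriv 1 v (F z) + J $ 2 $ 1 * partial_deriv 2 v (F z)"
      "partial_deriv 2 u z = J $ 1 $ 2 * partial_deriv 1 v (F z) + J $ 2 $ 2 * partial_deriv 2 v (F z)"
  shows "flux G u 1 z = sgn (det J) * (J $ 2 $ 2 * flux H' v 1 (F z) - J $ 1 $ 2 * flux H' v 2 (F z))" (is ?flux1)
    "flux G u 2 z = sgn (det J) * (J $ 1 $ 1 * flux H' v 2 (F z) - J $ 2 $ 1 * flux H' v 1 (F z))" (is ?flux2)
proof -
  let ?H = "H' (F z)"
  have dG: "det (G z) = (det J)\<^sup>2 * det ?H" by (simp add: G det_mul power2_eq_square)
  have dG0: "det (G z) > 0" using h J by (simp add: dG)
  have sG: "sqrt (det (G z)) = \<bar>det J\<bar> * sqrt (det ?H)" by (simp add: dG real_sqrt_mult)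
  have s0: "sqrt (det ?H) \<noteq> 0" using h by simp
  have sgn: "det J * r / (\<bar>det J\<bar> * sqrt (det ?H)) = sgn (det J) * (r / sqrt (det ?H))" for r
    using J by (simp add: sgn_if abs_if field_simps)
  have eq1: "G z $ 2 $ 2 * partial_deriv 1 u z - G z $ 1 $ 2 * partial_deriv 2 u z =
      det J * (J $ 2 $ 2 * (?H $ 2 $ 2 * partial_deriv 1 v (F z) - ?H $ 1 $ 2 * partial_deriv 2 v (F z)) -
        J $ 1 $ 2 * (?H $ 1 $ 1 * partial_deriv 2 v (F z) - ?H $ 2 $ 1 * partial_deriv 1 v (F z)))"
    unfolding u by (simp add: G matrix_matrix_mult_def transpose_def sum_2 det_2) algebra
  show ?flux1
    unfolding flux_eq[where G = G, OF dG0] flux_eq[where G = H', OF h] sG eq1 sgn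
    by (simp add: right_diff_distrib diff_divide_distrib)
  have eq2: "G z $ 1 $ 1 * partial_deriv 2 u z - G z $ 2 $ 1 * partial_deriv 1 u z =
      det J * (J $ 1 $ 1 * (?H $ 1 $ 1 * partial_deriv 2 v (F z) - ?H $ 2 $ 1 * partial_deriv 1 v (F z)) -
        J $ 2 $ 1 * (?H $ 2 $ 2 * partial_deriv 1 v (F z) - ?H $ 1 $ 2 * partial_deriv 2 v (F z)))"
    unfolding u by (simp add: G matrix_matrix_mult_def transpose_def sum_2 det_2) algebra
  show ?flux2
    unfolding flux_eq[where G = G, OF dG0] flux_eq[where G = H', OF h] sG eq2 sgn
    by (simp add: right_diff_distrib diff_divide_distrib)
qed

lemma flux_differentiable:
  assumes V: "open V" "z \<in> V" and H: "smooth_on H V" "\<And>z. z \<in> V \<Longrightarrow> det (H z) > 0" and v: "smooth_on v V"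
  shows "flux H v i differentiable (at z)"
proof -
  have comp: "(\<lambda>z. H z $ k $ l) differentiable (at z)" for k l
    by (intro differentiable_compose_at[of "\<lambda>z. H z $ k" _ "\<lambda>r. r $ l"] differentiable_compose_at[of H _ "\<lambda>r. r $ k"]
        smooth_on_differentiable[OF H(1) V(2)] bounded_linear_imp_differentiable bounded_linear_vec_nth)
  have pd: "(\<lambda>z. partial_deriv k v z) differentiable (at z)" for k
    unfolding partial_deriv_def by (rule smooth_on_differentiable[OF smooth_on_frechet_derivative[OF v] V(2)])
  have "(\<lambda>z. det (H z)) differentiable (at z)"
    unfolding det_2 by (intro differentiable_diff differentiable_mult comp)
  moreover have "sqrt differentiable (at (det (H z)))"
    using H(2)[OF V(2)] real_differentiable_def DERIV_real_sqrt by blast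
  ultimately have sq: "(\<lambda>z. sqrt (det (H z))) differentiable (at z)"
    by (rule differentiable_compose_at)
  have s0: "sqrt (det (H z)) \<noteq> 0" using H(2)[OF V(2)] by simp
  have "flux H v 1 differentiable (at z)"
    by (rule differentiable_local[OF V flux_eq(1)[symmetric, OF H(2)]])
      (auto intro!: differentiable_divide differentiable_diff differentiable_mult comp pd sq s0)
  moreover have "flux H v 2 differentiable (at z)"
    by (rule differentiable_local[OF V flux_eq(2)[symmetric, OF H(2)]])
      (auto intro!: differentiable_divide differentiable_diff differentiable_mult comp pd sq s0)
  ultimately show ?thesis using exhaust_2[of i] by auto
qed

text \<open>The rows of the cofactor matrix of a Jacobian are divergence free, because second derivatives
  commute (Piola's identity). So the divergence of the transformed flux only sees the
  derivatives of the flux itself, multiplied by the Jacobian determinant.\<close>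

lemma coord_laplacian_pullback:
  assumes W: "open W" "y \<in> W" and V: "open V" "F ` W \<subseteq> V"
    and F: "smooth_on F W" and H: "smooth_on H V" "\<And>z. z \<in> V \<Longrightarrow> det (H z) > 0" and v: "smooth_on v V"
    and J: "\<And>z. z \<in> W \<Longrightarrow> det (jacobian F (at z)) \<noteq> 0"
    and G: "\<And>z. z \<in> W \<Longrightarrow> G z = transpose (jacobian F (at z)) ** H (F z) ** jacobian F (at z)"
    and u: "\<And>z. z \<in> W \<Longrightarrow> u z = v (F z)"
  shows "coord_laplacian G u y = coord_laplacian H v (F y)"
proof -
  define J' where "J' k i z = jacobian F (at z) $ k $ i" for k i :: 2 and z
  have FW: "F z \<in> V" if "z \<in> W" for z using V that by blast
  have Fd: "F differentiable (at z)" if "z \<in> W" for z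
    using smooth_on_differentiable[OF F that] .
  have Fk: "smooth_on (\<lambda>z. F z $ k) W" for k
    by (rule smooth_on_linear[OF W(1) bounded_linear_vec_nth F])
  have J'_eq: "J' k i z = frechet_derivative (\<lambda>z. F z $ k) (at z) (axis i 1)" if "z \<in> W" for k i z
    using partial_deriv_component[OF Fd[OF that]] by (simp add: J'_def partial_deriv_def)
  have J'_smooth: "smooth_on (J' k i) W" for k i
    by (rule smooth_on_cong[OF W(1) J'_eq[symmetric] smooth_on_frechet_derivative[OF Fk]])
  have J'_diff: "J' k i differentiable (at y)" for k i
    using smooth_on_differentiable[OF J'_smooth W(2)] .
  have piola: "partial_deriv 1 (J' k 2) y = partial_deriv 2 (J' k 1) y" for k
  proof -
    have "partial_deriv i (J' k j) y =
        frechet_derivative (\<lambda>z. frechet_derivative (\<lambda>z. F z $ k) (at z) (axis j 1)) (at y) (axis i 1)" for i j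
      unfolding partial_deriv_def using frechet_derivative_local[OF W J'_eq] by simp
    then show ?thesis
      using frechet_derivative_commute[OF _ W, of "\<lambda>z. F z $ k"] Fk[of k] unfolding smooth_on_def by metis
  qed
  define D where "D z = det (jacobian F (at z))" for z
  have D_eq: "D z = J' 1 1 z * J' 2 2 z - J' 1 2 z * J' 2 1 z" for z
    by (simp add: D_def det_2 J'_def)
  have D0: "D y \<noteq> 0" using J[OF W(2)] by (simp add: D_def)
  \<comment> \<open>The sign of the Jacobian determinant is locally constant.\<close>
  define W' where "W' = {z \<in> W. D z * D y > 0}"
  have "continuous_on W D"
    unfolding D_eq[abs_def] by (intro continuous_intros smooth_on_continuous_on J'_smooth)
  then have "open (W \<inter> (\<lambda>z. D z * D y) -` {0<..})"
    by (intro continuous_open_preimage continuous_intros W(1)) auto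
  then have W': "open W'" "y \<in> W'" "W' \<subseteq> W"
    using W(2) D0 by (auto simp: W'_def Int_def vimage_def zero_less_mult_iff)
  have sgnD: "sgn (D z) = sgn (D y)" if "z \<in> W'" for z
    using that by (auto simp: W'_def zero_less_mult_iff)
  define Z where "Z i = flux H v i" for i
  have pu: "partial_deriv i u z = J' 1 i z * partial_deriv 1 v (F z) + J' 2 i z * partial_deriv 2 v (F z)"
    if "z \<in> W" for z i
    using partial_deriv_local[OF W(1) that u] 
      partial_deriv_compose[OF Fd[OF that] smooth_on_differentiable[OF v FW[OF that]]]
    by (simp add: J'_def)
  define s where "s = sgn (D y)"
  have flux1: "flux G u 1 z = s * (J' 2 2 z * Z 1 (F z) - J' 1 2 z * Z 2 (F z))" (is ?flux1)
    and flux2: "flux G u 2 z = s * (J' 1 1 z * Z 2 (F z) - J' 2 1 z * Z 1 (F z))" (is ?flux2)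
    if z: "z \<in> W'" for z
  proof -
    have zW: "z \<in> W" using z W' by blast
    note fp = flux_pullback[of G z "jacobian F (at z)" H F u v, OF G[OF zW] H(2)[OF FW[OF zW]] J[OF zW]
        pu[OF zW, unfolded J'_def] pu[OF zW, unfolded J'_def]]
    show ?flux1 ?flux2
      using fp sgnD[OF z] by (simp_all add: D_def J'_def Z_def s_def)
  qed
  have Zd: "Z i differentiable (at (F y))" for i
    unfolding Z_def by (rule flux_differentiable[OF V(1) FW[OF W(2)] H v])
  have ZFd: "(\<lambda>z. Z i (F z)) differentiable (at y)" for i
    by (rule differentiable_compose_at[OF Fd[OF W(2)] Zd])
  have prod: "partial_deriv i (\<lambda>z. J' k l z * Z m (F z)) y =
      J' k l y * (J' 1 i y * partial_deriv 1 (Z m) (F y) + J' 2 i y * partial_deriv 2 (Z m) (F y)) +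
      partial_deriv i (J' k l) y * Z m (F y)" for i k l m
    using partial_deriv_mult[OF J'_diff ZFd] partial_deriv_compose[OF Fd[OF W(2)] Zd]
    by (simp add: J'_def)
  have JZd: "(\<lambda>z. J' k l z * Z m (F z)) differentiable (at y)" for k l m
    by (intro differentiable_mult J'_diff ZFd)
  have pf: "partial_deriv i (\<lambda>z. r * (J' k l z * Z m (F z) - J' k' l' z * Z m' (F z))) y =
      r * (partial_deriv i (\<lambda>z. J' k l z * Z m (F z)) y - partial_deriv i (\<lambda>z. J' k' l' z * Z m' (F z)) y)"
    for i r k l m k' l' m'
    by (simp add: partial_deriv_cmult[OF differentiable_diff[OF JZd JZd]] partial_deriv_diff[OF JZd JZd])
  have div1: "partial_deriv 1 (flux G u 1) y =
      partial_deriv 1 (\<lambda>z. s * (J' 2 2 z * Z 1 (F z) - J' 1 2 z * Z 2 (F z))) y"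
    by (rule partial_deriv_local[OF W'(1,2) flux1])
  have div2: "partial_deriv 2 (flux G u 2) y =
      partial_deriv 2 (\<lambda>z. s * (J' 1 1 z * Z 2 (F z) - J' 2 1 z * Z 1 (F z))) y"
    by (rule partial_deriv_local[OF W'(1,2) flux2])
  have "partial_deriv 1 (flux G u 1) y + partial_deriv 2 (flux G u 2) y =
      s * D y * (partial_deriv 1 (Z 1) (F y) + partial_deriv 2 (Z 2) (F y))"
    unfolding div1 div2 pf prod piola D_eq by (simp add: algebra_simps)
  moreover have "s * D y = \<bar>D y\<bar>" by (simp add: s_def sgn_if abs_if)
  moreover have "sqrt (det (G y)) = \<bar>D y\<bar> * sqrt (det (H (F y)))"
  proof -
    have "det (G y) = (D y)\<^sup>2 * det (H (F y))"
      by (simp add: G[OF W(2)] det_mul D_def power2_eq_square)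
    then show ?thesis by (simp add: real_sqrt_mult)
  qed
  ultimately show ?thesis
    using D0 by (simp add: coord_laplacian_flux Z_def)
qed

context surface_atlas
begin

section \<open>Isometric metrics are isospectral\<close>

text \<open>The two sides are computed in the charts chosen at \<open>x\<close> and at \<open>\<phi> x\<close>. In these, \<open>\<phi>\<close> is a change of
  coordinates that relates the component matrices of \<open>g'\<close> and \<open>g\<close> near \<open>x\<close>, and not only at \<open>x\<close>.\<close>

lemma laplacian_pulls_back:
  assumes \<phi>: "diffeomorphism X A \<phi>" and g: "riemannian_metric A g" and pb: "pulls_back \<phi> g g'"
    and f: "smooth_function A f" and f': "\<And>x. x \<in> topspace X \<Longrightarrow> f' x = f (\<phi> x)"
    and x: "x \<in> topspace X"
  shows "laplacian A g' f' x = laplacian A g f (\<phi> x)"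
proof -
  obtain \<psi> where "smooth_inverses \<phi> \<psi>"
    using diffeomorphism_smooth_inverse[OF \<phi>] by blast
  note \<psi> = smooth_inversesD[OF this]
  define c where "c = chart_at A x"
  define d where "d = chart_at A (\<phi> x)"
  have c: "c \<in> A" "x \<in> chart_dom c" using chart_at[OF x] by (auto simp: c_def)
  have d: "d \<in> A" "\<phi> x \<in> chart_dom d"
    using chart_at[OF smooth_self_map_in_topspace[OF \<psi>(1) x]] by (auto simp: d_def)
  let ?U = "{x \<in> chart_dom c. \<phi> x \<in> chart_dom d}"
  let ?F = "coord d \<circ> \<phi> \<circ> chart_inv c"
  have rep: "smooth_rep c d \<phi> ?U" by (rule smooth_self_map_rep[OF \<psi>(1) c(1) d(1)])
  have "coord_laplacian (g' c \<circ> chart_inv c) (f' \<circ> chart_inv c) (coord c x) =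
      coord_laplacian (g d \<circ> chart_inv d) (f \<circ> chart_inv d) (?F (coord c x))"
  proof (rule coord_laplacian_pullback[OF smooth_rep_open[OF rep] _ open_chart_img[OF d(1)]])
    show "coord c x \<in> coord c ` ?U" using c d by blast
    show "?F ` coord c ` ?U \<subseteq> chart_img d" using c by auto
    show "smooth_on ?F (coord c ` ?U)" using rep by (simp add: smooth_rep_def)
    show "smooth_on (g d \<circ> chart_inv d) (chart_img d)" using g d by (simp add: riemannian_metric_def)
    show "smooth_on (f \<circ> chart_inv d) (chart_img d)" using f d by (simp add: smooth_function_def)
    show "det ((g d \<circ> chart_inv d) z) > 0" if "z \<in> chart_img d" for z
      using that d(1) by (auto intro!: det_metric_pos[OF g])
    fix z assume "z \<in> coord c ` ?U"
    then obtain w where w: "w \<in> chart_dom c" "\<phi> w \<in> chart_dom d" "z = coord c w" by blast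
    have wX: "w \<in> topspace X" using w dom_subset[OF c(1)] by blast
    have jac: "jacobian ?F (at z) = Jac c d \<phi> w" by (simp add: Jac_def w)
    have "Jac d c \<psi> (\<phi> w) ** Jac c d \<phi> w = mat 1"
      by (rule Jac_inverse[OF \<psi>(1-3) c(1) d(1) w(1,2)])
    then have "det (Jac d c \<psi> (\<phi> w)) * det (Jac c d \<phi> w) = 1"
      by (metis det_I det_mul)
    then show "det (jacobian ?F (at z)) \<noteq> 0" unfolding jac by auto
    show "(g' c \<circ> chart_inv c) z =
        transpose (jacobian ?F (at z)) ** (g d \<circ> chart_inv d) (?F z) ** jacobian ?F (at z)"
      unfolding jac using pulls_backD[OF pb c(1) d(1) w(1,2)] w c d by simp
    show "(f' \<circ> chart_inv c) z = (f \<circ> chart_inv d) (?F z)"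
      using f'[OF wX] w c d by simp
  qed
  then show ?thesis using c d by (simp add: laplacian_def Let_def c_def[symmetric] d_def[symmetric])
qed

lemma smooth_function_comp:
  assumes \<phi>: "smooth_self_map X A \<phi>" and f: "smooth_function A f"
    and f': "\<And>x. x \<in> topspace X \<Longrightarrow> f' x = f (\<phi> x)"
  shows "smooth_function A f'"
  unfolding smooth_function_def
proof
  fix c assume c: "c \<in> A"
  show "smooth_on (f' \<circ> chart_inv c) (chart_img c)"
  proof (rule smooth_on_local)
    fix y assume "y \<in> chart_img c"
    then obtain x where x: "x \<in> chart_dom c" "y = coord c x" by blast
    obtain d where d: "d \<in> A" "\<phi> x \<in> chart_dom d"
      using ex_chart[OF smooth_self_map_in_topspace[OF \<phi>]] x dom_subset[OF c] by blast
    let ?U = "{x \<in> chart_dom c. \<phi> x \<in> chart_dom d}"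
    have rep: "smooth_rep c d \<phi> ?U" by (rule smooth_self_map_rep[OF \<phi> c d(1)])
    have "smooth_on (\<lambda>y. f (\<phi> (chart_inv c y))) (coord c ` ?U)"
      using f d by (intro smooth_rep_tensor[OF rep]) (simp add: smooth_function_def)
    then have "smooth_on (f' \<circ> chart_inv c) (coord c ` ?U)"
      by (rule smooth_on_cong[OF smooth_rep_open[OF rep], rotated])
        (use f' c dom_subset[OF c] in \<open>auto simp: subset_eq\<close>)
    then show "\<exists>T. open T \<and> y \<in> T \<and> smooth_on (f' \<circ> chart_inv c) T"
      using smooth_rep_open[OF rep] x d by blast
  qed
qed

text \<open>The composition with \<open>\<phi>\<close>, in the normal form used for eigenfunctions: zero off the surface.\<close>

definition pull_fun :: "('a \<Rightarrow> 'a) \<Rightarrow> ('a \<Rightarrow> real) \<Rightarrow> 'a \<Rightarrow> real" where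
  "pull_fun \<phi> f x = (if x \<in> topspace X then f (\<phi> x) else 0)"

lemma pull_fun_eigenspace:
  assumes \<phi>: "diffeomorphism X A \<phi>" and g: "riemannian_metric A g" and pb: "pulls_back \<phi> g g'"
    and f: "f \<in> eigenspace X A g l"
  shows "pull_fun \<phi> f \<in> eigenspace X A g' l"
proof -
  have \<phi>s: "smooth_self_map X A \<phi>" using \<phi> by (simp add: diffeomorphism_def)
  have sm: "smooth_function A f" using f by (simp add: eigenspace_def)
  have eq: "pull_fun \<phi> f x = f (\<phi> x)" if "x \<in> topspace X" for x using that by (simp add: pull_fun_def)
  show ?thesis
    using f smooth_function_comp[OF \<phi>s sm eq] laplacian_pulls_back[OF \<phi> g pb sm eq]
      smooth_self_map_in_topspace[OF \<phi>s]
    by (simp add: eigenspace_def eq) (simp add: pull_fun_def)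
qed

lemma pull_fun_inj:
  assumes "diffeomorphism X A \<phi>" "\<And>x. x \<notin> topspace X \<Longrightarrow> f x = 0" "\<And>x. x \<notin> topspace X \<Longrightarrow> f' x = 0"
    and "pull_fun \<phi> f = pull_fun \<phi> f'"
  shows "f = f'"
proof
  fix x
  obtain \<psi> where "smooth_inverses \<phi> \<psi>"
    using diffeomorphism_smooth_inverse[OF assms(1)] by blast
  note \<psi> = smooth_inversesD[OF this]
  show "f x = f' x"
  proof (cases "x \<in> topspace X")
    case True
    then show ?thesis
      using fun_cong[OF assms(4), of "\<psi> x"] \<psi>(4) smooth_self_map_in_topspace[OF \<psi>(2)]
      by (simp add: pull_fun_def)
  next
    case False
    then show ?thesis using assms by simp
  qed
qed

lemma module_real_functions: "module (\<lambda>(a::real) f x. a * f x :: real)"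
  by (rule module.intro) (simp_all add: fun_eq_iff algebra_simps)

lemma pull_fun_independent:
  assumes \<phi>: "diffeomorphism X A \<phi>" and B: "finite B" "\<And>f x. f \<in> B \<Longrightarrow> x \<notin> topspace X \<Longrightarrow> f x = 0"
    and ind: "\<not> module.dependent (\<lambda>(a::real) f x. a * f x) B"
  shows "\<not> module.dependent (\<lambda>(a::real) f x. a * f x) (pull_fun \<phi> ` B)"
proof
  interpret module "\<lambda>(a::real) f x. a * f x :: real" by (rule module_real_functions)
  have inj: "inj_on (pull_fun \<phi>) B"
    by (rule inj_onI, rule pull_fun_inj[OF \<phi>]) (use B in auto)
  assume "dependent (pull_fun \<phi> ` B)"
  then obtain w where w: "\<exists>v\<in>pull_fun \<phi> ` B. w v \<noteq> 0" "(\<Sum>v\<in>pull_fun \<phi> ` B. (\<lambda>x. w v * v x)) = 0"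
    using B(1) by (auto simp: dependent_finite)
  let ?s = "\<Sum>f\<in>B. (\<lambda>x. w (pull_fun \<phi> f) * f x)"
  have sum: "(\<Sum>f\<in>C. (\<lambda>x. k f * h f x)) x = (\<Sum>f\<in>C. k f * h f x)"
    for C :: "('a \<Rightarrow> real) set" and k and h :: "('a \<Rightarrow> real) \<Rightarrow> 'a \<Rightarrow> real" and x
    by (induction C rule: infinite_finite_induct) auto
  have "?s = 0"
  proof (rule pull_fun_inj[OF \<phi>])
    show "?s x = 0" if "x \<notin> topspace X" for x
      unfolding sum by (rule sum.neutral) (use B(2) that in auto)
    have "pull_fun \<phi> ?s x = (\<Sum>f\<in>B. w (pull_fun \<phi> f) * pull_fun \<phi> f x)" for x
      unfolding pull_fun_def[of \<phi> ?s] sum by (simp add: pull_fun_def)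
    also have "\<dots> x = (\<Sum>v\<in>pull_fun \<phi> ` B. (\<lambda>x. w v * v x)) x" for x
      unfolding sum by (simp add: sum.reindex[OF inj])
    finally show "pull_fun \<phi> ?s = pull_fun \<phi> 0"
      unfolding w(2) by (simp add: fun_eq_iff pull_fun_def)
  qed simp
  then have "dependent B"
    using w(1) B(1) by (auto simp: dependent_finite intro!: exI[of _ "\<lambda>f. w (pull_fun \<phi> f)"])
  then show False using ind by simp
qed

text \<open>Composition with \<open>\<phi>\<close> is linear, injective and maps eigenfunctions to eigenfunctions. Since being
  isometric is a symmetric relation, these one-sided estimates give equality.\<close>

lemma spectrum_multiplicity_le:
  assumes \<phi>: "diffeomorphism X A \<phi>" and g: "riemannian_metric A g" and pb: "pulls_back \<phi> g g'"
  shows "spectrum X A g \<subseteq> spectrum X A g'" "multiplicity X A g l \<le> multiplicity X A g' l"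
proof -
  have zero: "f x = 0" if "f \<in> eigenspace X A g l" "x \<notin> topspace X" for f l x
    using that by (simp add: eigenspace_def)
  show "spectrum X A g \<subseteq> spectrum X A g'"
  proof
    fix l assume "l \<in> spectrum X A g"
    then obtain f where f: "f \<in> eigenspace X A g l" "f \<noteq> (\<lambda>x. 0)" by (auto simp: spectrum_def)
    have "pull_fun \<phi> f \<noteq> pull_fun \<phi> (\<lambda>x. 0)"
      using pull_fun_inj[OF \<phi>, of f "\<lambda>x. 0"] zero[OF f(1)] f(2) by blast
    moreover have "pull_fun \<phi> (\<lambda>x. 0) = (\<lambda>x. 0)" by (simp add: pull_fun_def fun_eq_iff)
    ultimately show "l \<in> spectrum X A g'"
      using pull_fun_eigenspace[OF \<phi> g pb f(1)] unfolding spectrum_def by auto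
  qed
  show "multiplicity X A g l \<le> multiplicity X A g' l"
    unfolding multiplicity_def
  proof (rule SUP_mono)
    fix B assume "B \<in> {B. finite B \<and> B \<subseteq> eigenspace X A g l \<and> \<not> module.dependent (\<lambda>(a::real) f x. a * f x) B}"
    then have B: "finite B" "B \<subseteq> eigenspace X A g l" "\<not> module.dependent (\<lambda>(a::real) f x. a * f x) B"
      by auto
    have zB: "f x = 0" if "f \<in> B" "x \<notin> topspace X" for f x using zero B(2) that by blast
    have "inj_on (pull_fun \<phi>) B"
      by (rule inj_onI, rule pull_fun_inj[OF \<phi>]) (use zB in auto)
    then have card: "card (pull_fun \<phi> ` B) = card B" by (rule card_image)
    have "pull_fun \<phi> ` B \<subseteq> eigenspace X A g' l"
      using pull_fun_eigenspace[OF \<phi> g pb] B(2) by blast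
    moreover have "\<not> module.dependent (\<lambda>(a::real) f x. a * f x) (pull_fun \<phi> ` B)"
      by (rule pull_fun_independent[OF \<phi> B(1) _ B(3)]) (use zB in auto)
    ultimately show "\<exists>C\<in>{B. finite B \<and> B \<subseteq> eigenspace X A g' l \<and> \<not> module.dependent (\<lambda>(a::real) f x. a * f x) B}.
        enat (card B) \<le> enat (card C)"
      using B(1) card
      by (intro bexI[of _ "pull_fun \<phi> ` B"]) auto
  qed
qed

lemma isometric_imp_isospectral:
  assumes g: "riemannian_metric A g" and iso: "isometric X A g g'"
  shows "isospectral X A g g'"
proof -
  obtain \<phi> where \<phi>: "diffeomorphism X A \<phi>" "pulls_back \<phi> g g'"
    using iso isometric_iff[OF g] by blast
  note g' = riemannian_metric_pulls_back[OF \<phi>(1) g \<phi>(2)]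
  obtain \<psi> where \<psi>: "diffeomorphism X A \<psi>" "pulls_back \<psi> g' g"
    using isometric_sym[OF g iso] isometric_iff[OF g'] by blast
  show ?thesis
    unfolding isospectral_def
    using spectrum_multiplicity_le[OF \<phi>(1) g \<phi>(2)] spectrum_multiplicity_le[OF \<psi>(1) g' \<psi>(2)]
    by (auto intro: antisym)
qed

end

section \<open>Diffeomorphisms supported in a chart disc\<close>

lemma smooth_on_funpow:
  fixes f :: "'a::euclidean_space \<Rightarrow> 'a"
  assumes "smooth_on f UNIV"
  shows "smooth_on (f ^^ n) UNIV"
proof (induction n)
  case 0
  then show ?case using smooth_on_ident[of "UNIV :: 'a set"] by (simp add: id_def)
next
  case (Suc n)
  show ?case
    using smooth_on_compose[OF open_UNIV open_UNIV _ Suc assms] by (simp add: o_def)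
qed

lemma funpow_inverse:
  fixes f g :: "'a \<Rightarrow> 'a"
  assumes "\<And>x. g (f x) = x"
  shows "(g ^^ n) ((f ^^ n) x) = x"
proof (induction n arbitrary: x)
  case (Suc n)
  have "(g ^^ Suc n) ((f ^^ Suc n) x) = (g ^^ n) (g (f ((f ^^ n) x)))" by (simp add: funpow_swap1)
  then show ?case using Suc assms by simp
qed simp

locale closed_surface_atlas = compact_surface_atlas +
  assumes Hausdorff: "Hausdorff_space X" and connected: "connected_space X"
begin

text \<open>For a map \<open>\<rho>\<close> of the plane that is the identity outside a compact subset of the chart image,
  this is the map of the surface that looks like \<open>\<rho>\<close> in the chart \<open>c\<close>.\<close>

definition transplant :: "'a chart \<Rightarrow> (real^2 \<Rightarrow> real^2) \<Rightarrow> 'a \<Rightarrow> 'a" where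
  "transplant c \<rho> x = (if x \<in> chart_dom c then chart_inv c (\<rho> (coord c x)) else x)"

text \<open>In the chart domain the map is \<open>\<rho>\<close>. The closed disc is compact, hence closed in the surface, so every point
  outside the chart domain has a neighbourhood on which the map is the identity.\<close>

lemma smooth_self_map_transplant:
  assumes c: "c \<in> A" and B: "cball q R \<subseteq> chart_img c"
    and \<rho>: "smooth_on \<rho> UNIV" "\<And>y. y \<notin> ball q R \<Longrightarrow> \<rho> y = y" "\<And>y. y \<in> ball q R \<Longrightarrow> \<rho> y \<in> ball q R"
  shows "smooth_self_map X A (transplant c \<rho>)"
proof (rule smooth_self_mapI)
  have img: "\<rho> y \<in> chart_img c" if "y \<in> chart_img c" for y
    using that \<rho>(2,3)[of y] B ball_subset_cball[of q R] by (cases "y \<in> ball q R") auto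
  fix x assume x: "x \<in> topspace X"
  show "\<exists>d e U. x \<in> U \<and> smooth_rep d e (transplant c \<rho>) U"
  proof (cases "x \<in> chart_dom c")
    case True
    have eq: "\<rho> y = (coord c \<circ> transplant c \<rho> \<circ> chart_inv c) y" if "y \<in> chart_img c" for y
      using chart_inv_dom[OF that] img[OF that] that by (simp add: transplant_def)
    have "smooth_on (coord c \<circ> transplant c \<rho> \<circ> chart_inv c) (chart_img c)"
      by (rule smooth_on_cong[OF open_chart_img[OF c] eq smooth_on_subset[OF \<rho>(1)]]) auto
    moreover have "transplant c \<rho> z \<in> chart_dom c" if "z \<in> chart_dom c" for z
      using that chart_inv_dom[OF img, of "coord c z"] by (simp add: transplant_def)
    ultimately have "smooth_rep c c (transplant c \<rho>) (chart_dom c)"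
      using c openin_dom[OF c] by (auto simp: smooth_rep_def)
    then show ?thesis using True by blast
  next
    case False
    let ?K = "chart_inv c ` cball q R"
    obtain d where d: "d \<in> A" "x \<in> chart_dom d" using ex_chart[OF x] by blast
    have "closedin X ?K"
      using compactin_imp_closedin[OF Hausdorff compactin_chart_inv_image[OF c compact_cball B]] .
    then have U: "openin X (chart_dom d - ?K)" using openin_dom[OF d(1)] by (rule openin_diff[rotated])
    have "smooth_rep d d id (chart_dom d - ?K)"
      by (rule smooth_rep_subset[OF smooth_rep_id[OF d(1) d(1)] U]) auto
    then have "smooth_rep d d (transplant c \<rho>) (chart_dom d - ?K)"
    proof (rule smooth_rep_cong)
      fix z assume z: "z \<in> chart_dom d - ?K"
      show "id z = transplant c \<rho> z"
      proof (cases "z \<in> chart_dom c")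
        case True
        have "coord c z \<notin> ball q R"
        proof
          assume "coord c z \<in> ball q R"
          then have "chart_inv c (coord c z) \<in> ?K" by (intro imageI) simp
          then show False using z True c by simp
        qed
        then show ?thesis using True c \<rho>(2) by (simp add: transplant_def)
      qed (simp add: transplant_def)
    qed
    moreover have "x \<notin> ?K" using False chart_inv_image_subset[OF B] by blast
    ultimately show ?thesis using d by blast
  qed
qed

lemma diffeomorphism_transplant:
  assumes c: "c \<in> A" and B: "cball q R \<subseteq> chart_img c"
    and \<rho>: "smooth_on \<rho> UNIV" "smooth_on \<sigma> UNIV" "\<And>y. \<sigma> (\<rho> y) = y" "\<And>y. \<rho> (\<sigma> y) = y"
      "\<And>y. y \<notin> ball q R \<Longrightarrow> \<rho> y = y"
  shows "diffeomorphism X A (transplant c \<rho>)"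
proof -
  have \<sigma>: "\<sigma> y = y" if "y \<notin> ball q R" for y using \<rho>(3)[of y] \<rho>(5)[OF that] by simp
  have \<rho>B: "\<rho> y \<in> ball q R" if "y \<in> ball q R" for y using \<sigma>[of "\<rho> y"] \<rho>(3)[of y] that by force
  have \<sigma>B: "\<sigma> y \<in> ball q R" if "y \<in> ball q R" for y using \<rho>(5)[of "\<sigma> y"] \<rho>(4)[of y] that by force
  have sub: "ball q R \<subseteq> chart_img c" using B ball_subset_cball by blast
  have img: "\<rho> y \<in> chart_img c" "\<sigma> y \<in> chart_img c" if "y \<in> chart_img c" for y
    using that \<rho>(5)[of y] \<sigma>[of y] \<rho>B[of y] \<sigma>B[of y] sub by (cases "y \<in> ball q R"; auto)+
  show ?thesis
  proof (rule diffeomorphismI)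
    show "smooth_self_map X A (transplant c \<rho>)"
      by (rule smooth_self_map_transplant[OF c B \<rho>(1,5) \<rho>B])
    show "smooth_self_map X A (transplant c \<sigma>)"
      by (rule smooth_self_map_transplant[OF c B \<rho>(2) \<sigma> \<sigma>B])
    show "transplant c \<sigma> (transplant c \<rho> x) = x" for x
      using img(1)[of "coord c x"] chart_inv_dom[of "\<rho> (coord c x)" c] c \<rho>(3) by (simp add: transplant_def)
    show "transplant c \<rho> (transplant c \<sigma> x) = x" for x
      using img(2)[of "coord c x"] chart_inv_dom[of "\<sigma> (coord c x)" c] c \<rho>(4) by (simp add: transplant_def)
  qed
qed

text \<open>The iterates of the expanding diffeomorphism do this: the parts of the disc that they leave uncovered
  decrease to the empty set, so their areas tend to zero.\<close>

lemma expand_in_chart_disc: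
  assumes g: "g \<in> unit_area_metrics X A"
    and c: "c \<in> A" and R: "R > 0" "cball q R \<subseteq> chart_img c"
    and V: "openin X V" "chart_inv c q \<in> V" and eps: "\<epsilon> > 0"
  obtains \<phi> where "diffeomorphism X A \<phi>" "\<And>x. x \<notin> chart_inv c ` ball q R \<Longrightarrow> \<phi> x = x"
    "emeasure (area_measure X A g) (chart_inv c ` ball q R - \<phi> ` V) < \<epsilon>"
proof -
  have gm: "riemannian_metric A g" using g by (simp add: unit_area_metrics_def)
  let ?\<mu> = "area_measure X A g" and ?D = "chart_inv c ` ball q R"
  have sub: "ball q R \<subseteq> chart_img c" using R(2) ball_subset_cball by blast
  have D: "?D \<subseteq> chart_dom c" using chart_inv_image_subset[OF sub] .
  obtain \<rho> \<sigma> where sm: "smooth_on \<rho> UNIV" "smooth_on \<sigma> UNIV" and inv: "\<And>x. \<sigma> (\<rho> x) = x" "\<And>x. \<rho> (\<sigma> x) = x"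
    and out: "\<And>x. x \<notin> ball q R \<Longrightarrow> \<rho> x = x" and le: "\<And>x. dist q (\<sigma> x) \<le> dist q x"
    and lim: "\<And>x. x \<in> ball q R \<Longrightarrow> (\<lambda>n. (\<sigma> ^^ n) x) \<longlonglongrightarrow> q"
    using expanding_diffeomorphism_ball[OF R(1), of q] by blast
  have outn: "(\<rho> ^^ n) y = y" if "y \<notin> ball q R" for n y
    using out[OF that] by (induction n) auto
  have invn: "(\<sigma> ^^ n) ((\<rho> ^^ n) y) = y" "(\<rho> ^^ n) ((\<sigma> ^^ n) y) = y" for n y
    by (rule funpow_inverse, rule inv)+
  define \<Phi> where "\<Phi> n = transplant c (\<rho> ^^ n)" for n
  have \<Phi>: "diffeomorphism X A (\<Phi> n)" for n
    unfolding \<Phi>_def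
    by (rule diffeomorphism_transplant[OF c R(2) smooth_on_funpow[OF sm(1)] smooth_on_funpow[OF sm(2)]
          invn outn])
  have \<Phi>out: "\<Phi> n x = x" if "x \<notin> ?D" for n x
  proof (cases "x \<in> chart_dom c")
    case True
    then have "coord c x \<notin> ball q R" using that c by (metis chart_inv_coord imageI)
    then show ?thesis using True c outn by (simp add: \<Phi>_def transplant_def)
  qed (simp add: \<Phi>_def transplant_def)
  have qc: "q \<in> chart_img c" using sub R(1) by auto
  let ?W = "coord c ` (V \<inter> chart_dom c)"
  have "open ?W" using V openin_dom[OF c] by (intro open_coord_image[OF c]) auto
  moreover have "q \<in> ?W"
    using V(2) qc chart_inv_dom[OF qc] coord_chart_inv[OF qc] by (metis IntI imageI)
  ultimately obtain \<delta> where \<delta>: "\<delta> > 0" "ball q \<delta> \<subseteq> ?W" using openE by blast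
  \<comment> \<open>The points of the disc that \<open>\<Phi> n\<close> reaches from the small ball around the centre.\<close>
  define E where "E n = chart_inv c ` {y \<in> ball q R. (\<sigma> ^^ n) y \<in> ball q \<delta>}" for n
  have E_sub: "E n \<subseteq> \<Phi> n ` V" for n
  proof
    fix x assume "x \<in> E n"
    then obtain y where y: "y \<in> ball q R" "(\<sigma> ^^ n) y \<in> ball q \<delta>" "x = chart_inv c y"
      by (auto simp: E_def)
    obtain v where v: "v \<in> V" "v \<in> chart_dom c" "(\<sigma> ^^ n) y = coord c v" using y(2) \<delta>(2) by blast
    have "\<Phi> n v = chart_inv c ((\<rho> ^^ n) ((\<sigma> ^^ n) y))" using v by (simp add: \<Phi>_def transplant_def)
    then have "\<Phi> n v = x" using invn(2) y(3) by simp
    then show "x \<in> \<Phi> n ` V" using v(1) by blast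
  qed
  have E_open: "openin X (E n)" for n
  proof -
    have "continuous_on UNIV (\<sigma> ^^ n)" using smooth_on_continuous_on smooth_on_funpow[OF sm(2)] by blast
    then have "open ((\<sigma> ^^ n) -` ball q \<delta>)" by (intro open_vimage) auto
    then have "open (ball q R \<inter> (\<sigma> ^^ n) -` ball q \<delta>)" by (intro open_Int) auto
    moreover have "ball q R \<inter> (\<sigma> ^^ n) -` ball q \<delta> = {y \<in> ball q R. (\<sigma> ^^ n) y \<in> ball q \<delta>}" by blast
    ultimately show ?thesis
      unfolding E_def using sub by (intro openin_chart_inv_image[OF c]) auto
  qed
  have E_mono: "E n \<subseteq> E (Suc n)" for n
  proof -
    have "dist q ((\<sigma> ^^ Suc n) y) \<le> dist q ((\<sigma> ^^ n) y)" for y using le by simp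
    then show ?thesis unfolding E_def by (intro image_mono) (auto intro: order.strict_trans1)
  qed
  have E_cover: "?D \<subseteq> (\<Union>n. E n)"
  proof
    fix x assume "x \<in> ?D"
    then obtain y where y: "y \<in> ball q R" "x = chart_inv c y" by blast
    have "\<forall>\<^sub>F n in sequentially. dist ((\<sigma> ^^ n) y) q < \<delta>" using tendstoD[OF lim[OF y(1)] \<delta>(1)] .
    then obtain n where "dist ((\<sigma> ^^ n) y) q < \<delta>" using eventually_happens' sequentially_bot by blast
    then have "x \<in> E n" using y by (auto simp: E_def dist_commute)
    then show "x \<in> (\<Union>n. E n)" by blast
  qed
  interpret sigma_algebra "topspace X" "borel_sets X" by (rule sigma_algebra_borel_sets)
  have Dopen: "openin X ?D" by (rule openin_chart_inv_image[OF c open_ball sub])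
  have DE: "?D - E n \<in> sets ?\<mu>" for n
    unfolding sets_area_measure[OF gm] using open_borel[OF Dopen] open_borel[OF E_open] by blast
  have fin: "emeasure ?\<mu> B \<noteq> \<infinity>" for B
  proof -
    have "emeasure ?\<mu> B \<le> emeasure ?\<mu> (space ?\<mu>)" by (rule emeasure_space)
    also have "\<dots> = 1" using g by (simp add: unit_area_metrics_def space_area_measure)
    finally show ?thesis by (auto simp: top_unique)
  qed
  have "(\<lambda>n. emeasure ?\<mu> (?D - E n)) \<longlonglongrightarrow> emeasure ?\<mu> (\<Inter>n. ?D - E n)"
  proof (rule Lim_emeasure_decseq[OF _ _ fin])
    show "range (\<lambda>n. ?D - E n) \<subseteq> sets ?\<mu>" using DE by blast
    show "decseq (\<lambda>n. ?D - E n)" by (rule decseq_SucI) (use E_mono in blast)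
  qed
  also have "(\<Inter>n. ?D - E n) = {}" using E_cover by blast
  finally have "(\<lambda>n. emeasure ?\<mu> (?D - E n)) \<longlonglongrightarrow> 0" by simp
  then have "\<forall>\<^sub>F n in sequentially. emeasure ?\<mu> (?D - E n) < \<epsilon>" using eps by (rule order_tendstoD)
  then obtain n where n: "emeasure ?\<mu> (?D - E n) < \<epsilon>" using eventually_happens' sequentially_bot by blast
  have "emeasure ?\<mu> (?D - \<Phi> n ` V) \<le> emeasure ?\<mu> (?D - E n)"
    using E_sub DE by (intro emeasure_mono) auto
  then have "emeasure ?\<mu> (?D - \<Phi> n ` V) < \<epsilon>" using n by (rule order.strict_trans1)
  then show thesis by (intro that[of "\<Phi> n"] \<Phi> \<Phi>out)
qed

section \<open>Filling the surface\<close>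

text \<open>The chart disc has to leave room: a disc of twice the radius around any of its points
  contains it and still lies inside the chart.\<close>

definition roomy_disc :: "'a set \<Rightarrow> bool" where
  "roomy_disc D \<longleftrightarrow> (\<exists>c\<in>A. \<exists>y r. 0 < r \<and> cball y (3 * r) \<subseteq> chart_img c \<and> D = chart_inv c ` ball y r)"

lemma roomy_disc_openin: "roomy_disc D \<Longrightarrow> openin X D"
  unfolding roomy_disc_def
proof (elim bexE exE conjE)
  fix c y r assume "c \<in> A" "0 < (r::real)" "cball y (3 * r) \<subseteq> chart_img c" and D: "D = chart_inv c ` ball y r"
  moreover have "ball y r \<subseteq> cball y (3 * r)" using \<open>0 < r\<close> by auto
  ultimately show "openin X D" unfolding D by (intro openin_chart_inv_image) auto
qed

lemma ex_roomy_disc: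
  assumes "x \<in> topspace X"
  shows "\<exists>D. roomy_disc D \<and> x \<in> D"
proof -
  obtain c where c: "c \<in> A" "x \<in> chart_dom c" using ex_chart[OF assms] by blast
  obtain e where e: "e > 0" "cball (coord c x) e \<subseteq> chart_img c"
    using open_contains_cball open_chart_img[OF c(1)] c(2) by blast
  have "x \<in> chart_inv c ` ball (coord c x) (e / 3)"
    by (rule image_eqI[of _ _ "coord c x"]) (use c e in auto)
  moreover have "roomy_disc (chart_inv c ` ball (coord c x) (e / 3))"
    unfolding roomy_disc_def using c e by (intro bexI[of _ c] exI[of _ "coord c x"] exI[of _ "e / 3"]) auto
  ultimately show ?thesis by blast
qed

text \<open>An open set that meets the disc can be expanded until it covers the disc up to a set of small area,
  and nothing is lost elsewhere: the diffeomorphism moves points only inside a larger disc,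
  which gets filled as well.\<close>

lemma expand_over_disc:
  assumes g: "g \<in> unit_area_metrics X A" and D: "roomy_disc D" and V: "openin X V" "V \<inter> D \<noteq> {}"
    and eps: "\<epsilon> > 0"
  obtains \<phi> N where "diffeomorphism X A \<phi>" "N \<in> borel_sets X" "emeasure (area_measure X A g) N < \<epsilon>"
    "\<And>S. (S \<union> D) - \<phi> ` V \<subseteq> N \<union> (S - V)"
proof -
  obtain c y r where c: "c \<in> A" and r: "0 < r" "cball y (3 * r) \<subseteq> chart_img c"
    and Dd: "D = chart_inv c ` ball y r"
    using D by (auto simp: roomy_disc_def)
  obtain q where q: "q \<in> ball y r" "chart_inv c q \<in> V" using V(2) Dd by blast
  have sub: "cball q (2 * r) \<subseteq> cball y (3 * r)" "ball y r \<subseteq> ball q (2 * r)"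
    using q(1) by (auto simp: cball_subset_cball_iff ball_subset_ball_iff dist_commute)
  have B: "cball q (2 * r) \<subseteq> chart_img c" using sub(1) r(2) by blast
  obtain \<phi> where \<phi>: "diffeomorphism X A \<phi>" "\<And>x. x \<notin> chart_inv c ` ball q (2 * r) \<Longrightarrow> \<phi> x = x"
    "emeasure (area_measure X A g) (chart_inv c ` ball q (2 * r) - \<phi> ` V) < \<epsilon>"
    using expand_in_chart_disc[OF g c _ B V(1) q(2) eps] r(1) by auto
  let ?D' = "chart_inv c ` ball q (2 * r)"
  interpret sigma_algebra "topspace X" "borel_sets X" by (rule sigma_algebra_borel_sets)
  have "openin X ?D'" using B ball_subset_cball by (intro openin_chart_inv_image[OF c]) blast+
  then have "?D' - \<phi> ` V \<in> borel_sets X"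
    using diffeomorphism_image_borel[OF \<phi>(1) open_borel[OF V(1)]] open_borel by blast
  moreover have "(S \<union> D) - \<phi> ` V \<subseteq> (?D' - \<phi> ` V) \<union> (S - V)" for S
  proof
    fix x assume x: "x \<in> (S \<union> D) - \<phi> ` V"
    show "x \<in> (?D' - \<phi> ` V) \<union> (S - V)"
    proof (cases "x \<in> ?D'")
      case False
      then have "x \<in> S" using x Dd sub(2) by blast
      moreover have "x \<notin> V" using \<phi>(2)[OF False] x by (metis DiffD2 imageI)
      ultimately show ?thesis by blast
    qed (use x in blast)
  qed
  ultimately show thesis using that[OF \<phi>(1) _ \<phi>(3)] by blast
qed

definition fillable :: "'a tensor2 \<Rightarrow> 'a set \<Rightarrow> 'a set \<Rightarrow> bool" where
  "fillable g Q S \<longleftrightarrow> openin X S \<and>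
     (\<forall>\<epsilon>>0. \<exists>\<phi>. diffeomorphism X A \<phi> \<and> emeasure (area_measure X A g) (S - \<phi> ` Q) < \<epsilon>)"

lemma diffeomorphism_openin_image:
  assumes "diffeomorphism X A \<phi>" "openin X V"
  shows "openin X (\<phi> ` V)"
proof -
  obtain \<psi> where "smooth_inverses \<phi> \<psi>"
    using diffeomorphism_smooth_inverse[OF assms(1)] by blast
  note \<psi> = smooth_inversesD[OF this]
  have "\<phi> ` V = {y \<in> topspace X. \<psi> y \<in> V}"
    by (rule diffeomorphism_image_eq[OF \<psi>(3,4,1,2) openin_subset[OF assms(2)]])
  then show ?thesis using openin_self_map_preimage[OF \<psi>(2) assms(2)] by simp
qed

lemma fillable_disc:
  assumes g: "g \<in> unit_area_metrics X A" and Q: "openin X Q" and D: "roomy_disc D" "Q \<inter> D \<noteq> {}"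
  shows "fillable g Q D"
  unfolding fillable_def
proof (intro conjI allI impI roomy_disc_openin D(1))
  have gm: "riemannian_metric A g" using g by (simp add: unit_area_metrics_def)
  fix \<epsilon> :: ennreal assume "\<epsilon> > 0"
  then obtain \<phi> N where \<phi>: "diffeomorphism X A \<phi>" "N \<in> borel_sets X" "emeasure (area_measure X A g) N < \<epsilon>"
    "\<And>S. (S \<union> D) - \<phi> ` Q \<subseteq> N \<union> (S - Q)"
    using expand_over_disc[OF g D(1) Q D(2)] by metis
  have "emeasure (area_measure X A g) (D - \<phi> ` Q) \<le> emeasure (area_measure X A g) N"
    using \<phi>(2) \<phi>(4)[of "{}"] by (intro emeasure_mono) (auto simp: sets_area_measure[OF gm])
  then show "\<exists>\<phi>. diffeomorphism X A \<phi> \<and> emeasure (area_measure X A g) (D - \<phi> ` Q) < \<epsilon>"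
    using \<phi>(1,3) by (metis order.strict_trans1)
qed

text \<open>A diffeomorphism that fills \<open>S\<close> well enough brings \<open>Q\<close> into the disc; a second one then fills the
  disc without uncovering more of \<open>S\<close>.\<close>

lemma fillable_Un_disc:
  assumes g: "g \<in> unit_area_metrics X A" and Q: "openin X Q"
    and S: "fillable g Q S" and D: "roomy_disc D" "S \<inter> D \<noteq> {}"
  shows "fillable g Q (S \<union> D)"
  unfolding fillable_def
proof (intro conjI allI impI)
  have gm: "riemannian_metric A g" using g by (simp add: unit_area_metrics_def)
  let ?\<mu> = "area_measure X A g"
  have So: "openin X S" using S by (simp add: fillable_def)
  have Do: "openin X D" by (rule roomy_disc_openin[OF D(1)])
  show "openin X (S \<union> D)" using So Do by blast
  interpret sigma_algebra "topspace X" "borel_sets X" by (rule sigma_algebra_borel_sets)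
  fix \<epsilon> :: ennreal assume eps: "\<epsilon> > 0"
  have half: "\<epsilon> / 2 > 0" using eps by (simp add: ennreal_zero_less_divide)
  have meet: "emeasure ?\<mu> (S \<inter> D) > 0" using So Do D(2) by (intro area_open_pos[OF gm]) auto
  \<comment> \<open>If less than the area of the intersection is missing, then the image of \<open>Q\<close> meets the disc.\<close>
  then have "min (\<epsilon> / 2) (emeasure ?\<mu> (S \<inter> D)) > 0" using half by simp
  then obtain \<phi> where \<phi>: "diffeomorphism X A \<phi>"
    "emeasure ?\<mu> (S - \<phi> ` Q) < min (\<epsilon> / 2) (emeasure ?\<mu> (S \<inter> D))"
    using S unfolding fillable_def by blast
  let ?V = "\<phi> ` Q"
  have V: "openin X ?V" using diffeomorphism_openin_image[OF \<phi>(1) Q] .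
  have SV: "S - ?V \<in> borel_sets X" using open_borel[OF So] open_borel[OF V] by blast
  have "?V \<inter> D \<noteq> {}"
  proof
    assume "?V \<inter> D = {}"
    then have "emeasure ?\<mu> (S \<inter> D) \<le> emeasure ?\<mu> (S - ?V)"
      using SV by (intro emeasure_mono) (auto simp: sets_area_measure[OF gm])
    then show False using \<phi>(2) by (metis leD min_less_iff_conj)
  qed
  then obtain \<theta> N where \<theta>: "diffeomorphism X A \<theta>" "N \<in> borel_sets X" "emeasure ?\<mu> N < \<epsilon> / 2"
    "\<And>S. (S \<union> D) - \<theta> ` ?V \<subseteq> N \<union> (S - ?V)"
    using expand_over_disc[OF g D(1) V _ half] by metis
  have "emeasure ?\<mu> ((S \<union> D) - (\<theta> \<circ> \<phi>) ` Q) \<le> emeasure ?\<mu> (N \<union> (S - ?V))"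
    using \<theta>(2) \<theta>(4)[of S] SV by (intro emeasure_mono) (auto simp: sets_area_measure[OF gm] image_comp[symmetric])
  also have "\<dots> \<le> emeasure ?\<mu> N + emeasure ?\<mu> (S - ?V)"
    using \<theta>(2) SV by (intro emeasure_subadditive) (auto simp: sets_area_measure[OF gm])
  also have "\<dots> < \<epsilon> / 2 + \<epsilon> / 2" using \<theta>(3) \<phi>(2) by (intro add_strict_mono) auto
  also have "\<dots> = (\<epsilon> * 2) / 2" by (simp only: add_divide_distrib_ennreal[symmetric] mult_2_right)
  also have "\<dots> = \<epsilon>" by (rule mult_divide_eq_ennreal) simp_all
  finally show "\<exists>\<phi>. diffeomorphism X A \<phi> \<and> emeasure ?\<mu> ((S \<union> D) - \<phi> ` Q) < \<epsilon>"
    using diffeomorphism_comp[OF \<phi>(1) \<theta>(1)] by blast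
qed

text \<open>Among the families of discs from a finite cover with fillable union, take a maximal one. No further
  disc of the cover meets its union, so by connectedness the union is everything.\<close>

lemma fillable_topspace:
  assumes g: "g \<in> unit_area_metrics X A" and Q: "openin X Q" "Q \<noteq> {}"
  shows "fillable g Q (topspace X)"
proof -
  obtain p where p: "p \<in> Q" "p \<in> topspace X" using Q openin_subset by blast
  obtain D0 where D0: "roomy_disc D0" "p \<in> D0" using ex_roomy_disc[OF p(2)] by blast
  have "\<exists>F. finite F \<and> F \<subseteq> Collect roomy_disc \<and> topspace X \<subseteq> \<Union>F"
  proof -
    have "topspace X \<subseteq> \<Union>(Collect roomy_disc)" using ex_roomy_disc by blast
    moreover have "\<And>U. U \<in> Collect roomy_disc \<Longrightarrow> openin X U" using roomy_disc_openin by blast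
    ultimately show ?thesis using compact unfolding compact_space_alt by (metis (no_types, lifting))
  qed
  then obtain F where F: "finite F" "F \<subseteq> Collect roomy_disc" "topspace X \<subseteq> \<Union>F" by blast
  let ?\<C> = "{C. C \<subseteq> insert D0 F \<and> C \<noteq> {} \<and> fillable g Q (\<Union>C)}"
  have "{D0} \<in> ?\<C>" using fillable_disc[OF g Q(1) D0(1)] p(1) D0(2) by auto
  moreover have "finite ?\<C>"
    by (rule finite_subset[of _ "Pow (insert D0 F)"]) (use F(1) in auto)
  ultimately obtain C where C: "C \<in> ?\<C>" "\<And>B. B \<in> ?\<C> \<Longrightarrow> C \<subseteq> B \<Longrightarrow> B = C"
    using finite_has_maximal[of ?\<C>] by (metis (no_types, lifting) empty_iff)
  have Cs: "C \<subseteq> insert D0 F" "C \<noteq> {}" "fillable g Q (\<Union>C)" using C(1) by auto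
  have roomy: "roomy_disc D" if "D \<in> insert D0 F" for D using that F(2) D0(1) by blast
  have disj: "\<Union>C \<inter> D = {}" if D: "D \<in> F" "D \<notin> C" for D
  proof (rule ccontr)
    assume "\<Union>C \<inter> D \<noteq> {}"
    then have "fillable g Q (\<Union>C \<union> D)"
      using D roomy by (intro fillable_Un_disc[OF g Q(1) Cs(3)]) auto
    then have "insert D C \<in> ?\<C>" using Cs D by (auto simp: Un_commute)
    then show False using C(2)[of "insert D C"] D by blast
  qed
  let ?U = "\<Union>(F - C)"
  have "openin X (\<Union>C)" using Cs(3) by (simp add: fillable_def)
  moreover have "openin X ?U" using roomy_disc_openin roomy by (intro openin_Union) blast
  moreover have "topspace X \<subseteq> \<Union>C \<union> ?U" using F(3) by blast
  moreover have "\<Union>C \<inter> ?U = {}" using disj by blast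
  moreover have "\<Union>C \<noteq> {}"
  proof -
    obtain D where "D \<in> C" using Cs(2) by blast
    then have "roomy_disc D" using Cs(1) roomy by blast
    then have "D \<noteq> {}" by (auto simp: roomy_disc_def)
    then show ?thesis using \<open>D \<in> C\<close> by blast
  qed
  ultimately have "?U = {}"
    using connected unfolding connected_space_def by metis
  then have "topspace X \<subseteq> \<Union>C" using F(3) by blast
  moreover have "\<Union>C \<subseteq> topspace X" using \<open>openin X (\<Union>C)\<close> openin_subset by blast
  ultimately show ?thesis using Cs(3) by (simp add: subset_antisym)
qed

lemma shrinking_neighbourhoods:
  assumes p: "p \<in> topspace X"
  obtains B :: "nat \<Rightarrow> 'a set" where "\<And>n. openin X (B n)" "\<And>n. p \<in> B n"
    "\<And>U. openin X U \<Longrightarrow> p \<in> U \<Longrightarrow> \<forall>\<^sub>F n in sequentially. B n \<subseteq> U"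
proof -
  obtain c where c: "c \<in> A" "p \<in> chart_dom c" using ex_chart[OF p] by blast
  let ?b = "\<lambda>n. ball (coord c p) (inverse (real (Suc n))) \<inter> chart_img c"
  show thesis
  proof
    show "openin X (chart_inv c ` ?b n)" for n
      using open_chart_img[OF c(1)] by (intro openin_chart_inv_image[OF c(1)]) auto
    show "p \<in> chart_inv c ` ?b n" for n
      by (rule image_eqI[of _ _ "coord c p"]) (use c in auto)
    fix U assume U: "openin X U" "p \<in> U"
    have "open (coord c ` (U \<inter> chart_dom c))"
      using U openin_dom[OF c(1)] by (intro open_coord_image[OF c(1)]) auto
    then obtain e where e: "e > 0" "ball (coord c p) e \<subseteq> coord c ` (U \<inter> chart_dom c)"
      using U(2) c(2) openE by (metis IntI imageI)
    have "\<forall>\<^sub>F n in sequentially. inverse (real (Suc n)) < e"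
      using LIMSEQ_inverse_real_of_nat e(1) by (rule order_tendstoD)
    then show "\<forall>\<^sub>F n in sequentially. chart_inv c ` ?b n \<subseteq> U"
    proof eventually_elim
      case (elim n)
      show ?case
      proof
        fix x assume "x \<in> chart_inv c ` ?b n"
        then obtain y where y: "y \<in> ball (coord c p) (inverse (real (Suc n)))" "x = chart_inv c y" by blast
        then have "y \<in> ball (coord c p) e" using elim by simp
        then obtain u where "u \<in> U" "u \<in> chart_dom c" "y = coord c u" using e(2) by blast
        then show "x \<in> U" using y c by simp
      qed
    qed
  qed
qed

text \<open>The diffeomorphism \<open>\<phi> n\<close> spreads the \<open>n\<close>-th member of a shrinking sequence of neighbourhoods of \<open>p\<close> over
  the surface, up to area \<open>1 / (n + 1)\<close>. A fixed neighbourhood of \<open>p\<close> contains almost all of these members.\<close>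

lemma ex_concentrating_isometric_metrics:
  assumes g: "g \<in> unit_area_metrics X A" and p: "p \<in> topspace X"
  shows "\<exists>gs. (\<forall>n. gs n \<in> unit_area_metrics X A \<and> isometric X A g (gs n)) \<and> concentrates_to X A gs p"
proof -
  have gm: "riemannian_metric A g" and one: "emeasure (area_measure X A g) (topspace X) = 1"
    using g by (auto simp: unit_area_metrics_def)
  let ?\<mu> = "area_measure X A g"
  obtain B :: "nat \<Rightarrow> 'a set" where B: "\<And>n. openin X (B n)" "\<And>n. p \<in> B n"
    "\<And>U. openin X U \<Longrightarrow> p \<in> U \<Longrightarrow> \<forall>\<^sub>F n in sequentially. B n \<subseteq> U"
    using shrinking_neighbourhoods[OF p] by metis
  have "\<exists>\<phi>. diffeomorphism X A \<phi> \<and> emeasure ?\<mu> (topspace X - \<phi> ` B n) < ennreal (inverse (real (Suc n)))" for n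
  proof -
    have "fillable g (B n) (topspace X)" using B(2) by (intro fillable_topspace[OF g B(1)]) auto
    moreover have "ennreal (inverse (real (Suc n))) > 0" by simp
    ultimately show ?thesis unfolding fillable_def by blast
  qed
  then obtain \<phi> where \<phi>: "\<And>n. diffeomorphism X A (\<phi> n)"
    "\<And>n. emeasure ?\<mu> (topspace X - \<phi> n ` B n) < ennreal (inverse (real (Suc n)))"
    by metis
  define gs where "gs n = pullback A (\<phi> n) g" for n
  have pb: "pulls_back (\<phi> n) g (gs n)" for n
    using \<phi>(1)[of n] by (intro pulls_back_pullback gm) (auto simp: gs_def diffeomorphism_def)
  have unit: "gs n \<in> unit_area_metrics X A" for n
    by (rule unit_area_pulls_back[OF \<phi>(1) g pb])
  have iso: "isometric X A g (gs n)" for n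
    using isometric_iff[OF gm] \<phi>(1) pb by blast
  have "concentrates_to X A gs p"
    unfolding concentrates_to_def
  proof (intro ballI impI, elim exE conjE)
    fix N U assume N: "N \<in> borel_sets X" and U: "openin X U" "p \<in> U" "U \<subseteq> N"
    have area: "emeasure (area_measure X A (gs n)) N = emeasure ?\<mu> (\<phi> n ` N)" for n
      by (rule area_measure_pulls_back[OF \<phi>(1) gm pb N])
    have upper: "emeasure ?\<mu> (\<phi> n ` N) \<le> 1" for n
      using emeasure_space[of ?\<mu> "\<phi> n ` N"] one by (simp add: space_area_measure[OF gm])
    have lower: "\<forall>\<^sub>F n in sequentially. ennreal (1 - inverse (real (Suc n))) \<le> emeasure ?\<mu> (\<phi> n ` N)"
      using B(3)[OF U(1,2)]
    proof eventually_elim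
      case (elim n)
      interpret sigma_algebra "topspace X" "borel_sets X" by (rule sigma_algebra_borel_sets)
      let ?e = "ennreal (inverse (real (Suc n)))"
      have img: "\<phi> n ` N \<in> borel_sets X" "\<phi> n ` B n \<in> borel_sets X"
        using diffeomorphism_image_borel[OF \<phi>(1)] N open_borel[OF B(1)] by auto
      have "1 \<le> emeasure ?\<mu> (\<phi> n ` N \<union> (topspace X - \<phi> n ` B n))"
        unfolding one[symmetric] using img elim U(3)
        by (intro emeasure_mono) (auto simp: sets_area_measure[OF gm])
      also have "\<dots> \<le> emeasure ?\<mu> (\<phi> n ` N) + emeasure ?\<mu> (topspace X - \<phi> n ` B n)"
        using img by (intro emeasure_subadditive) (auto simp: sets_area_measure[OF gm])
      also have "\<dots> \<le> emeasure ?\<mu> (\<phi> n ` N) + ?e"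
        using \<phi>(2)[of n] by (intro add_left_mono) simp
      finally have "1 - ?e \<le> emeasure ?\<mu> (\<phi> n ` N)"
        by (simp add: ennreal_minus_le_iff add.commute)
      then show ?case by (simp add: ennreal_minus ennreal_1[symmetric] del: ennreal_1)
    qed
    have "(\<lambda>n. 1 - inverse (real (Suc n))) \<longlonglongrightarrow> 1 - 0"
      by (intro tendsto_diff tendsto_const LIMSEQ_inverse_real_of_nat)
    then have "(\<lambda>n. ennreal (1 - inverse (real (Suc n)))) \<longlonglongrightarrow> ennreal (1 - 0)"
      by (rule tendsto_ennrealI)
    then have "(\<lambda>n. emeasure ?\<mu> (\<phi> n ` N)) \<longlonglongrightarrow> 1"
      using lower upper by (intro tendsto_sandwich[OF lower _ _ tendsto_const]) auto
    then show "(\<lambda>n. emeasure (area_measure X A (gs n)) N) \<longlonglongrightarrow> 1" by (simp add: area)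
  qed
  then show ?thesis using unit iso by blast
qed

end

theorem proposition1p1p2:
  fixes X :: "'a topology" and A :: "'a chart set" and g0 :: "'a tensor2" and p :: 'a
  assumes "closed_surface X A"
    and "g0 \<in> unit_area_metrics X A"
    and "p \<in> topspace X"
  shows "\<exists>g :: nat \<Rightarrow> 'a tensor2.
    (\<forall>n\<ge>1. g n \<in> unit_area_metrics X A \<and> isometric X A g0 (g n)) \<and>
    (\<forall>m\<ge>1. \<forall>n\<ge>1. isometric X A (g m) (g n)) \<and>
    concentrates_to X A g p \<and>
    (\<forall>m\<ge>1. \<forall>n\<ge>1. isospectral X A (g m) (g n))"
proof -
  interpret closed_surface_atlas X A
    using assms(1) by unfold_locales (auto simp: closed_surface_def)
  obtain g :: "nat \<Rightarrow> 'a tensor2" where g: "\<And>n. g n \<in> unit_area_metrics X A" "\<And>n. isometric X A g0 (g n)"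
    "concentrates_to X A g p"
    using ex_concentrating_isometric_metrics[OF assms(2,3)] by blast
  have metric: "riemannian_metric A g0" "riemannian_metric A (g n)" for n
    using assms(2) g(1) by (auto simp: unit_area_metrics_def)
  have iso: "isometric X A (g m) (g n)" for m n
    by (rule isometric_trans[OF metric(2) isometric_sym[OF metric(1) g(2)] g(2)])
  have "isospectral X A (g m) (g n)" for m n
    by (rule isometric_imp_isospectral[OF metric(2) iso])
  then show ?thesis using g iso by blast
qed

end
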